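(* Let $m\ge 1$ be an integer, let $K\subset \mathbb{R}$ be a compact set, and let $F=(F^k)_{k=0}^m$, $G=(G^k)_{k=0}^m$, $H=(H^k)_{k=0}^m$ be jets of order $m$ on $K$. Then the triple $(F,G,H)$ extends to a $C^m$ horizontal curve $(f,g,h)\colon \mathbb{R}\to\mathbb{H}^1$ if and only if the following three conditions hold: (1) $F$, $G$, and $H$ are Whitney fields of class $C^m$ on $K$; (2) for every $1\le k\le m$ and every $t\in K$, $$H^{k}(t) = \mathcal{P}^k \left(F^0(t),G^0(t),F^1(t),G^1(t),\dots,F^{k}(t),G^{k}(t)\right);$$ (3) $A(a,b)/V(a,b)\to 0$ uniformly as $(b-a)\searrow 0$ with $a,b\in K$, i.e. for every $\varepsilon>0$ there is $\delta>0$ such that $|A(a,b)|\le \varepsilon V(a,b)$ for all $a,b\in K$ with $0<b-a<\delta$.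
   Context: Heisenberg group: $\mathbb{H}^1$ is $\mathbb{R}^3$ with group law $(x,y,t)(x',y',t')=(x+x',y+y',t+t'+2(yx'-xy'))$ and horizontal vector fields $X=\partial_x+2y\partial_t$, $Y=\partial_y-2x\partial_t$. An absolutely continuous curve is horizontal if at almost every time its derivative lies in the span of $X,Y$ at the point of the curve; for a $C^m$ curve $(f,g,h)$ with $m\ge1$ this means $h'=2(f'g-g'f)$ everywhere. Jets: a jet of order $m$ on $K\subset\mathbb{R}$ is a collection $F=(F^k)_{k=0}^m$ of continuous real-valued functions on $K$; one writes $F(x)=F^0(x)$. For $a\in K$ the Taylor polynomial is $T_a^mF(x)=\sum_{k=0}^m \frac{F^k(a)}{k!}(x-a)^k$, $x\in\mathbb{R}$. The jet $F$ is a Whitney field of class $C^m$ on $K$ if for every $0\le k\le m$, $F^k(b)-\sum_{\ell=0}^{m-k}\frac{F^{k+\ell}(a)}{\ell!}(b-a)^\ell=o(|a-b|^{m-k})$ uniformly as $|a-b|\to0$ with $a,b\in K$. The triple $(F,G,H)$ of jets of order $m$ on $K$ extends to the $C^m$ horizontal curve $(f,g,h)\colon\mathbb{R}\to\mathbb{H}^1$ if $(f,g,h)$ is a $C^m$ horizontal curve and $D^kf(x)=F^k(x)$, $D^kg(x)=G^k(x)$, $D^kh(x)=H^k(x)$ for all $x\in K$ and $0\le k\le m$. Polynomials $\mathcal{P}^k$: for $1\le k\le m$, $\mathcal{P}^k$ is the polynomial obtained by differentiating $h'=2(f'g-g'f)$ $k-1$ times by the Leibniz rule, so that $D^kh=\mathcal{P}^k(f,g,f',g',\dots,D^kf,D^kg)$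 for $C^m$ horizontal curves; explicitly $\mathcal{P}^k(x_0,y_0,x_1,y_1,\dots,x_k,y_k)=2\sum_{j=0}^{k-1}\binom{k-1}{j}(x_{j+1}y_{k-1-j}-y_{j+1}x_{k-1-j})$. For $a,b\in K$ define the area discrepancy $$A(a,b)=H(b)-H(a)-2\int_a^b\big((T_a^mF)'(T_a^mG)-(T_a^mG)'(T_a^mF)\big)+2F(a)(G(b)-T_a^mG(b))-2G(a)(F(b)-T_a^mF(b))$$ and the velocity $$V(a,b)=(b-a)^{2m}+(b-a)^m\int_a^b\big(|(T_a^mF)'|+|(T_a^mG)'|\big).$$ *)

theory Defs
  imports "HOL-Analysis.Analysis"
begin

section \<open>Horizontal curves in the Heisenberg group\<close>

text \<open>The underlying space of the Heisenberg group is \<open>\<real>\<^sup>3\<close>, represented as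
  \<^typ>\<open>real \<times> real \<times> real\<close>. The fields below are \<open>\<partial>\<^sub>x + 2y \<partial>\<^sub>t\<close> and \<open>\<partial>\<^sub>y - 2x \<partial>\<^sub>t\<close>.\<close>

type_synonym heis = "real \<times> real \<times> real"

definition heis_X :: "heis \<Rightarrow> heis" where
  "heis_X p = (case p of (x, y, t) \<Rightarrow> (1, 0, 2 * y))"

definition heis_Y :: "heis \<Rightarrow> heis" where
  "heis_Y p = (case p of (x, y, t) \<Rightarrow> (0, 1, - 2 * x))"

text \<open>The set \<open>D\<close> ranges over finite families of non-overlapping subintervals,
  each interval being given by its pair of endpoints.\<close>

definition abs_continuous_on :: "real \<Rightarrow> real \<Rightarrow> (real \<Rightarrow> 'a::metric_space) \<Rightarrow> bool" where
  "abs_continuous_on a b \<gamma> \<longleftrightarrow>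
     (\<forall>\<epsilon>>0. \<exists>\<delta>>0. \<forall>D. finite D \<and> (\<forall>(u, v)\<in>D. a \<le> u \<and> u \<le> v \<and> v \<le> b) \<and>
        disjoint_family_on (\<lambda>(u, v). {u<..<v}) D \<and> (\<Sum>(u, v)\<in>D. v - u) < \<delta>
        \<longrightarrow> (\<Sum>(u, v)\<in>D. dist (\<gamma> u) (\<gamma> v)) < \<epsilon>)"

text \<open>For a curve defined on the whole line, absolute continuity is meant on compact intervals.\<close>

definition horizontal_curve :: "(real \<Rightarrow> heis) \<Rightarrow> bool" where
  "horizontal_curve \<gamma> \<longleftrightarrow>
     (\<forall>a b. abs_continuous_on a b \<gamma>) \<and>
     (AE t in lebesgue. \<gamma> differentiable (at t) \<and>
        vector_derivative \<gamma> (at t) \<in> span {heis_X (\<gamma> t), heis_Y (\<gamma> t)})"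

lemma horizontal_span_iff:
  "(u,v,w) \<in> span {heis_X (x,y,t), heis_Y (x,y,t)} \<longleftrightarrow> w = 2 * (u * y - v * x)"
  unfolding span_insert span_empty by (auto simp: heis_X_def heis_Y_def algebra_simps)

text \<open>For a \<open>C\<^sup>1\<close> curve, horizontality amounts to \<open>h' = 2(f'g - g'f)\<close> everywhere.\<close>

lemma horizontal_curve_C1_iff:
  assumes f: "\<And>t. (f has_real_derivative f' t) (at t)" "continuous_on UNIV f'"
    and g: "\<And>t. (g has_real_derivative g' t) (at t)" "continuous_on UNIV g'"
    and h: "\<And>t. (h has_real_derivative h' t) (at t)" "continuous_on UNIV h'"
  shows "horizontal_curve (\<lambda>t. (f t, g t, h t)) \<longleftrightarrow> (\<forall>t. h' t = 2 * (f' t * g t - g' t * f t))"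
proof -
  let ?c = "\<lambda>t. (f t, g t, h t)" and ?d = "\<lambda>t. (f' t, g' t, h' t)"
  have d: "(?c has_vector_derivative ?d t) (at t)" for t
    using f(1)[of t] g(1)[of t] h(1)[of t]
    by (auto intro!: has_vector_derivative_Pair simp: has_real_derivative_iff_has_vector_derivative)
  have cd: "continuous_on UNIV ?d" using f g h by (auto intro!: continuous_intros)
  have ac: "abs_continuous_on a b ?c" for a b
    unfolding abs_continuous_on_def
  proof (intro allI impI)
    fix e :: real assume e: "e > 0"
    have "compact (?d ` {a..b})" by (intro compact_continuous_image continuous_on_subset[OF cd]) auto
    then have "\<exists>B>0. \<forall>x\<in>?d ` {a..b}. norm x \<le> B" using compact_imp_bounded bounded_pos by blast
    then obtain B where B: "B > 0" "\<And>t. t \<in> {a..b} \<Longrightarrow> norm (?d t) \<le> B"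
      by blast
    have lip: "dist (?c u) (?c v) \<le> B * (v - u)" if "a \<le> u" "u \<le> v" "v \<le> b" for u v
    proof -
      have "norm (?c v - ?c u) \<le> B * norm (v - u)"
      proof (rule differentiable_bound[where S="{u..v}" and f'="\<lambda>t x. x *\<^sub>R ?d t"])
        fix t assume t: "t \<in> {u..v}"
        show "(?c has_derivative (\<lambda>x. x *\<^sub>R ?d t)) (at t within {u..v})"
          using d[of t] unfolding has_vector_derivative_def by (rule has_derivative_at_withinI)
        have "norm (?d t) \<le> B" using B that t by auto
        then show "onorm (\<lambda>x. x *\<^sub>R ?d t) \<le> B"
          by (intro onorm_le) (simp add: mult.commute[of B] mult_left_mono del: scaleR_Pair)
      qed (use that in auto)
      then show ?thesis using that by (simp add: dist_norm norm_minus_commute[of "?c u" "?c v"] del: diff_Pair)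
    qed
    show "\<exists>\<delta>>0. \<forall>D. finite D \<and> (\<forall>(u, v)\<in>D. a \<le> u \<and> u \<le> v \<and> v \<le> b) \<and>
        disjoint_family_on (\<lambda>(u, v). {u<..<v}) D \<and> (\<Sum>(u, v)\<in>D. v - u) < \<delta>
        \<longrightarrow> (\<Sum>(u, v)\<in>D. dist (?c u) (?c v)) < e"
    proof (intro exI[of _ "e/B"] conjI allI impI)
      show "e / B > 0" using e B by simp
      fix D assume D: "finite D \<and> (\<forall>(u, v)\<in>D. a \<le> u \<and> u \<le> v \<and> v \<le> b) \<and>
        disjoint_family_on (\<lambda>(u, v). {u<..<v}) D \<and> (\<Sum>(u, v)\<in>D. v - u) < e/B"
      have "(\<Sum>(u, v)\<in>D. dist (?c u) (?c v)) \<le> (\<Sum>(u, v)\<in>D. B * (v - u))"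
        using D lip by (intro sum_mono) fastforce
      also have "\<dots> = B * (\<Sum>(u, v)\<in>D. v - u)" by (simp add: sum_distrib_left case_prod_unfold)
      also have "\<dots> < e" using D B by (simp add: field_simps)
      finally show "(\<Sum>(u, v)\<in>D. dist (?c u) (?c v)) < e" .
    qed
  qed
  have diff: "?c differentiable (at t)" for t using d differentiableI_vector by blast
  have vd: "vector_derivative ?c (at t) = ?d t" for t using d vector_derivative_at by blast
  let ?w = "\<lambda>t. h' t - 2 * (f' t * g t - g' t * f t)"
  have cf: "continuous_on UNIV f" "continuous_on UNIV g"
    using f(1) g(1) by (auto simp: continuous_on_eq_continuous_at intro: DERIV_isCont)
  have cw: "continuous_on UNIV ?w" by (intro continuous_intros f g h cf)
    have op: "open {t. ?w t \<noteq> 0}" using open_Collect_neq[OF cw continuous_on_const[of UNIV 0]] .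
  have "(AE t in lebesgue. ?w t = 0) \<longleftrightarrow> (\<forall>t. ?w t = 0)"
  proof
    assume "AE t in lebesgue. ?w t = 0"
    then have n: "negligible {t. ?w t \<noteq> 0}"
      using AE_iff_null_sets[of "{t. ?w t \<noteq> 0}" lebesgue] op
      by (simp add: negligible_iff_null_sets borel_open lborelD)
    have "{t. ?w t \<noteq> 0} = {}" using n op open_not_negligible by blast
    then show "\<forall>t. ?w t = 0" by blast
  qed auto
  then show ?thesis unfolding horizontal_curve_def using ac diff vd by (simp add: horizontal_span_iff)
qed

definition Cm_fun :: "nat \<Rightarrow> (real \<Rightarrow> real) \<Rightarrow> bool" where
  "Cm_fun m f \<longleftrightarrow>
     (\<forall>k<m. \<forall>t. (deriv ^^ k) f differentiable (at t)) \<and> continuous_on UNIV ((deriv ^^ m) f)"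

definition Cm_horizontal_curve ::
    "nat \<Rightarrow> (real \<Rightarrow> real) \<Rightarrow> (real \<Rightarrow> real) \<Rightarrow> (real \<Rightarrow> real) \<Rightarrow> bool" where
  "Cm_horizontal_curve m f g h \<longleftrightarrow>
     Cm_fun m f \<and> Cm_fun m g \<and> Cm_fun m h \<and> horizontal_curve (\<lambda>t. (f t, g t, h t))"

section \<open>Jets\<close>

text \<open>A jet \<open>(F\<^sup>k)\<close> is a function \<open>F\<close> of the order \<open>k\<close> and the point; only the values \<open>F k x\<close>
  with \<open>k \<le> m\<close> and \<open>x \<in> K\<close> are meaningful.\<close>

definition jet :: "nat \<Rightarrow> real set \<Rightarrow> (nat \<Rightarrow> real \<Rightarrow> real) \<Rightarrow> bool" where
  "jet m K F \<longleftrightarrow> (\<forall>k\<le>m. continuous_on K (F k))"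

definition taylor :: "nat \<Rightarrow> (nat \<Rightarrow> real \<Rightarrow> real) \<Rightarrow> real \<Rightarrow> real \<Rightarrow> real" where
  "taylor m F a x = (\<Sum>k\<le>m. F k a / fact k * (x - a) ^ k)"

definition whitney_field :: "nat \<Rightarrow> real set \<Rightarrow> (nat \<Rightarrow> real \<Rightarrow> real) \<Rightarrow> bool" where
  "whitney_field m K F \<longleftrightarrow> jet m K F \<and>
     (\<forall>k\<le>m. \<forall>\<epsilon>>0. \<exists>\<delta>>0. \<forall>a\<in>K. \<forall>b\<in>K. \<bar>a - b\<bar> < \<delta> \<longrightarrow>
        \<bar>F k b - (\<Sum>l\<le>m - k. F (k + l) a / fact l * (b - a) ^ l)\<bar> \<le> \<epsilon> * \<bar>a - b\<bar> ^ (m - k))"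

definition extends_to_horizontal_curve ::
    "nat \<Rightarrow> real set \<Rightarrow> (nat \<Rightarrow> real \<Rightarrow> real) \<Rightarrow> (nat \<Rightarrow> real \<Rightarrow> real) \<Rightarrow> (nat \<Rightarrow> real \<Rightarrow> real) \<Rightarrow>
     (real \<Rightarrow> real) \<Rightarrow> (real \<Rightarrow> real) \<Rightarrow> (real \<Rightarrow> real) \<Rightarrow> bool" where
  "extends_to_horizontal_curve m K F G H f g h \<longleftrightarrow>
     Cm_horizontal_curve m f g h \<and>
     (\<forall>x\<in>K. \<forall>k\<le>m. (deriv ^^ k) f x = F k x \<and> (deriv ^^ k) g x = G k x \<and> (deriv ^^ k) h x = H k x)"

text \<open>The polynomial \<open>P\<^sup>k(x\<^sub>0, y\<^sub>0, \<dots>, x\<^sub>k, y\<^sub>k)\<close> for \<open>k \<ge> 1\<close>, which comes from applying the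
  Leibniz rule to the derivative of order \<open>k - 1\<close> of \<open>h' = 2(f'g - g'f)\<close>. Its variables are passed
  as two sequences, of which only the entries up to index \<open>k\<close> are used.\<close>

definition horizontal_poly :: "nat \<Rightarrow> (nat \<Rightarrow> real) \<Rightarrow> (nat \<Rightarrow> real) \<Rightarrow> real" where
  "horizontal_poly k x y =
     2 * (\<Sum>j<k. of_nat ((k - 1) choose j) *
            (x (j + 1) * y (k - 1 - j) - y (j + 1) * x (k - 1 - j)))"

text \<open>The integrals are oriented, so that both quantities are meaningful for all \<open>a\<close> and \<open>b\<close>.\<close>

definition area_discrepancy ::
    "nat \<Rightarrow> (nat \<Rightarrow> real \<Rightarrow> real) \<Rightarrow> (nat \<Rightarrow> real \<Rightarrow> real) \<Rightarrow> (nat \<Rightarrow> real \<Rightarrow> real) \<Rightarrow>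
     real \<Rightarrow> real \<Rightarrow> real" where
  "area_discrepancy m F G H a b =
     H 0 b - H 0 a
     - 2 * (LBINT s=a..b. deriv (taylor m F a) s * taylor m G a s
                          - deriv (taylor m G a) s * taylor m F a s)
     + 2 * F 0 a * (G 0 b - taylor m G a b)
     - 2 * G 0 a * (F 0 b - taylor m F a b)"

definition velocity ::
    "nat \<Rightarrow> (nat \<Rightarrow> real \<Rightarrow> real) \<Rightarrow> (nat \<Rightarrow> real \<Rightarrow> real) \<Rightarrow> real \<Rightarrow> real \<Rightarrow> real" where
  "velocity m F G a b =
     (b - a) ^ (2 * m)
     + (b - a) ^ m * (LBINT s=a..b. \<bar>deriv (taylor m F a) s\<bar> + \<bar>deriv (taylor m G a) s\<bar>)"

end

theory Submission
  imports Defs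
begin

text \<open>
  Necessity: write \<open>f = p + \<phi>\<close> and \<open>g = q + \<psi>\<close> on \<open>[a, b]\<close> with the Taylor polynomials \<open>p\<close>, \<open>q\<close> at \<open>a\<close>.
  After integrating by parts, the area discrepancy is the integral of
  \<open>4(p'\<psi> - q'\<phi>) + 2(\<phi>'\<psi> - \<psi>'\<phi>) + 2\<phi>(b)q' - 2\<psi>(b)p'\<close>, and Taylor's theorem bounds every term by
  \<open>\<epsilon> V(a, b)\<close>.

  Sufficiency: extend \<open>F\<close> and \<open>G\<close> by Whitney's construction, with a polynomial on each gap of \<open>K\<close>. By
  the estimate above, the area error \<open>e\<close> of the extension over a gap of length \<open>L\<close> is at most
  \<open>\<epsilon> V \<le> \<epsilon> (L\<^sup>2\<^sup>m + C L\<^sup>m\<^sup>+\<^sup>1 M)\<close>, where \<open>M\<close> bounds the rescaled coefficients of \<open>p'\<close> and \<open>q'\<close>. It is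
  corrected by adding polynomial bumps on the gap whose \<open>m\<close>-th derivatives are small with \<open>\<epsilon>\<close>. If
  \<open>M \<ge> L\<^sup>m\<^sup>-\<^sup>1\<close>, a bump proportional to \<open>p'\<close> added to \<open>g\<close> (or to \<open>q'\<close> added to \<open>f\<close>) changes the area
  linearly at a rate of order \<open>L\<^sup>m\<^sup>+\<^sup>1 M\<close>; otherwise bumps added to both functions correct the error
  quadratically at the scale \<open>L\<^sup>2\<^sup>m\<close>. The corrected functions stay \<open>C\<^sup>m\<close>, and the lift \<open>h\<close> of
  \<open>(f, g)\<close> agrees with \<open>H\<close> on \<open>K\<close>, because \<open>H - h\<close> has derivative zero along \<open>K\<close> and equal values at
  the two ends of each gap.
\<close>

section \<open>Sequences of derivatives\<close>

text \<open>The threshold \<open>M = L^(m-1)\<close> is where the bounds \<open>L^(2m)\<close> and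
  \<open>L^(m+1) M\<close> for the two terms of \<open>V\<close> balance. It is also where the
  Taylor error of \<open>f'\<close>, at most \<open>\<kappa> L^(m-1)\<close>, is comparable with
  \<open>p'\<close>: above it a bump proportional to \<open>p'\<close> still sees the true
  \<open>f'\<close>; below it no linear rate can be relied on (\<open>f\<close> and \<open>g\<close>
  may be constant there). The quadratic term then costs the square root of \<epsilon> instead of
  \<epsilon>, which still tends to zero. The obstacle to gluing is uniformity. Bumps on infinitely
  many gaps form a C^m function only if their derivatives of order \<open>m\<close> tend to zero
  with the gap length, while the corrections are found for each \<epsilon> separately; hence the
  single nearly optimal choice. Long gaps are finitely many, so any exact correction serves there.
  \<open>H\<close> itself is never extended: the third component is the lift of the corrected pair,
  so the area over every gap must match exactly, not only up to a small error.\<close>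

text \<open>A C^m function is carried with its derivatives as a sequence of the same type as a jet,
  so that \<open>taylor\<close>, \<open>area_discrepancy\<close> and \<open>velocity\<close> apply
  to it directly. Entries beyond \<open>m\<close> are unconstrained.\<close>

definition smooth_seq :: "nat \<Rightarrow> (nat \<Rightarrow> real \<Rightarrow> real) \<Rightarrow> bool" where
  "smooth_seq m u \<longleftrightarrow>
     (\<forall>k<m. \<forall>x. (u k has_real_derivative u (Suc k) x) (at x)) \<and> continuous_on UNIV (u m)"

lemma smooth_seq_deriv:
  "smooth_seq m u \<Longrightarrow> k < m \<Longrightarrow> (u k has_real_derivative u (Suc k) x) (at x)"
  by (simp add: smooth_seq_def)

lemma smooth_seq_continuous:
  assumes "smooth_seq m u" "k \<le> m"
  shows "continuous_on A (u k)"
proof -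
  have "continuous_on UNIV (u k)"
  proof (cases "k = m")
    case False
    then have "\<forall>x. (u k has_real_derivative u (Suc k) x) (at x)"
      using assms by (simp add: smooth_seq_def)
    then show ?thesis
      by (meson DERIV_continuous_on has_field_derivative_at_within)
  qed (use assms in \<open>simp add: smooth_seq_def\<close>)
  then show ?thesis by (rule continuous_on_subset) simp
qed

lemma Cm_fun_smooth_seq: "Cm_fun m f \<Longrightarrow> smooth_seq m (\<lambda>k. (deriv ^^ k) f)"
  by (auto simp: Cm_fun_def smooth_seq_def DERIV_deriv_iff_real_differentiable)

lemma smooth_seq_deriv_eq:
  assumes "smooth_seq m u" "k \<le> m"
  shows "(deriv ^^ k) (u 0) = u k"
  using assms(2)
proof (induction k)
  case (Suc k)
  have "deriv (u k) = u (Suc k)"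
    using Suc.prems assms(1) by (intro ext DERIV_imp_deriv) (simp add: smooth_seq_deriv)
  then show ?case using Suc by simp
qed simp

lemma smooth_seq_Cm_fun:
  assumes "smooth_seq m u"
  shows "Cm_fun m (u 0)"
  unfolding Cm_fun_def
proof (intro conjI allI impI)
  fix k t assume "k < m"
  then show "(deriv ^^ k) (u 0) differentiable at t"
    using smooth_seq_deriv[OF assms, of k t] smooth_seq_deriv_eq[OF assms, of k]
    by (auto simp: real_differentiable_def)
qed (use assms smooth_seq_deriv_eq[OF assms, of m] in \<open>simp add: smooth_seq_def\<close>)

lemma smooth_seq_add:
  assumes "smooth_seq m u" "smooth_seq m v"
  shows "smooth_seq m (\<lambda>k x. u k x + v k x)"
  using assms by (auto simp: smooth_seq_def intro!: DERIV_add continuous_intros)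

text \<open>The Lagrange remainder of order \<open>m - k\<close> and the last term of the Taylor sum
  differ by an increment of \<open>u m\<close>, which is uniformly continuous on the compact
  interval. One \<delta> therefore serves all \<open>k\<close>.\<close>

lemma smooth_seq_taylor:
  assumes u: "smooth_seq m u" and e: "\<epsilon> > 0"
  obtains \<delta> where "\<delta> > 0" "\<And>a x k. a \<in> {c..d} \<Longrightarrow> x \<in> {c..d} \<Longrightarrow> \<bar>x - a\<bar> < \<delta> \<Longrightarrow> k \<le> m \<Longrightarrow>
           \<bar>u k x - (\<Sum>l\<le>m - k. u (k + l) a / fact l * (x - a) ^ l)\<bar> \<le> \<epsilon> * \<bar>x - a\<bar> ^ (m - k)"
proof -
  have "uniformly_continuous_on {c..d} (u m)"
    by (intro compact_uniformly_continuous smooth_seq_continuous[OF u]) auto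
  then obtain \<delta> where d: "\<delta> > 0"
    "\<And>x y. x \<in> {c..d} \<Longrightarrow> y \<in> {c..d} \<Longrightarrow> \<bar>y - x\<bar> < \<delta> \<Longrightarrow> \<bar>u m y - u m x\<bar> < \<epsilon>"
    unfolding uniformly_continuous_on_def dist_real_def using e by metis
  have "\<bar>u k x - (\<Sum>l\<le>m - k. u (k + l) a / fact l * (x - a) ^ l)\<bar> \<le> \<epsilon> * \<bar>x - a\<bar> ^ (m - k)"
    if a: "a \<in> {c..d}" "x \<in> {c..d}" "\<bar>x - a\<bar> < \<delta>" "k \<le> m" for a x k
  \<comment> \<open>Taylor's theorem needs \<open>x \<noteq> a\<close> and a positive order; for
    \<open>k = m\<close> the claim is the uniform continuity of \<open>u m\<close>.\<close>
  proof (cases "x = a \<or> k = m")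
    case True
    have "(\<Sum>l\<le>m - k. u (k + l) a / fact l * (a - a) ^ l) = u k a"
      by (subst sum.remove[of _ 0]) (auto simp: sum.neutral)
    with True d(2)[of a x] a e show ?thesis by auto
  next
    case False
    define n where "n = m - k"
    have n: "n > 0" "k + n = m" using False a by (auto simp: n_def)
    have "\<forall>j t. j < n \<and> c \<le> t \<and> t \<le> d \<longrightarrow> DERIV (u (k + j)) t :> u (k + Suc j) t"
      using smooth_seq_deriv[OF u] n by auto
    then obtain t where t: "if x < a then x < t \<and> t < a else a < t \<and> t < x"
      "u k x = (\<Sum>j<n. u (k + j) a / fact j * (x - a) ^ j) + u (k + n) t / fact n * (x - a) ^ n"
      using Taylor[of n "\<lambda>j. u (k + j)" "u k" c d a x] False a n by auto
    have tt: "t \<in> {c..d}" "\<bar>t - a\<bar> < \<delta>" using t(1) a by (auto split: if_splits)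
    have "u k x - (\<Sum>l\<le>m - k. u (k + l) a / fact l * (x - a) ^ l)
        = (u m t - u m a) / fact n * (x - a) ^ n"
      unfolding t(2) n_def[symmetric] using n
      by (simp add: lessThan_Suc_atMost[symmetric] field_simps)
    moreover have "\<bar>(u m t - u m a) / fact n * (x - a) ^ n\<bar> \<le> \<epsilon> * \<bar>x - a\<bar> ^ n"
    proof -
      have "\<bar>(u m t - u m a) / fact n\<bar> \<le> \<bar>u m t - u m a\<bar> / 1"
        unfolding abs_divide by (intro divide_left_mono_neg frac_le) auto
      also have "\<dots> \<le> \<epsilon>" using d(2)[of a t] tt a by auto
      finally have "\<bar>(u m t - u m a) / fact n\<bar> \<le> \<epsilon>" .
      from mult_right_mono[OF this, of "\<bar>x - a\<bar> ^ n"] show ?thesis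
        by (simp only: abs_mult power_abs) simp
    qed
    ultimately show ?thesis by (simp add: n_def)
  qed
  then show thesis using d(1) by (intro that)
qed

section \<open>The Leibniz rule and the derivatives of the lift\<close>

text \<open>Pascal's rule splits the coefficient \<open>Suc n choose j\<close>: one half collects
  the terms in which \<open>u\<close> was differentiated, the other those in which \<open>v\<close>
  was.\<close>

lemma Leibniz_deriv:
  fixes u v :: "nat \<Rightarrow> real \<Rightarrow> real"
  assumes "\<And>j. j \<le> n \<Longrightarrow> (u j has_real_derivative u (Suc j) x) (at x)"
    and "\<And>j. j \<le> n \<Longrightarrow> (v j has_real_derivative v (Suc j) x) (at x)"
  shows "((\<lambda>x. \<Sum>j\<le>n. of_nat (n choose j) * (u j x * v (n - j) x)) has_real_derivative
          (\<Sum>j\<le>Suc n. of_nat (Suc n choose j) * (u j x * v (Suc n - j) x))) (at x)"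
proof -
  have 1: "((\<lambda>x. \<Sum>j\<le>n. of_nat (n choose j) * (u j x * v (n - j) x)) has_real_derivative
     (\<Sum>j\<le>n. of_nat (n choose j) * (u j x * v (Suc (n - j)) x + u (Suc j) x * v (n - j) x))) (at x)"
    by (intro DERIV_sum DERIV_cmult DERIV_mult' assms) auto
  have "(\<Sum>j\<le>Suc n. of_nat (Suc n choose j) * (u j x * v (Suc n - j) x))
     = u 0 x * v (Suc n) x + (\<Sum>j\<le>n. of_nat (Suc n choose Suc j) * (u (Suc j) x * v (n - j) x))"
    by (subst sum.atMost_Suc_shift) simp
  also have "(\<Sum>j\<le>n. of_nat (Suc n choose Suc j) * (u (Suc j) x * v (n - j) x))
     = (\<Sum>j\<le>n. of_nat (n choose j) * (u (Suc j) x * v (n - j) x))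
      + (\<Sum>j\<le>n. of_nat (n choose Suc j) * (u (Suc j) x * v (n - j) x))"
    by (simp add: algebra_simps sum.distrib)
  also have "u 0 x * v (Suc n) x + \<dots> = (\<Sum>j\<le>n. of_nat (n choose j) * (u (Suc j) x * v (n - j) x))
      + (\<Sum>j\<le>Suc n. of_nat (n choose j) * (u j x * v (Suc n - j) x))"
    unfolding sum.atMost_Suc_shift[where g="\<lambda>j. of_nat (n choose j) * (u j x * v (Suc n - j) x)"] by simp
  also have "(\<Sum>j\<le>Suc n. of_nat (n choose j) * (u j x * v (Suc n - j) x))
     = (\<Sum>j\<le>n. of_nat (n choose j) * (u j x * v (Suc (n - j)) x))"
    by (simp add: Suc_diff_le)
  finally have "(\<Sum>j\<le>Suc n. of_nat (Suc n choose j) * (u j x * v (Suc n - j) x))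
     = (\<Sum>j\<le>n. of_nat (n choose j) * (u j x * v (Suc (n - j)) x + u (Suc j) x * v (n - j) x))"
    by (simp add: algebra_simps sum.distrib)
  with 1 show ?thesis by simp
qed

text \<open>At index \<open>Suc n\<close> the two halves of the polynomial are Leibniz sums of order
  \<open>n\<close> for the products \<open>f' g\<close> and \<open>g' f\<close>. At
  \<open>k = 0\<close> the polynomial is an empty sum and the rule fails in general.\<close>

lemma horizontal_poly_deriv:
  assumes f: "smooth_seq m f" and g: "smooth_seq m g" and k: "1 \<le> k" "k < m"
  shows "((\<lambda>x. horizontal_poly k (\<lambda>j. f j x) (\<lambda>j. g j x)) has_real_derivative
          horizontal_poly (Suc k) (\<lambda>j. f j x) (\<lambda>j. g j x)) (at x)"
proof -
  obtain n where n: "k = Suc n" using k by (cases k) auto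
  have *: "horizontal_poly (Suc n) x y = 2 * ((\<Sum>j\<le>n. of_nat (n choose j) * (x (Suc j) * y (n - j)))
      - (\<Sum>j\<le>n. of_nat (n choose j) * (y (Suc j) * x (n - j))))" for n x y
    unfolding horizontal_poly_def
    by (simp add: lessThan_Suc_atMost sum_subtractf[symmetric] algebra_simps)
  show ?thesis unfolding n *
    by (intro DERIV_cmult DERIV_diff Leibniz_deriv[where u="\<lambda>j. f (Suc j)"]
      Leibniz_deriv[where u="\<lambda>j. g (Suc j)"] smooth_seq_deriv[OF f] smooth_seq_deriv[OF g])
      (use k n in auto)
qed

text \<open>The derivatives of a lift. Order 0 has to be \<open>h\<close> itself, because
  \<open>horizontal_poly 0\<close> is zero; the later entries are forced by the Leibniz
  rule.\<close>

lemma smooth_seq_horizontal_poly: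
  assumes f: "smooth_seq m f" and g: "smooth_seq m g"
    and h: "\<And>x. (h has_real_derivative 2 * (f 1 x * g 0 x - g 1 x * f 0 x)) (at x)" and m: "m \<ge> 1"
  shows "smooth_seq m (\<lambda>k x. if k = 0 then h x else horizontal_poly k (\<lambda>j. f j x) (\<lambda>j. g j x))"
proof -
  have "continuous_on UNIV (\<lambda>x. horizontal_poly m (\<lambda>j. f j x) (\<lambda>j. g j x))"
    unfolding horizontal_poly_def using m
    by (intro continuous_intros smooth_seq_continuous[OF f] smooth_seq_continuous[OF g]) auto
  moreover have "((\<lambda>x. if k = 0 then h x else horizontal_poly k (\<lambda>j. f j x) (\<lambda>j. g j x)) has_real_derivative
      horizontal_poly (Suc k) (\<lambda>j. f j x) (\<lambda>j. g j x)) (at x)" if "k < m" for k x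
  proof (cases "k = 0")
    case True
    then show ?thesis using h[of x] by (simp add: horizontal_poly_def)
  next
    case False
    then show ?thesis using horizontal_poly_deriv[OF f g, of k x] that by simp
  qed
  ultimately show ?thesis using m by (simp add: smooth_seq_def)
qed

lemma smooth_seq_unique:
  assumes "smooth_seq m u" "smooth_seq m v" "u 0 = v 0" "k \<le> m"
  shows "u k = v k"
  using assms smooth_seq_deriv_eq by metis

section \<open>Taylor polynomials and the area estimate\<close>

text \<open>A formal polynomial, so that derivatives of all orders can be computed with
  \<open>pderiv\<close>; \<open>c k\<close> is the prescribed derivative of order \<open>k\<close>
  at \<open>a\<close>.\<close>

definition taylor_poly :: "nat \<Rightarrow> (nat \<Rightarrow> real) \<Rightarrow> real \<Rightarrow> real poly" where
  "taylor_poly n c a = (\<Sum>k\<le>n. smult (c k / fact k) ([:- a, 1:] ^ k))"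

lemma poly_taylor_poly: "poly (taylor_poly n c a) x = (\<Sum>k\<le>n. c k / fact k * (x - a) ^ k)"
  by (simp add: taylor_poly_def poly_sum)

lemma poly_taylor_poly_center: "poly (taylor_poly n c a) a = c 0"
  unfolding poly_taylor_poly by (subst sum.remove[of _ 0]) (auto simp: sum.neutral)

lemma pderiv_taylor_poly:
  "pderiv (taylor_poly (Suc n) c a) = taylor_poly n (\<lambda>k. c (Suc k)) a"
proof -
  have "pderiv (taylor_poly (Suc n) c a)
      = (\<Sum>k\<le>Suc n. smult (c k / fact k) (smult (of_nat k) ([:- a, 1:] ^ (k - 1))))"
    unfolding taylor_poly_def
    by (simp add: higher_pderiv_sum[of 1, simplified] pderiv_smult pderiv_power pderiv_pCons del: sum.atMost_Suc)
  also have "\<dots> = taylor_poly n (\<lambda>k. c (Suc k)) a"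
    unfolding taylor_poly_def
    by (subst sum.atMost_Suc_shift) (auto intro!: sum.cong arg_cong2[of _ _ _ _ smult] simp: fact_Suc simp del: of_nat_Suc)
  finally show ?thesis .
qed

lemma higher_pderiv_taylor_poly:
  "k \<le> n \<Longrightarrow> (pderiv ^^ k) (taylor_poly n c a) = taylor_poly (n - k) (\<lambda>j. c (k + j)) a"
proof (induction k)
  case (Suc k)
  then have "(pderiv ^^ Suc k) (taylor_poly n c a) = pderiv (taylor_poly (Suc (n - Suc k)) (\<lambda>j. c (k + j)) a)"
    by (simp add: Suc_diff_Suc)
  then show ?case by (simp add: pderiv_taylor_poly)
qed simp

lemma poly_higher_pderiv_taylor_poly_center:
  "k \<le> n \<Longrightarrow> poly ((pderiv ^^ k) (taylor_poly n c a)) a = c k"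
  by (simp add: higher_pderiv_taylor_poly poly_taylor_poly_center)

lemma taylor_conv_poly: "taylor m F a = poly (taylor_poly m (\<lambda>k. F k a) a)"
  by (simp add: fun_eq_iff taylor_def poly_taylor_poly)

lemma deriv_poly: "deriv (poly p) = poly (pderiv (p :: real poly))"
  by (intro ext DERIV_imp_deriv poly_DERIV)

lemma taylor_cong: "(\<And>k. k \<le> m \<Longrightarrow> F k a = F' k a) \<Longrightarrow> taylor m F a = taylor m F' a"
  by (auto simp: taylor_def fun_eq_iff intro!: sum.cong)

lemma LBINT_eq_integral:
  fixes f :: "real \<Rightarrow> real"
  assumes "a \<le> b" "continuous_on {a..b} f"
  shows "(LBINT s=a..b. f s) = integral {a..b} f"
  using assms by (intro interval_integral_eq_integral borel_integrable_atLeastAtMost') auto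

lemma integral_bound_mono:
  fixes f g :: "real \<Rightarrow> real"
  assumes "continuous_on {a..b} f" "continuous_on {a..b} g" "\<And>s. s \<in> {a..b} \<Longrightarrow> \<bar>f s\<bar> \<le> g s"
  shows "\<bar>integral {a..b} f\<bar> \<le> integral {a..b} g"
  using integral_norm_bound_integral[of f "{a..b}" g] assms integrable_continuous_real by auto

text \<open>Pointwise bound for the integrand \<open>r\<close> of \<open>area_estimate\<close>.
  There \<open>p\<close>, \<open>q\<close> are values of the derivatives of the Taylor polynomials,
  \<open>E = \<eta> L^m\<close>, \<open>E' = \<eta> L^(m-1)\<close> and
  \<open>D = \<eta> L^(2m-1)\<close>.\<close>

lemma area_remainder_bound:
  fixes p q u v u' v' ub vb E E' D :: real
  assumes "\<bar>u\<bar> \<le> E" "\<bar>v\<bar> \<le> E" "\<bar>u'\<bar> \<le> E'" "\<bar>v'\<bar> \<le> E'" "\<bar>ub\<bar> \<le> E" "\<bar>vb\<bar> \<le> E" "E' * E \<le> D"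
  shows "\<bar>4 * (p * v - q * u) + 2 * (u' * v - v' * u) + 2 * ub * q - 2 * vb * p\<bar>
     \<le> 6 * E * (\<bar>p\<bar> + \<bar>q\<bar>) + 4 * D"
proof -
  define P where "P = \<bar>p\<bar>"
  define Q where "Q = \<bar>q\<bar>"
  have *: "\<bar>x * y\<bar> \<le> \<bar>x\<bar> * c" if "\<bar>y\<bar> \<le> c" for x y c :: real
    using that by (simp add: abs_mult mult_left_mono)
  have **: "\<bar>x * y\<bar> \<le> D" if "\<bar>x\<bar> \<le> E'" "\<bar>y\<bar> \<le> E" for x y
  proof -
    have "0 \<le> E'" using that by linarith
    then show ?thesis unfolding abs_mult by (intro order_trans[OF mult_mono[OF that] assms(7)]) auto
  qed
  have b: "\<bar>p * v\<bar> \<le> P * E" "\<bar>q * u\<bar> \<le> Q * E" "\<bar>u' * v\<bar> \<le> D" "\<bar>v' * u\<bar> \<le> D"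
    "\<bar>q * ub\<bar> \<le> Q * E" "\<bar>p * vb\<bar> \<le> P * E"
    using assms by (auto simp: P_def Q_def intro: * **)
  have "\<bar>4 * (p * v - q * u) + 2 * (u' * v - v' * u) + 2 * (q * ub) - 2 * (p * vb)\<bar>
     \<le> 4 * (P * E + Q * E) + 2 * (D + D) + 2 * (Q * E) + 2 * (P * E)"
  proof -
    have "\<bar>4 * (a - b) + 2 * (c - d) + 2 * e - 2 * f\<bar> \<le> 4 * (A + B) + 2 * (D + D) + 2 * B + 2 * A"
      if "\<bar>a\<bar> \<le> A" "\<bar>b\<bar> \<le> B" "\<bar>c\<bar> \<le> D" "\<bar>d\<bar> \<le> D" "\<bar>e\<bar> \<le> B" "\<bar>f\<bar> \<le> A"
      for a b c d e f A B :: real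
      using that by (smt (verit))
    from this[OF b] show ?thesis .
  qed
  also have "\<dots> = 6 * E * (P + Q) + 4 * D" by algebra
  finally show ?thesis by (simp add: P_def Q_def mult_ac)
qed

text \<open>The discrepancy sees \<open>H\<close> only through \<open>H 0 b - H 0 a\<close>, so any
  \<open>H\<close> with the right increment is allowed, with \<delta> independent of it. Necessity
  applies this to the third component of the curve, sufficiency to an artificial function.\<close>

lemma area_estimate:
  assumes f: "smooth_seq m f" and g: "smooth_seq m g" and m: "m \<ge> 1" and e: "\<epsilon> > 0"
  shows "\<exists>\<delta>>0. \<forall>a\<in>{c..d}. \<forall>b\<in>{c..d}. 0 < b - a \<and> b - a < \<delta> \<longrightarrow>
     (\<forall>H. H 0 b - H 0 a = 2 * integral {a..b} (\<lambda>s. f 1 s * g 0 s - g 1 s * f 0 s) \<longrightarrow>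
        \<bar>area_discrepancy m f g H a b\<bar> \<le> \<epsilon> * velocity m f g a b)"
proof -
  \<comment> \<open>\<open>\<eta> \<le> 1\<close> absorbs the square of \<eta> in the products of
    two errors. The 6 is the coefficient of \<open>|p'| + |q'|\<close> in
    \<open>area_remainder_bound\<close>, and it exceeds the 4 in front of \<open>D\<close>.\<close>
  define \<eta> where "\<eta> = min 1 (\<epsilon> / 6)"
  have eta: "\<eta> > 0" "\<eta> \<le> 1" "6 * \<eta> \<le> \<epsilon>" using e by (auto simp: \<eta>_def)
  obtain d1 where d1: "d1 > 0" "\<And>a x k. a \<in> {c..d} \<Longrightarrow> x \<in> {c..d} \<Longrightarrow> \<bar>x - a\<bar> < d1 \<Longrightarrow> k \<le> m \<Longrightarrow>
           \<bar>f k x - (\<Sum>l\<le>m - k. f (k + l) a / fact l * (x - a) ^ l)\<bar> \<le> \<eta> * \<bar>x - a\<bar> ^ (m - k)"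
    by (rule smooth_seq_taylor[OF f eta(1), of c d]) (rule that)
  obtain d2 where d2: "d2 > 0" "\<And>a x k. a \<in> {c..d} \<Longrightarrow> x \<in> {c..d} \<Longrightarrow> \<bar>x - a\<bar> < d2 \<Longrightarrow> k \<le> m \<Longrightarrow>
           \<bar>g k x - (\<Sum>l\<le>m - k. g (k + l) a / fact l * (x - a) ^ l)\<bar> \<le> \<eta> * \<bar>x - a\<bar> ^ (m - k)"
    by (rule smooth_seq_taylor[OF g eta(1), of c d]) (rule that)
  have "\<bar>area_discrepancy m f g H a b\<bar> \<le> \<epsilon> * velocity m f g a b"
    if ab: "a \<in> {c..d}" "b \<in> {c..d}" "0 < b - a" "b - a < min d1 d2"
      and H: "H 0 b - H 0 a = 2 * integral {a..b} (\<lambda>s. f 1 s * g 0 s - g 1 s * f 0 s)" for a b H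
  proof -
    define L where "L = b - a"
    define P where "P = taylor_poly m (\<lambda>k. f k a) a"
    define Q where "Q = taylor_poly m (\<lambda>k. g k a) a"
    define p where "p = poly P"
    define q where "q = poly Q"
    define p' where "p' = poly (pderiv P)"
    define q' where "q' = poly (pderiv Q)"
    define \<phi> where "\<phi> x = f 0 x - p x" for x
    define \<psi> where "\<psi> x = g 0 x - q x" for x
    define \<phi>' where "\<phi>' x = f 1 x - p' x" for x
    define \<psi>' where "\<psi>' x = g 1 x - q' x" for x
    note defs = \<phi>_def \<psi>_def \<phi>'_def \<psi>'_def
    have L: "L > 0" using ab by (simp add: L_def)
    have dp: "(p has_real_derivative p' x) (at x)" "(q has_real_derivative q' x) (at x)" for x
      by (auto simp: p_def q_def p'_def q'_def poly_DERIV)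
    have df: "(f 0 has_real_derivative f 1 x) (at x)" "(g 0 has_real_derivative g 1 x) (at x)" for x
      using smooth_seq_deriv[OF f, of 0 x] smooth_seq_deriv[OF g, of 0 x] m by auto
    have dphi: "(\<phi> has_real_derivative \<phi>' x) (at x)" "(\<psi> has_real_derivative \<psi>' x) (at x)" for x
      unfolding defs by (intro DERIV_diff dp df)+
    have cont: "continuous_on A p" "continuous_on A q" "continuous_on A p'" "continuous_on A q'"
      "continuous_on A (f 0)" "continuous_on A (g 0)" "continuous_on A (f 1)" "continuous_on A (g 1)" for A
      using smooth_seq_continuous[OF f] smooth_seq_continuous[OF g] m
      by (auto simp: p_def q_def p'_def q'_def intro: continuous_on_poly)
    have cont2: "continuous_on A \<phi>" "continuous_on A \<psi>" "continuous_on A \<phi>'" "continuous_on A \<psi>'" for A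
      unfolding defs[abs_def] by (intro continuous_intros cont)+
    have at_a: "p a = f 0 a" "q a = g 0 a" "\<phi> a = 0" "\<psi> a = 0"
      by (auto simp: p_def q_def P_def Q_def defs poly_taylor_poly_center)
    have pd: "poly (pderiv P) x = (\<Sum>l\<le>m - 1. f (1 + l) a / fact l * (x - a) ^ l)"
      "poly (pderiv Q) x = (\<Sum>l\<le>m - 1. g (1 + l) a / fact l * (x - a) ^ l)" for x
      using m higher_pderiv_taylor_poly[of 1 m] by (auto simp: P_def Q_def poly_taylor_poly)
    have est: "\<bar>\<phi> x\<bar> \<le> \<eta> * L ^ m" "\<bar>\<psi> x\<bar> \<le> \<eta> * L ^ m"
      "\<bar>\<phi>' x\<bar> \<le> \<eta> * L ^ (m - 1)" "\<bar>\<psi>' x\<bar> \<le> \<eta> * L ^ (m - 1)" if x: "x \<in> {a..b}" for x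
    proof -
      have x': "x \<in> {c..d}" "\<bar>x - a\<bar> < d1" "\<bar>x - a\<bar> < d2" "\<bar>x - a\<bar> \<le> L" using x ab by (auto simp: L_def)
      have pw: "\<eta> * \<bar>x - a\<bar> ^ j \<le> \<eta> * L ^ j" for j
        using x' eta by (intro mult_left_mono power_mono) auto
      show "\<bar>\<phi> x\<bar> \<le> \<eta> * L ^ m" "\<bar>\<psi> x\<bar> \<le> \<eta> * L ^ m"
        using d1(2)[of a x 0] d2(2)[of a x 0] ab x' pw[of m]
        by (auto simp: defs p_def q_def P_def Q_def poly_taylor_poly)
      show "\<bar>\<phi>' x\<bar> \<le> \<eta> * L ^ (m - 1)" "\<bar>\<psi>' x\<bar> \<le> \<eta> * L ^ (m - 1)"
        using d1(2)[of a x 1] d2(2)[of a x 1] ab x' pw[of "m - 1"] m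
        by (auto simp: defs p'_def q'_def pd)
    qed
    \<comment> \<open>Integrating \<open>\<phi>' q - \<psi>' p\<close> by parts doubles
      \<open>p' \<psi> - q' \<phi>\<close> and leaves
      \<open>\<phi>(b) q(b) - \<psi>(b) p(b)\<close>. The last two terms of the discrepancy, where
      \<open>F(a) = p(a)\<close> and \<open>G(a) = q(a)\<close>, turn these boundary values into
      increments of \<open>q\<close> and \<open>p\<close>, that is into integrals of
      \<open>q'\<close> and \<open>p'\<close>.\<close>
    define r where "r s = 4 * (p' s * \<psi> s - q' s * \<phi> s) + 2 * (\<phi>' s * \<psi> s - \<psi>' s * \<phi> s)
        + 2 * \<phi> b * q' s - 2 * \<psi> b * p' s" for s
    have I1: "integral {a..b} (\<lambda>s. \<phi>' s * q s + \<phi> s * q' s - (\<psi>' s * p s + \<psi> s * p' s)) = \<phi> b * q b - \<psi> b * p b"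
    proof -
      have "((\<lambda>s. \<phi>' s * q s + \<phi> s * q' s - (\<psi>' s * p s + \<psi> s * p' s)) has_integral
         ((\<phi> b * q b - \<psi> b * p b) - (\<phi> a * q a - \<psi> a * p a))) {a..b}"
      proof (rule fundamental_theorem_of_calculus)
        fix x assume "x \<in> {a..b}"
        have "((\<lambda>s. \<phi> s * q s - \<psi> s * p s) has_real_derivative
            (\<phi>' x * q x + \<phi> x * q' x - (\<psi>' x * p x + \<psi> x * p' x))) (at x)"
          using dphi[of x] dp[of x] by (auto intro!: derivative_eq_intros)
        then show "((\<lambda>s. \<phi> s * q s - \<psi> s * p s) has_vector_derivative
            (\<phi>' x * q x + \<phi> x * q' x - (\<psi>' x * p x + \<psi> x * p' x))) (at x within {a..b})"
          by (metis has_field_derivative_at_within has_real_derivative_iff_has_vector_derivative)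
      qed (use L in \<open>simp add: L_def\<close>)
      then show ?thesis by (simp add: at_a integral_unique)
    qed
    have I2: "integral {a..b} q' = q b - q a" "integral {a..b} p' = p b - p a"
      using fundamental_theorem_of_calculus[of a b q q'] fundamental_theorem_of_calculus[of a b p p'] dp L
      by (auto intro!: integral_unique simp: L_def has_field_derivative_at_within
          simp flip: has_real_derivative_iff_has_vector_derivative)
    have intg: "(\<lambda>s. p' s * q s - q' s * p s) integrable_on {a..b}"
       "(\<lambda>s. \<phi>' s * q s + \<phi> s * q' s - (\<psi>' s * p s + \<psi> s * p' s)) integrable_on {a..b}"
       "p' integrable_on {a..b}" "q' integrable_on {a..b}" "(\<lambda>s. f 1 s * g 0 s - g 1 s * f 0 s) integrable_on {a..b}"
      by (intro integrable_continuous_real continuous_intros cont cont2)+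
    have "integral {a..b} r = integral {a..b} (\<lambda>s. 2 * (f 1 s * g 0 s - g 1 s * f 0 s)
       - 2 * (p' s * q s - q' s * p s) - 2 * (\<phi>' s * q s + \<phi> s * q' s - (\<psi>' s * p s + \<psi> s * p' s))
       + 2 * \<phi> b * q' s - 2 * \<psi> b * p' s)"
      by (intro integral_cong) (simp add: r_def defs algebra_simps)
    also have "\<dots> = 2 * integral {a..b} (\<lambda>s. f 1 s * g 0 s - g 1 s * f 0 s)
       - 2 * integral {a..b} (\<lambda>s. p' s * q s - q' s * p s)
       - 2 * (\<phi> b * q b - \<psi> b * p b) + 2 * \<phi> b * (q b - q a) - 2 * \<psi> b * (p b - p a)"
      by (simp only: integral_add integral_diff integral_mult_right I1 I2
          integrable_add integrable_diff integrable_on_mult_right intg)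
    also have "integral {a..b} (\<lambda>s. p' s * q s - q' s * p s)
      = (LBINT s=a..b. deriv (taylor m f a) s * taylor m g a s - deriv (taylor m g a) s * taylor m f a s)"
      using L unfolding taylor_conv_poly deriv_poly unfolding P_def[symmetric] Q_def[symmetric] p_def[symmetric]
        q_def[symmetric] p'_def[symmetric] q'_def[symmetric] L_def
      by (intro LBINT_eq_integral[symmetric] continuous_intros cont) auto
    finally have A: "area_discrepancy m f g H a b = integral {a..b} r"
      unfolding area_discrepancy_def H taylor_conv_poly deriv_poly unfolding P_def[symmetric] Q_def[symmetric] p_def[symmetric]
        q_def[symmetric] by (simp add: at_a algebra_simps defs)
    have V: "velocity m f g a b = L ^ (2 * m) + L ^ m * integral {a..b} (\<lambda>s. \<bar>p' s\<bar> + \<bar>q' s\<bar>)"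
      unfolding velocity_def taylor_conv_poly deriv_poly unfolding P_def[symmetric] Q_def[symmetric]
        p'_def[symmetric] q'_def[symmetric] L_def using L
      by (subst LBINT_eq_integral) (auto intro!: continuous_intros cont simp: L_def)
    have "\<bar>integral {a..b} r\<bar> \<le> integral {a..b} (\<lambda>s. 6 * \<eta> * L ^ m * (\<bar>p' s\<bar> + \<bar>q' s\<bar>) + 4 * \<eta> * L ^ (2 * m - 1))"
    proof (rule integral_bound_mono)
      show "continuous_on {a..b} r" unfolding r_def[abs_def] by (intro continuous_intros cont cont2)
      show "continuous_on {a..b} (\<lambda>s. 6 * \<eta> * L ^ m * (\<bar>p' s\<bar> + \<bar>q' s\<bar>) + 4 * \<eta> * L ^ (2 * m - 1))"
        by (intro continuous_intros cont cont2)
      fix s assume s: "s \<in> {a..b}"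
      note es = est[OF s]
      have eb: "\<bar>\<phi> b\<bar> \<le> \<eta> * L ^ m" "\<bar>\<psi> b\<bar> \<le> \<eta> * L ^ m" using est[of b] L by (auto simp: L_def)
      have "(\<eta> * L ^ (m - 1)) * (\<eta> * L ^ m) = \<eta> * (\<eta> * L ^ (2 * m - 1))"
        using m by (simp add: power_add[symmetric] mult_2)
      also have "\<dots> \<le> 1 * (\<eta> * L ^ (2 * m - 1))" using eta L by (intro mult_right_mono) auto
      finally have m2: "(\<eta> * L ^ (m - 1)) * (\<eta> * L ^ m) \<le> \<eta> * L ^ (2 * m - 1)" by simp
      show "\<bar>r s\<bar> \<le> 6 * \<eta> * L ^ m * (\<bar>p' s\<bar> + \<bar>q' s\<bar>) + 4 * \<eta> * L ^ (2 * m - 1)"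
        unfolding r_def using area_remainder_bound[OF es eb m2, of "p' s" "q' s"] by (simp only: mult.assoc)
    qed
    also have "\<dots> = 6 * \<eta> * L ^ m * integral {a..b} (\<lambda>s. \<bar>p' s\<bar> + \<bar>q' s\<bar>) + 4 * \<eta> * L ^ (2 * m - 1) * L"
    proof -
      have "(\<lambda>s. \<bar>p' s\<bar> + \<bar>q' s\<bar>) integrable_on {a..b}"
        by (intro integrable_continuous_real continuous_intros cont)
      then show ?thesis using L
        by (subst integral_add) (auto simp: L_def intro!: integrable_on_mult_right)
    qed
    also have "L ^ (2 * m - 1) * L = L ^ (2 * m)"
      using m power_Suc2[of L "2 * m - 1"] by simp
    then have "6 * \<eta> * L ^ m * integral {a..b} (\<lambda>s. \<bar>p' s\<bar> + \<bar>q' s\<bar>) + 4 * \<eta> * L ^ (2 * m - 1) * L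
       = 6 * \<eta> * velocity m f g a b - 2 * \<eta> * L ^ (2 * m)"
      by (simp add: V algebra_simps)
    also have "\<dots> \<le> 6 * \<eta> * velocity m f g a b" using eta L by simp
    also have "\<dots> \<le> \<epsilon> * velocity m f g a b"
    proof (intro mult_right_mono eta)
      have "0 \<le> integral {a..b} (\<lambda>s. \<bar>p' s\<bar> + \<bar>q' s\<bar>)"
        by (intro integral_nonneg integrable_continuous_real continuous_intros cont) auto
      then show "0 \<le> velocity m f g a b" using L by (simp add: V)
    qed
    finally show ?thesis by (simp add: A)
  qed
  then show ?thesis using d1(1) d2(1) by (intro exI[of _ "min d1 d2"]) simp
qed

section \<open>Gluing along the gaps of a closed set\<close>

text \<open>\<open>e\<close> is the first point of \<open>K\<close> met on the way from
  \<open>x\<close> to \<open>x0\<close>. The second conclusion is the form in which ends of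
  complementary components enter the gluing.\<close>

lemma nearest_in_segment:
  fixes K :: "real set"
  assumes "closed K" "x0 \<in> K" "x \<notin> K"
  obtains e where "e \<in> closed_segment x0 x" "closed_segment e x \<inter> K = {e}"
proof -
  have "closed (closed_segment x0 x \<inter> K)" "closed_segment x0 x \<inter> K \<noteq> {}"
    using assms by (auto intro: closed_Int)
  then obtain e where e: "e \<in> closed_segment x0 x \<inter> K"
    "\<And>y. y \<in> closed_segment x0 x \<inter> K \<Longrightarrow> dist x e \<le> dist x y"
    using distance_attains_inf by metis
  have "z = e" if "z \<in> closed_segment e x \<inter> K" for z
    using e(1) that e(2)[of z] by (auto simp: closed_segment_eq_real_ivl dist_real_def split: if_splits)
  then show thesis using e(1) by (intro that[of e]) auto
qed

text \<open>\<open>P\<close> is constant on each component of the complement, and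
  \<open>closed_segment e x \<inter> K = {e}\<close> says that \<open>e\<close> is an end of the
  component of \<open>x\<close>. For the derivative at a point of \<open>K\<close>, a nearby
  \<open>y\<close> outside \<open>K\<close> is reached through an end \<open>z\<close> of its
  component: the derivative along \<open>K\<close> controls the way to \<open>z\<close>, the mean
  value inequality the rest.\<close>

lemma glue_core:
  fixes F :: "nat \<Rightarrow> real \<Rightarrow> real" and P :: "real \<Rightarrow> real poly"
  assumes K: "closed K"
    and contF: "\<And>k. k \<le> m \<Longrightarrow> continuous_on K (F k)"
    and derF: "\<And>k x. k < m \<Longrightarrow> x \<in> K \<Longrightarrow> (F k has_real_derivative F (Suc k) x) (at x within K)"
    and const: "\<And>x y. closed_segment x y \<inter> K = {} \<Longrightarrow> P x = P y"
    and match: "\<And>k e x. k \<le> m \<Longrightarrow> x \<notin> K \<Longrightarrow> closed_segment e x \<inter> K = {e} \<Longrightarrow>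
                  poly ((pderiv ^^ k) (P x)) e = F k e"
    and unif: "\<And>k \<epsilon>. k \<le> m \<Longrightarrow> \<epsilon> > 0 \<Longrightarrow> \<exists>\<delta>>0. \<forall>e x. x \<notin> K \<longrightarrow> closed_segment e x \<inter> K = {e} \<longrightarrow>
                  \<bar>x - e\<bar> < \<delta> \<longrightarrow> \<bar>poly ((pderiv ^^ k) (P x)) x - F k e\<bar> < \<epsilon>"
  shows "smooth_seq m (\<lambda>k x. if x \<in> K then F k x else poly ((pderiv ^^ k) (P x)) x)"
proof -
  define u where "u k x = (if x \<in> K then F k x else poly ((pderiv ^^ k) (P x)) x)" for k x
  have off: "(u k has_real_derivative u (Suc k) x) (at x)" if x: "x \<notin> K" for k x
  proof -
    obtain r where r: "r > 0" "ball x r \<inter> K = {}"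
      using K x by (metis open_Compl open_contains_ball ComplI disjoint_eq_subset_Compl)
    have eq: "u k y = poly ((pderiv ^^ k) (P x)) y" if y: "y \<in> ball x r" for y k
    proof -
      have "closed_segment y x \<subseteq> ball x r" using y r(1)
        by (intro closed_segment_subset) auto
      then have "P y = P x" using r by (intro const) auto
      moreover have "y \<notin> K" using y r by auto
      ultimately show ?thesis by (simp add: u_def)
    qed
    have "(poly ((pderiv ^^ k) (P x)) has_real_derivative u (Suc k) x) (at x)"
      using eq[of x "Suc k"] r by (simp add: poly_DERIV)
    then show ?thesis
      by (rule has_field_derivative_transform_within_open[of _ _ _ "ball x r"]) (use r eq in auto)
  qed
  \<comment> \<open>Continuity of all orders comes first: on \<open>K\<close>, differentiability of
    \<open>u k\<close> rests on continuity of \<open>u (Suc k)\<close>.\<close>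
  have cont: "isCont (u k) x" if k: "k \<le> m" for k x
  proof (cases "x \<in> K")
    case False
    then show ?thesis using off DERIV_isCont by blast
  next
    case x: True
    show ?thesis unfolding continuous_at_eps_delta
    proof (intro allI impI)
      fix e :: real assume e: "e > 0"
      from contF[OF k, unfolded continuous_on_iff dist_real_def, rule_format, OF x half_gt_zero[OF e]]
      obtain d1 where d1: "d1 > 0" "\<forall>y\<in>K. \<bar>y - x\<bar> < d1 \<longrightarrow> \<bar>F k y - F k x\<bar> < e / 2"
        by blast
      from unif[OF k half_gt_zero[OF e]] obtain d2 where d2: "d2 > 0"
        "\<forall>z y. y \<notin> K \<longrightarrow> closed_segment z y \<inter> K = {z} \<longrightarrow>
                  \<bar>y - z\<bar> < d2 \<longrightarrow> \<bar>poly ((pderiv ^^ k) (P y)) y - F k z\<bar> < e / 2"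
        by blast
      have "\<bar>u k y - u k x\<bar> < e" if y: "\<bar>y - x\<bar> < min d1 d2" for y
      proof (cases "y \<in> K")
        case True
        then show ?thesis using d1(2)[rule_format, of y] y x e by (simp add: u_def)
      next
        case False
        obtain z where z: "z \<in> closed_segment x y" "closed_segment z y \<inter> K = {z}"
          using nearest_in_segment[OF K x False] .
        have "\<bar>z - x\<bar> < d1" "\<bar>y - z\<bar> < d2"
          using z(1) y by (auto simp: closed_segment_eq_real_ivl split: if_splits)
        moreover have "z \<in> K" using z(2) by auto
        ultimately have "\<bar>F k z - F k x\<bar> < e / 2" "\<bar>poly ((pderiv ^^ k) (P y)) y - F k z\<bar> < e / 2"
          using d1 d2(2)[rule_format, OF False z(2)] by auto
        then show ?thesis using False x unfolding u_def by (simp add: abs_if split: if_splits)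
      qed
      then show "\<exists>d>0. \<forall>y. dist y x < d \<longrightarrow> dist (u k y) (u k x) < e"
        using d1(1) d2(1) by (intro exI[of _ "min d1 d2"]) (simp add: dist_real_def)
    qed
  qed
  have on: "(u k has_real_derivative u (Suc k) x) (at x)" if x: "x \<in> K" and k: "k < m" for k x
    unfolding has_field_derivative_def has_derivative_at_alt
  proof (intro conjI allI impI bounded_linear_mult_right)
    fix e :: real assume e: "e > 0"
    define c where "c = F (Suc k) x"
    have "(F k has_derivative (*) c) (at x within K)"
      using derF[OF k x] by (simp add: has_field_derivative_def c_def)
    then have "\<forall>e>0. \<exists>d>0. \<forall>y\<in>K. \<bar>y - x\<bar> < d \<longrightarrow> \<bar>F k y - F k x - c * (y - x)\<bar> \<le> e * \<bar>y - x\<bar>"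
      unfolding has_derivative_within_alt real_norm_def by (rule conjunct2)
    then obtain d1 where d1: "d1 > 0"
      "\<forall>y\<in>K. \<bar>y - x\<bar> < d1 \<longrightarrow> \<bar>F k y - F k x - c * (y - x)\<bar> \<le> e * \<bar>y - x\<bar>"
      using e by blast
    from cont[OF Suc_leI[OF k], of x, unfolded continuous_at_eps_delta dist_real_def, rule_format, OF e]
    obtain d2 where d2: "d2 > 0" "\<forall>y. \<bar>y - x\<bar> < d2 \<longrightarrow> \<bar>u (Suc k) y - u (Suc k) x\<bar> < e"
      by blast
    have "\<bar>u k y - u k x - u (Suc k) x * (y - x)\<bar> \<le> e * \<bar>y - x\<bar>" if y: "\<bar>y - x\<bar> < min d1 d2" for y
    proof (cases "y \<in> K")
      case True
      then show ?thesis using d1(2)[rule_format, of y] y x by (simp add: u_def c_def)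
    next
      case False
      obtain z where z: "z \<in> closed_segment x y" "closed_segment z y \<inter> K = {z}"
        using nearest_in_segment[OF K x False] .
      have zK: "z \<in> K" using z by auto
      have zy: "\<bar>z - x\<bar> < d1" "\<bar>y - z\<bar> + \<bar>z - x\<bar> = \<bar>y - x\<bar>"
        using z(1) y by (auto simp: closed_segment_eq_real_ivl split: if_splits)
      let ?q = "\<lambda>k. poly ((pderiv ^^ k) (P y))"
      have eq: "u j w = ?q j w" if w: "w \<in> closed_segment z y" and j: "j \<le> m" for j w
      proof (cases "w = z")
        case True
        then show ?thesis using match[OF j False z(2)] zK by (simp add: u_def)
      next
        case wz: False
        have sub: "closed_segment w y \<subseteq> closed_segment z y" using w by (simp add: subset_closed_segment)
        have nz: "z \<notin> closed_segment w y" using w wz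
          by (auto simp: closed_segment_eq_real_ivl split: if_splits)
        have n: "closed_segment w y \<inter> K = {}"
        proof (rule equals0I)
          fix v assume v: "v \<in> closed_segment w y \<inter> K"
          then have "v \<in> closed_segment z y \<inter> K" using sub by auto
          then show False unfolding z(2) using nz v by simp
        qed
        then have "w \<notin> K" by auto
        then show ?thesis using const[OF n] by (simp add: u_def)
      qed
      \<comment> \<open>Subtracting the line of slope \<open>c\<close> leaves a derivative of size
        at most \<open>e\<close>, since the segment from \<open>z\<close> to \<open>y\<close> stays
        within \<open>d2\<close> of \<open>x\<close>.\<close>
      have "norm ((?q k y - c * y) - (?q k z - c * z)) \<le> e * norm (y - z)"
      proof (rule field_differentiable_bound[where S="closed_segment z y" and f'="\<lambda>w. ?q (Suc k) w - c"])
        fix w assume w: "w \<in> closed_segment z y"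
        show "((\<lambda>w. ?q k w - c * w) has_field_derivative ?q (Suc k) w - c) (at w within closed_segment z y)"
          by (auto intro!: derivative_eq_intros poly_DERIV[THEN has_field_derivative_at_within])
        have "\<bar>w - x\<bar> < d2"
          using z(1) w y by (auto simp: closed_segment_eq_real_ivl split: if_splits)
        from d2(2)[rule_format, OF this] show "norm (?q (Suc k) w - c) \<le> e"
          using eq[OF w, of "Suc k"] k x by (simp add: u_def c_def)
      qed auto
      then have 1: "\<bar>?q k y - ?q k z - c * (y - z)\<bar> \<le> e * \<bar>y - z\<bar>" by (simp add: algebra_simps)
      have 2: "\<bar>F k z - F k x - c * (z - x)\<bar> \<le> e * \<bar>z - x\<bar>" using d1(2) zK zy by auto
      have "?q k y = u k y" "?q k z = F k z" "u k x = F k x" "u (Suc k) x = c"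
        using eq[of y k] eq[of z k] zK k x by (simp_all add: u_def c_def)
      then have "u k y - u k x - u (Suc k) x * (y - x)
          = (?q k y - ?q k z - c * (y - z)) + (F k z - F k x - c * (z - x))"
        by (simp add: algebra_simps)
      also have "\<bar>\<dots>\<bar> \<le> e * \<bar>y - z\<bar> + e * \<bar>z - x\<bar>"
        by (rule order_trans[OF abs_triangle_ineq add_mono[OF 1 2]])
      also have "\<dots> = e * \<bar>y - x\<bar>" using zy(2) by (simp flip: distrib_left)
      finally show ?thesis .
    qed
    then show "\<exists>d>0. \<forall>y. norm (y - x) < d \<longrightarrow> norm (u k y - u k x - u (Suc k) x * (y - x)) \<le> e * norm (y - x)"
      using d1(1) d2(1) by (intro exI[of _ "min d1 d2"]) simp
  qed
  have "smooth_seq m u"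
    unfolding smooth_seq_def using off on cont by (auto simp: continuous_on_eq_continuous_at)
  then show ?thesis unfolding u_def .
qed

section \<open>Gaps of a compact set and gluing of polynomials on them\<close>

definition gap :: "real set \<Rightarrow> real \<Rightarrow> real \<Rightarrow> bool" where
  "gap K a b \<longleftrightarrow> a \<in> K \<and> b \<in> K \<and> a < b \<and> {a<..<b} \<inter> K = {}"

lemma gap_cases:
  assumes K: "compact K" "K \<noteq> {}" and x: "x \<notin> K"
  obtains "x < Inf K" | "x > Sup K" | a b where "gap K a b" "a < x" "x < b"
proof -
  have cl: "closed K" "bounded K" using K by (auto simp: compact_imp_closed compact_imp_bounded)
  have bdd: "bdd_above K" "bdd_below K" using cl by (auto intro: bounded_imp_bdd_above bounded_imp_bdd_below)
  have ends: "Inf K \<in> K" "Sup K \<in> K" using K bdd cl closed_contains_Inf closed_contains_Sup by auto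
  show thesis
  proof (cases "x < Inf K \<or> x > Sup K")
    case False
    then have s: "Inf K \<le> x" "x \<le> Sup K" by auto
    have "Inf K \<noteq> x" "Sup K \<noteq> x" using ends x by auto
    then have s: "Inf K < x" "x < Sup K" using s by auto
    obtain a where a: "a \<in> closed_segment (Inf K) x" "closed_segment a x \<inter> K = {a}"
      using nearest_in_segment[OF cl(1) ends(1) x] .
    obtain b where b: "b \<in> closed_segment (Sup K) x" "closed_segment b x \<inter> K = {b}"
      using nearest_in_segment[OF cl(1) ends(2) x] .
    have ab: "a \<in> K" "b \<in> K" using a b by auto
    then have "a \<noteq> x" "b \<noteq> x" using x by auto
    then have ax: "a < x" "x < b" using s a(1) b(1) by (auto simp: closed_segment_eq_real_ivl)
    have "z \<notin> K" if "z \<in> {a<..<b}" for z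
    proof
      assume "z \<in> K"
      show False
      proof (cases "z \<le> x")
        case True
        then have "z \<in> closed_segment a x \<inter> K" using \<open>z \<in> K\<close> that ax by (auto simp: closed_segment_eq_real_ivl)
        then show False using a(2) that by auto
      next
        case False
        then have "z \<in> closed_segment b x \<inter> K" using \<open>z \<in> K\<close> that ax by (auto simp: closed_segment_eq_real_ivl)
        then show False using b(2) that by auto
      qed
    qed
    then have "{a<..<b} \<inter> K = {}" by blast
    then show thesis using that(3)[of a b] ab ax by (simp add: gap_def)
  qed (use that in blast)
qed

lemma gap_unique:
  assumes "gap K a b" "gap K a' b'" "a < x" "x < b" "a' < x" "x < b'"
  shows "a = a' \<and> b = b'"
proof -
  have *: "\<And>z. z \<in> K \<Longrightarrow> \<not> (a < z \<and> z < b)" "\<And>z. z \<in> K \<Longrightarrow> \<not> (a' < z \<and> z < b')"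
    using assms by (auto simp: gap_def)
  have "a \<in> K" "b \<in> K" "a' \<in> K" "b' \<in> K" using assms by (auto simp: gap_def)
  then show ?thesis using *(1)[of a'] *(1)[of b'] *(2)[of a] *(2)[of b] assms(3-) by linarith
qed

text \<open>The left ends of gaps of length at least \<delta> are \<delta>-separated, so the floor
  of \<open>a / \<delta>\<close> separates them, and it takes finitely many values on a bounded
  set.\<close>

lemma finite_long_gaps:
  assumes K: "bounded K" and d: "\<delta> > 0"
  shows "finite {(a, b). gap K a b \<and> \<delta> \<le> b - a}" (is "finite ?S")
proof -
  obtain B where B: "\<And>x. x \<in> K \<Longrightarrow> \<bar>x\<bar> \<le> B" using K by (auto simp: bounded_iff)
  let ?f = "\<lambda>(a :: real, b :: real). \<lfloor>a / \<delta>\<rfloor>"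
  have "?f ` ?S \<subseteq> {\<lfloor>- B / \<delta>\<rfloor>..\<lfloor>B / \<delta>\<rfloor>}"
  proof clarify
    fix a b assume "gap K a b"
    then have "- B \<le> a" "a \<le> B" using B[of a] by (auto simp: gap_def)
    then have "- B / \<delta> \<le> a / \<delta>" "a / \<delta> \<le> B / \<delta>" using d by (intro divide_right_mono; simp)+
    then show "\<lfloor>a / \<delta>\<rfloor> \<in> {\<lfloor>- B / \<delta>\<rfloor>..\<lfloor>B / \<delta>\<rfloor>}" using floor_mono by auto
  qed
  then have "finite (?f ` ?S)" by (rule finite_subset) auto
  moreover have lt: "\<lfloor>a / \<delta>\<rfloor> < \<lfloor>a' / \<delta>\<rfloor>" if "gap K a b" "gap K a' b'" "\<delta> \<le> b - a" "a < a'" for a b a' b'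
  proof -
    have "b \<le> a'" using that unfolding gap_def by (metis IntI empty_iff greaterThanLessThan_iff not_le)
    then have "a + \<delta> \<le> a'" using that by simp
    then have "(a + \<delta>) / \<delta> \<le> a' / \<delta>" using d by (intro divide_right_mono) auto
    then have "a / \<delta> + 1 \<le> a' / \<delta>" using d by (simp add: add_divide_distrib)
    then show ?thesis by linarith
  qed
  have "inj_on ?f ?S"
  proof (rule inj_onI, clarify)
    fix a b a' b' assume h: "gap K a b" "gap K a' b'" "\<delta> \<le> b - a" "\<delta> \<le> b' - a'" "\<lfloor>a / \<delta>\<rfloor> = \<lfloor>a' / \<delta>\<rfloor>"
    then have "a = a'" using lt[of a b a' b'] lt[of a' b' a b] by linarith
    moreover have "b = b'" using h \<open>a = a'\<close> unfolding gap_def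
      by (metis IntI empty_iff greaterThanLessThan_iff linorder_neqE)
    ultimately show "a = a' \<and> b = b'" by simp
  qed
  ultimately show ?thesis using finite_imageD by blast
qed

text \<open>Control of order \<open>m\<close> on short gaps suffices, because lower orders follow by
  integration from the left end. The remaining components, long gaps and the two unbounded ones with
  Taylor polynomials at the extreme points of \<open>K\<close>, are finitely many, so there plain
  continuity of polynomials is enough.\<close>

lemma glue_gaps:
  fixes F :: "nat \<Rightarrow> real \<Rightarrow> real" and p :: "real \<Rightarrow> real \<Rightarrow> real poly"
  assumes K: "compact K" "K \<noteq> {}"
    and contF: "\<And>k. k \<le> m \<Longrightarrow> continuous_on K (F k)"
    and derF: "\<And>k x. k < m \<Longrightarrow> x \<in> K \<Longrightarrow> (F k has_real_derivative F (Suc k) x) (at x within K)"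
    and left: "\<And>k a b. k \<le> m \<Longrightarrow> gap K a b \<Longrightarrow> poly ((pderiv ^^ k) (p a b)) a = F k a"
    and right: "\<And>k a b. k \<le> m \<Longrightarrow> gap K a b \<Longrightarrow> poly ((pderiv ^^ k) (p a b)) b = F k b"
    and small: "\<And>\<epsilon>. \<epsilon> > 0 \<Longrightarrow> \<exists>\<delta>>0. \<forall>a b. gap K a b \<longrightarrow> b - a < \<delta> \<longrightarrow>
                  (\<forall>x\<in>{a..b}. \<bar>poly ((pderiv ^^ m) (p a b)) x - F m a\<bar> \<le> \<epsilon>)"
  obtains u where "smooth_seq m u" "\<And>k x. k \<le> m \<Longrightarrow> x \<in> K \<Longrightarrow> u k x = F k x"
    "\<And>k a b x. k \<le> m \<Longrightarrow> gap K a b \<Longrightarrow> x \<in> {a..b} \<Longrightarrow> u k x = poly ((pderiv ^^ k) (p a b)) x"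
proof -
  define lo where "lo = Inf K"
  define hi where "hi = Sup K"
  have cl: "closed K" "bounded K" using K by (auto simp: compact_imp_closed compact_imp_bounded)
  have bdd: "bdd_above K" "bdd_below K" using cl by (auto intro: bounded_imp_bdd_above bounded_imp_bdd_below)
  have ends: "lo \<in> K" "hi \<in> K" using K bdd cl closed_contains_Inf closed_contains_Sup by (auto simp: lo_def hi_def)
  have bnd: "lo \<le> x" "x \<le> hi" if "x \<in> K" for x
    using that bdd by (auto simp: lo_def hi_def cInf_lower cSup_upper)
  define Plo where "Plo = taylor_poly m (\<lambda>k. F k lo) lo"
  define Phi where "Phi = taylor_poly m (\<lambda>k. F k hi) hi"
  define P where "P x = (if x < lo then Plo else if x > hi then Phi
     else (THE q. \<exists>a b. gap K a b \<and> a < x \<and> x < b \<and> q = p a b))" for x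
  have P_gap: "P x = p a b" if "gap K a b" "a < x" "x < b" for a b x
  proof -
    have "\<not> x < lo" "\<not> x > hi" using bnd that by (force simp: gap_def)+
    then show ?thesis unfolding P_def using that gap_unique[OF _ that(1)] by (auto intro!: the_equality)
  qed
  have P_lo: "P x = Plo" if "x < lo" for x using that by (simp add: P_def)
  have P_hi: "P x = Phi" if "x > hi" for x using that bnd[OF ends(1)] by (simp add: P_def)
  have center: "poly ((pderiv ^^ k) Plo) lo = F k lo" "poly ((pderiv ^^ k) Phi) hi = F k hi" if "k \<le> m" for k
    using that by (auto simp: Plo_def Phi_def poly_higher_pderiv_taylor_poly_center)
  have comp: "(x < lo \<and> e = lo) \<or> (x > hi \<and> e = hi) \<or> (\<exists>a b. gap K a b \<and> a < x \<and> x < b \<and> (e = a \<or> e = b))"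
    if x: "x \<notin> K" and e: "closed_segment e x \<inter> K = {e}" for e x
    using K(1) K(2) x
  proof (cases rule: gap_cases)
    case 1
    then have xl: "x < lo" by (simp add: lo_def)
    have "e \<in> K" using e by auto
    then have "lo \<in> closed_segment e x" using xl bnd[of e] by (simp add: closed_segment_eq_real_ivl)
    then have "lo \<in> closed_segment e x \<inter> K" using ends by simp
    then show ?thesis using e xl by simp
  next
    case 2
    then have xh: "x > hi" by (simp add: hi_def)
    have "e \<in> K" using e by auto
    then have "hi \<in> closed_segment e x" using xh bnd[of e] by (simp add: closed_segment_eq_real_ivl)
    then have "hi \<in> closed_segment e x \<inter> K" using ends by simp
    then show ?thesis using e xh by simp
  next
    case (3 a b)
    have ab: "a \<in> K" "b \<in> K" and n: "\<And>z. z \<in> K \<Longrightarrow> \<not> (a < z \<and> z < b)" using 3 by (auto simp: gap_def)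
    have eK: "e \<in> K" using e by auto
    have "a \<in> closed_segment e x \<or> b \<in> closed_segment e x"
      using 3 n[OF eK] by (auto simp: closed_segment_eq_real_ivl)
    then have "a \<in> closed_segment e x \<inter> K \<or> b \<in> closed_segment e x \<inter> K" using ab by simp
    then have "e = a \<or> e = b" unfolding e by auto
    then show ?thesis using 3 by (intro disjI2 exI[of _ a] exI[of _ b]) simp
  qed
  \<comment> \<open>Descending induction from \<open>m\<close>: on short gaps the derivative of
    order \<open>Suc k\<close> is at most \<open>B + 1\<close>, so the one of order \<open>k\<close>
    moves by at most \<open>B + 1\<close> times the gap length.\<close>
  have osc: "\<exists>\<delta>>0. \<forall>a b. gap K a b \<longrightarrow> b - a < \<delta> \<longrightarrow> (\<forall>x\<in>{a..b}. \<bar>poly ((pderiv ^^ k) (p a b)) x - F k a\<bar> \<le> \<epsilon>)"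
    if "k \<le> m" "\<epsilon> > 0" for k \<epsilon>
    using that
  proof (induction arbitrary: \<epsilon> rule: inc_induct)
    case base
    then show ?case using small by blast
  next
    case (step k)
    obtain d where d: "d > 0" "\<And>a b x. gap K a b \<Longrightarrow> b - a < d \<Longrightarrow> x \<in> {a..b} \<Longrightarrow>
       \<bar>poly ((pderiv ^^ Suc k) (p a b)) x - F (Suc k) a\<bar> \<le> 1"
      using step.IH[of 1] by auto
    have "compact (F (Suc k) ` K)" using K contF[of "Suc k"] step.hyps by (intro compact_continuous_image) auto
    then obtain B where B: "\<And>x. x \<in> K \<Longrightarrow> \<bar>F (Suc k) x\<bar> \<le> B"
      using compact_imp_bounded by (force simp: bounded_iff)
    have B0: "B \<ge> 0" using B[OF ends(1)] by linarith
    have "\<bar>poly ((pderiv ^^ k) (p a b)) x - F k a\<bar> \<le> \<epsilon>"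
      if g: "gap K a b" "b - a < min d (\<epsilon> / (B + 1))" "x \<in> {a..b}" for a b x
    proof -
      have "norm (poly ((pderiv ^^ k) (p a b)) x - poly ((pderiv ^^ k) (p a b)) a) \<le> (B + 1) * norm (x - a)"
      proof (rule field_differentiable_bound[where S="{a..b}" and f'="poly ((pderiv ^^ Suc k) (p a b))"])
        fix y assume y: "y \<in> {a..b}"
        show "(poly ((pderiv ^^ k) (p a b)) has_field_derivative poly ((pderiv ^^ Suc k) (p a b)) y) (at y within {a..b})"
          by (simp add: poly_DERIV has_field_derivative_at_within)
        have "a \<in> K" using g by (auto simp: gap_def)
        then show "norm (poly ((pderiv ^^ Suc k) (p a b)) y) \<le> B + 1" using d(2)[OF g(1) _ y] B[of a] g by auto
      qed (use g in auto)
      also have "\<dots> \<le> (B + 1) * (\<epsilon> / (B + 1))" using g B0 by (intro mult_left_mono) auto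
      also have "\<dots> = \<epsilon>" using B0 by simp
      finally show ?thesis using left[of k a b] g step.hyps by simp
    qed
    moreover have "min d (\<epsilon> / (B + 1)) > 0" using d step.prems B0 by simp
    ultimately show ?case by (intro exI[of _ "min d (\<epsilon> / (B + 1))"]) blast
  qed
  have sm: "smooth_seq m (\<lambda>k x. if x \<in> K then F k x else poly ((pderiv ^^ k) (P x)) x)"
  proof (rule glue_core[OF cl(1)])
    fix x y assume n: "closed_segment x y \<inter> K = {}"
    then have x: "x \<notin> K" by auto
    from K(1) K(2) x show "P x = P y"
    proof (cases rule: gap_cases)
      case 1
      then have "x < lo" by (simp add: lo_def)
      moreover have "lo \<notin> closed_segment x y" using n ends by auto
      ultimately have "y < lo" by (auto simp: closed_segment_eq_real_ivl split: if_splits)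
      then show ?thesis using \<open>x < lo\<close> by (simp add: P_lo)
    next
      case 2
      then have "x > hi" by (simp add: hi_def)
      moreover have "hi \<notin> closed_segment x y" using n ends by auto
      ultimately have "y > hi" by (auto simp: closed_segment_eq_real_ivl split: if_splits)
      then show ?thesis using \<open>x > hi\<close> by (simp add: P_hi)
    next
      case (3 a b)
      then have "a \<notin> closed_segment x y" "b \<notin> closed_segment x y" using n by (auto simp: gap_def)
      then have "a < y" "y < b" using 3 by (auto simp: closed_segment_eq_real_ivl split: if_splits)
      then show ?thesis using P_gap 3 by simp
    qed
  next
    fix k e x assume k: "k \<le> m" and x: "x \<notin> K" and e: "closed_segment e x \<inter> K = {e}"
    from comp[OF x e] show "poly ((pderiv ^^ k) (P x)) e = F k e"
      by (elim disjE exE conjE) (simp_all add: P_lo P_hi P_gap left right center k)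
  next
    fix k and \<epsilon> :: real assume k: "k \<le> m" and eps: "\<epsilon> > 0"
    \<comment> \<open>A third, because the comparison with the right end goes through the left end
      and uses this bound twice.\<close>
    obtain d where d: "d > 0" "\<And>a b x. gap K a b \<Longrightarrow> b - a < d \<Longrightarrow> x \<in> {a..b} \<Longrightarrow>
       \<bar>poly ((pderiv ^^ k) (p a b)) x - F k a\<bar> \<le> \<epsilon> / 3"
      using osc[OF k, of "\<epsilon> / 3"] eps by auto
    \<comment> \<open>The finitely many pairs of a polynomial and an end of its component for which
      smallness does not come from a short gap.\<close>
    define Z where "Z = {(Plo, lo), (Phi, hi)} \<union>
      (\<lambda>(a, b). (p a b, a)) ` {(a, b). gap K a b \<and> d \<le> b - a} \<union>
      (\<lambda>(a, b). (p a b, b)) ` {(a, b). gap K a b \<and> d \<le> b - a}"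
    have "finite Z" unfolding Z_def using finite_long_gaps[OF cl(2) d(1)] by auto
    moreover have "\<forall>z\<in>Z. eventually (\<lambda>t. \<forall>x. \<bar>x - snd z\<bar> < t \<longrightarrow>
        \<bar>poly ((pderiv ^^ k) (fst z)) x - poly ((pderiv ^^ k) (fst z)) (snd z)\<bar> < \<epsilon>) (at_right 0)"
    proof
      fix z assume "z \<in> Z"
      have "isCont (poly ((pderiv ^^ k) (fst z))) (snd z)" by simp
      then obtain t where t: "t > 0" "\<And>x. \<bar>x - snd z\<bar> < t \<Longrightarrow>
         \<bar>poly ((pderiv ^^ k) (fst z)) x - poly ((pderiv ^^ k) (fst z)) (snd z)\<bar> < \<epsilon>"
        unfolding continuous_at_eps_delta dist_real_def using eps by metis
      then show "eventually (\<lambda>t. \<forall>x. \<bar>x - snd z\<bar> < t \<longrightarrow>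
        \<bar>poly ((pderiv ^^ k) (fst z)) x - poly ((pderiv ^^ k) (fst z)) (snd z)\<bar> < \<epsilon>) (at_right 0)"
        unfolding eventually_at_right_field by (intro exI[of _ t]) auto
    qed
    ultimately have "eventually (\<lambda>t. \<forall>z\<in>Z. \<forall>x. \<bar>x - snd z\<bar> < t \<longrightarrow>
        \<bar>poly ((pderiv ^^ k) (fst z)) x - poly ((pderiv ^^ k) (fst z)) (snd z)\<bar> < \<epsilon>) (at_right 0)"
      by (rule eventually_ball_finite)
    then obtain t0 where "t0 > 0" "\<And>t. 0 < t \<Longrightarrow> t < t0 \<Longrightarrow> \<forall>z\<in>Z. \<forall>x. \<bar>x - snd z\<bar> < t \<longrightarrow>
        \<bar>poly ((pderiv ^^ k) (fst z)) x - poly ((pderiv ^^ k) (fst z)) (snd z)\<bar> < \<epsilon>"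
      unfolding eventually_at_right_field by auto
    then obtain t where t: "t > 0" "\<And>q e x. (q, e) \<in> Z \<Longrightarrow> \<bar>x - e\<bar> < t \<Longrightarrow>
        \<bar>poly ((pderiv ^^ k) q) x - poly ((pderiv ^^ k) q) e\<bar> < \<epsilon>"
      using dense by (metis fst_conv snd_conv)
    have "\<bar>poly ((pderiv ^^ k) (P x)) x - F k e\<bar> < \<epsilon>"
      if x: "x \<notin> K" "closed_segment e x \<inter> K = {e}" "\<bar>x - e\<bar> < t" for e x
      using comp[OF x(1,2)]
    proof (elim disjE exE conjE)
      assume h: "x < lo" "e = lo"
      then show ?thesis using t(2)[of Plo lo x] x k
        by (simp add: Z_def P_lo center)
    next
      assume h: "x > hi" "e = hi"
      then show ?thesis using t(2)[of Phi hi x] x k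
        by (simp add: Z_def P_hi center)
    next
      fix a b assume g: "gap K a b" "a < x" "x < b" and e: "e = a"
      show ?thesis
      proof (cases "b - a < d")
        case True
        then show ?thesis using d(2)[OF g(1), of x] g e eps P_gap[OF g] by auto
      next
        case False
        then have "(p a b, a) \<in> Z" using g(1) unfolding Z_def by (intro UnI1[OF UnI2] image_eqI[of _ _ "(a, b)"]) auto
        then show ?thesis using t(2)[of "p a b" a x] e x left[OF k g(1)] P_gap[OF g] by simp
      qed
    next
      fix a b assume g: "gap K a b" "a < x" "x < b" and e: "e = b"
      show ?thesis
      proof (cases "b - a < d")
        case True
        then have "\<bar>poly ((pderiv ^^ k) (p a b)) x - F k a\<bar> \<le> \<epsilon> / 3" "\<bar>F k b - F k a\<bar> \<le> \<epsilon> / 3"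
          using d(2)[OF g(1), of x] d(2)[OF g(1), of b] right[OF k g(1)] g by auto
        then have "\<bar>poly ((pderiv ^^ k) (p a b)) x - F k b\<bar> < \<epsilon>" using eps by linarith
        then show ?thesis using e P_gap[OF g] by simp
      next
        case False
        then have "(p a b, b) \<in> Z" using g(1) unfolding Z_def by (intro UnI2 image_eqI[of _ _ "(a, b)"]) auto
        then show ?thesis using t(2)[of "p a b" b x] e x right[OF k g(1)] P_gap[OF g] by simp
      qed
    qed
    then show "\<exists>\<delta>>0. \<forall>e x. x \<notin> K \<longrightarrow> closed_segment e x \<inter> K = {e} \<longrightarrow>
                  \<bar>x - e\<bar> < \<delta> \<longrightarrow> \<bar>poly ((pderiv ^^ k) (P x)) x - F k e\<bar> < \<epsilon>"
      using t(1) by blast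
  qed (use contF derF in auto)
  show thesis
  proof (rule that[OF sm])
    fix k a b x assume k: "k \<le> m" and g: "gap K a b" and x: "x \<in> {a..b}"
    show "(if x \<in> K then F k x else poly ((pderiv ^^ k) (P x)) x) = poly ((pderiv ^^ k) (p a b)) x"
    proof (cases "x = a \<or> x = b")
      case True
      then show ?thesis using left[OF k g] right[OF k g] g by (auto simp: gap_def)
    next
      case False
      then have "a < x" "x < b" using x by auto
      moreover from this have "x \<notin> K" using g by (auto simp: gap_def)
      ultimately show ?thesis using P_gap[OF g] by simp
    qed
  qed simp
qed

section \<open>Whitney extension on the line\<close>

text \<open>The Whitney remainder is \<open>o(|y - x|^(m - k))\<close> with
  \<open>m - k \<ge> 1\<close>, so it contributes nothing to the derivative along
  \<open>K\<close>.\<close>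

lemma whitney_field_deriv:
  assumes w: "whitney_field m K F" and k: "k < m" and x: "x \<in> K"
  shows "(F k has_real_derivative F (Suc k) x) (at x within K)"
proof -
  define T where "T = taylor_poly (m - k) (\<lambda>l. F (k + l) x) x"
  have "poly (pderiv T) x = F (Suc k) x"
    using poly_higher_pderiv_taylor_poly_center[of 1 "m - k" "\<lambda>l. F (k + l) x" x] k by (simp add: T_def)
  then have T: "(poly T has_real_derivative F (Suc k) x) (at x within K)"
    using poly_DERIV[of T x] by (simp add: has_field_derivative_at_within)
  have r: "((\<lambda>y. F k y - poly T y) has_real_derivative 0) (at x within K)"
    unfolding has_field_derivative_def has_derivative_within_alt real_norm_def
  proof (intro conjI allI impI bounded_linear_mult_right)
    fix e :: real assume e: "e > 0"
    have "\<forall>\<epsilon>>0. \<exists>\<delta>>0. \<forall>a\<in>K. \<forall>b\<in>K. \<bar>a - b\<bar> < \<delta> \<longrightarrow>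
        \<bar>F k b - (\<Sum>l\<le>m - k. F (k + l) a / fact l * (b - a) ^ l)\<bar> \<le> \<epsilon> * \<bar>a - b\<bar> ^ (m - k)"
      using w k unfolding whitney_field_def by simp
    then obtain d where d: "d > 0" "\<forall>a\<in>K. \<forall>b\<in>K. \<bar>a - b\<bar> < d \<longrightarrow>
        \<bar>F k b - (\<Sum>l\<le>m - k. F (k + l) a / fact l * (b - a) ^ l)\<bar> \<le> e * \<bar>a - b\<bar> ^ (m - k)"
      using e by blast
    have "\<bar>F k y - poly T y - (F k x - poly T x) - 0 * (y - x)\<bar> \<le> e * \<bar>y - x\<bar>"
      if y: "y \<in> K" "\<bar>y - x\<bar> < min 1 d" for y
    proof -
      have "\<bar>F k y - poly T y\<bar> \<le> e * \<bar>y - x\<bar> ^ (m - k)"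
        using d(2)[rule_format, OF x y(1)] y(2) by (simp add: T_def poly_taylor_poly abs_minus_commute)
      also have "\<dots> \<le> e * \<bar>y - x\<bar> ^ 1"
        using e k y by (intro mult_left_mono power_decreasing) auto
      finally show ?thesis by (simp add: T_def poly_taylor_poly_center)
    qed
    then show "\<exists>d>0. \<forall>y\<in>K. \<bar>y - x\<bar> < d \<longrightarrow>
        \<bar>F k y - poly T y - (F k x - poly T x) - 0 * (y - x)\<bar> \<le> e * \<bar>y - x\<bar>"
      using d(1) by (intro exI[of _ "min 1 d"]) simp
  qed
  from DERIV_add[OF r T] show ?thesis by simp
qed

lemma common_delta:
  fixes P :: "nat \<Rightarrow> real \<Rightarrow> bool"
  assumes ex: "\<And>k. k \<le> m \<Longrightarrow> \<exists>\<delta>>0. P k \<delta>" and mono: "\<And>k \<delta> \<delta>'. P k \<delta> \<Longrightarrow> \<delta>' \<le> \<delta> \<Longrightarrow> P k \<delta>'"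
  shows "\<exists>\<delta>>0. \<forall>k\<le>m. P k \<delta>"
proof -
  have "eventually (\<lambda>\<delta>. P k \<delta>) (at_right 0)" if k: "k \<in> {..m}" for k
  proof -
    from k have "k \<le> m" by simp
    from ex[OF this] obtain d where d: "d > 0" "P k d" by blast
    then show ?thesis unfolding eventually_at_right_field by (intro exI[of _ d]) (simp add: mono[OF d(2)])
  qed
  then have "eventually (\<lambda>\<delta>. \<forall>k\<in>{..m}. P k \<delta>) (at_right 0)"
    by (intro eventually_ball_finite) auto
  then obtain d where d: "d > 0" "\<And>y. y > 0 \<Longrightarrow> y < d \<Longrightarrow> \<forall>k\<in>{..m}. P k y"
    unfolding eventually_at_right_field by blast
  from d(2)[of "d / 2"] d(1) show ?thesis by (intro exI[of _ "d / 2"]) simp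
qed

lemma poly_bounded_unit:
  fixes q :: "real poly"
  shows "\<exists>B\<ge>0. \<forall>y\<in>{0..1}. \<bar>poly q y\<bar> \<le> B"
proof -
  have "compact (poly q ` {0..1})" by (intro compact_continuous_image continuous_on_poly) auto
  then obtain B where "\<forall>x\<in>poly q ` {0..1}. norm x \<le> B" using compact_imp_bounded bounded_iff by blast
  then show ?thesis by (intro exI[of _ "max B 0"]) force
qed

section \<open>Hermite interpolation and rescaling to a gap\<close>

lemma poly_higher_pderiv_root:
  fixes q :: "real poly"
  assumes "[:- c, 1:] ^ Suc n dvd q" "k \<le> n"
  shows "poly ((pderiv ^^ k) q) c = 0"
  using assms
proof (induction k arbitrary: n q)
  case 0
  then have "[:- c, 1:] dvd q" by (meson dvd_trans dvd_power zero_less_Suc)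
  then show ?case by (simp add: poly_eq_0_iff_dvd)
next
  case (Suc k)
  then obtain n' where n: "n = Suc n'" by (cases n) auto
  from Suc.prems obtain r where r: "q = [:- c, 1:] ^ Suc n * r" by (auto elim: dvdE)
  have "pderiv q = [:- c, 1:] ^ n * ([:- c, 1:] * pderiv r + smult (of_nat (Suc n)) r)"
    unfolding r pderiv_mult pderiv_power_Suc by (simp add: pderiv_pCons algebra_simps)
  then have "[:- c, 1:] ^ Suc n' dvd pderiv q" by (simp only: n dvd_triv_left)
  then have "poly ((pderiv ^^ k) (pderiv q)) c = 0" using Suc.IH[of n' "pderiv q"] Suc.prems n by simp
  then show ?case by (simp add: funpow_Suc_right del: funpow.simps)
qed

text \<open>For \<open>l \<le> m\<close> this is \<open>(y - 1)^l / l!\<close> times a step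
  polynomial: the step kills all derivatives up to order \<open>m\<close> at 0 and changes none of
  them at 1. Such polynomials adjust the jet at the right end of a gap without disturbing the left
  end.\<close>

lemma hermite_basis:
  obtains Q :: "nat \<Rightarrow> real poly" where
    "\<And>k l. k \<le> m \<Longrightarrow> poly ((pderiv ^^ k) (Q l)) 0 = 0"
    "\<And>k l. k \<le> m \<Longrightarrow> poly ((pderiv ^^ k) (Q l)) 1 = (if k = l then 1 else 0)"
proof -
  define X where "X = [:0, 1 :: real:]"
  define n where "n = Suc m"
  \<comment> \<open>a polynomial step: it vanishes to order \<open>n\<close> at 0, and so does its difference with 1 at 1\<close>
  define \<eta> where "\<eta> = 1 - (1 - X ^ n) ^ n"
  have "1 - (1 - X ^ n) dvd 1 - (1 - X ^ n) ^ n" by (metis one_diff_power_eq dvd_triv_left)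
  then have d0: "[:- 0, 1:] ^ n dvd \<eta>" by (simp add: \<eta>_def X_def)
  have "[:- 1, 1:] dvd 1 - X ^ n"
    unfolding poly_eq_0_iff_dvd[symmetric] by (simp add: X_def poly_power)
  then have d1: "[:- 1, 1:] ^ n dvd \<eta> - 1" by (simp add: \<eta>_def dvd_power_same)
  define T where "T l = taylor_poly m (\<lambda>i. if i = l then 1 else 0 :: real) 1" for l
  have "poly ((pderiv ^^ k) (T l * \<eta>)) 0 = 0" if "k \<le> m" for k l
    using poly_higher_pderiv_root[of 0 m "T l * \<eta>" k] d0 that by (simp add: n_def del: power_Suc)
  moreover have "poly ((pderiv ^^ k) (T l * \<eta>)) 1 = (if k = l then 1 else 0)" if k: "k \<le> m" for k l
  proof -
    have "T l * \<eta> = T l + T l * (\<eta> - 1)" by (simp add: algebra_simps)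
    moreover have "poly ((pderiv ^^ k) (T l * (\<eta> - 1))) 1 = 0"
      using poly_higher_pderiv_root[of 1 m "T l * (\<eta> - 1)" k] d1 k by (simp add: n_def del: power_Suc)
    ultimately show ?thesis using k
      by (simp add: higher_pderiv_add T_def poly_higher_pderiv_taylor_poly_center)
  qed
  ultimately show thesis by (rule that)
qed

text \<open>The factor makes the derivative of order \<open>m\<close> invariant under the rescaling of \<open>[0, 1]\<close> to \<open>[a, b]\<close>.\<close>

definition rescaled :: "nat \<Rightarrow> real \<Rightarrow> real \<Rightarrow> real poly \<Rightarrow> real poly" where
  "rescaled m a b Q = smult ((b - a) ^ m) (pcompose Q [:- a / (b - a), 1 / (b - a):])"

lemma poly_higher_pderiv_rescaled:
  assumes "a < b" "k \<le> m"
  shows "poly ((pderiv ^^ k) (rescaled m a b Q)) x = (b - a) ^ (m - k) * poly ((pderiv ^^ k) Q) ((x - a) / (b - a))"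
proof -
  have *: "(pderiv ^^ k) (pcompose Q [:c, d:]) = smult (d ^ k) (pcompose ((pderiv ^^ k) Q) [:c, d:])"
    for c d :: real
    by (induction k) (simp_all add: pderiv_smult pderiv_pcompose pderiv_pCons mult_ac)
  have "(b - a) ^ m * (1 / (b - a)) ^ k = (b - a) ^ (m - k)"
    using assms by (simp add: power_diff power_one_over field_simps)
  moreover have "- a / (b - a) + x * (1 / (b - a)) = (x - a) / (b - a)"
    by (simp add: diff_divide_distrib)
  ultimately show ?thesis
    by (simp add: rescaled_def higher_pderiv_smult * poly_pcompose flip: mult.assoc)
qed

text \<open>On a gap the Taylor polynomial at \<open>a\<close> is kept, and its jet error at
  \<open>b\<close> is removed by a rescaled Hermite combination. The derivative of order
  \<open>m\<close> of \<open>T a\<close> is the constant \<open>F m a\<close>, so its deviation on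
  the gap is governed by the coefficients \<open>c a b l\<close> alone.\<close>

lemma whitney_extension:
  assumes w: "whitney_field m K F" and K: "compact K" "K \<noteq> {}"
  obtains u where "smooth_seq m u" "\<And>k x. k \<le> m \<Longrightarrow> x \<in> K \<Longrightarrow> u k x = F k x"
proof -
  obtain Q :: "nat \<Rightarrow> real poly" where
    Q: "\<And>k l. k \<le> m \<Longrightarrow> poly ((pderiv ^^ k) (Q l)) 0 = 0"
    "\<And>k l. k \<le> m \<Longrightarrow> poly ((pderiv ^^ k) (Q l)) 1 = (if k = l then 1 else 0)"
    using hermite_basis[of m] by blast
  define T where "T a = taylor_poly m (\<lambda>k. F k a) a" for a
  define r where "r a b l = F l b - poly ((pderiv ^^ l) (T a)) b" for a b l
  \<comment> \<open>The Whitney condition makes \<open>r a b l\<close> small against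
    \<open>(b - a)^(m - l)\<close>. This normalization, undone by \<open>rescaled\<close>, turns
    that into smallness of \<open>c a b l\<close> itself.\<close>
  define c where "c a b l = r a b l * (b - a) ^ l / (b - a) ^ m" for a b l
  define p where "p a b = T a + rescaled m a b (\<Sum>l\<le>m. smult (c a b l) (Q l))" for a b
  have p: "poly ((pderiv ^^ k) (p a b)) x = poly ((pderiv ^^ k) (T a)) x
      + (b - a) ^ (m - k) * (\<Sum>l\<le>m. c a b l * poly ((pderiv ^^ k) (Q l)) ((x - a) / (b - a)))"
    if "a < b" "k \<le> m" for a b k x
    using that
    by (simp add: p_def higher_pderiv_add poly_higher_pderiv_rescaled higher_pderiv_sum poly_sum higher_pderiv_smult)
  have T: "poly ((pderiv ^^ k) (T a)) x = (\<Sum>l\<le>m - k. F (k + l) a / fact l * (x - a) ^ l)" if "k \<le> m" for a x k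
    using that by (simp add: T_def higher_pderiv_taylor_poly poly_taylor_poly)
  have Ta: "poly ((pderiv ^^ k) (T a)) a = F k a" if "k \<le> m" for a k
    using that by (simp add: T_def poly_higher_pderiv_taylor_poly_center)
  have "\<forall>l. \<exists>B\<ge>0. \<forall>y\<in>{0..1}. \<bar>poly ((pderiv ^^ m) (Q l)) y\<bar> \<le> B"
    using poly_bounded_unit by blast
  from choice[OF this] obtain B where
    B: "\<And>l. B l \<ge> 0" "\<And>l y. y \<in> {0..1} \<Longrightarrow> \<bar>poly ((pderiv ^^ m) (Q l)) y\<bar> \<le> B l"
    by blast
  show thesis
  proof (rule glue_gaps[OF K, of m F p])
    fix k assume "k \<le> m"
    then show "continuous_on K (F k)" using w by (simp add: whitney_field_def jet_def)
  next
    fix k x assume "k < m" "x \<in> K"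
    then show "(F k has_real_derivative F (Suc k) x) (at x within K)" by (rule whitney_field_deriv[OF w])
  next
    fix k a b assume "k \<le> m" "gap K a b"
    then show "poly ((pderiv ^^ k) (p a b)) a = F k a" by (simp add: p gap_def Q Ta)
  next
    fix k a b assume k: "k \<le> m" and g: "gap K a b"
    then have ab: "a < b" by (simp add: gap_def)
    have "(\<Sum>l\<le>m. c a b l * poly ((pderiv ^^ k) (Q l)) ((b - a) / (b - a))) = (\<Sum>l\<le>m. if l = k then c a b l else 0)"
      using ab k by (intro sum.cong) (auto simp: Q)
    also have "\<dots> = c a b k" using k by simp
    finally have "poly ((pderiv ^^ k) (p a b)) b = poly ((pderiv ^^ k) (T a)) b + (b - a) ^ (m - k) * c a b k"
      using p[OF ab k] by simp
    also have "(b - a) ^ (m - k) * c a b k = r a b k"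
      using ab k by (simp add: c_def field_simps flip: power_add)
    finally show "poly ((pderiv ^^ k) (p a b)) b = F k b" by (simp add: r_def)
  next
    fix \<epsilon> :: real assume eps: "\<epsilon> > 0"
    define S where "S = (\<Sum>l\<le>m. B l)"
    have S: "S \<ge> 0" using B by (auto simp: S_def intro: sum_nonneg)
    define e where "e = \<epsilon> / (S + 1)"
    have e: "e > 0" using eps S by (simp add: e_def)
    have "\<exists>\<delta>>0. \<forall>k\<le>m. \<forall>a\<in>K. \<forall>b\<in>K. \<bar>a - b\<bar> < \<delta> \<longrightarrow>
        \<bar>F k b - (\<Sum>l\<le>m - k. F (k + l) a / fact l * (b - a) ^ l)\<bar> \<le> e * \<bar>a - b\<bar> ^ (m - k)"
      by (rule common_delta) (use w e in \<open>auto simp: whitney_field_def\<close>)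
    then obtain d where d: "d > 0" "\<forall>k\<le>m. \<forall>a\<in>K. \<forall>b\<in>K. \<bar>a - b\<bar> < d \<longrightarrow>
        \<bar>F k b - (\<Sum>l\<le>m - k. F (k + l) a / fact l * (b - a) ^ l)\<bar> \<le> e * \<bar>a - b\<bar> ^ (m - k)"
      by blast
    have "\<bar>poly ((pderiv ^^ m) (p a b)) x - F m a\<bar> \<le> \<epsilon>"
      if g: "gap K a b" "b - a < d" and x: "x \<in> {a..b}" for a b x
    proof -
      have ab: "a < b" "a \<in> K" "b \<in> K" using g by (auto simp: gap_def)
      have c: "\<bar>c a b l\<bar> \<le> e" if l: "l \<le> m" for l
      proof -
        have "\<bar>r a b l\<bar> \<le> e * (b - a) ^ (m - l)"
          using d(2)[rule_format, OF l ab(2,3)] ab g T[OF l] by (simp add: r_def)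
        moreover have "\<bar>c a b l\<bar> = \<bar>r a b l\<bar> * (b - a) ^ l / (b - a) ^ m"
          using ab by (simp add: c_def abs_mult)
        ultimately have "\<bar>c a b l\<bar> \<le> e * (b - a) ^ (m - l) * (b - a) ^ l / (b - a) ^ m"
          using ab by (simp add: divide_right_mono mult_right_mono)
        also have "\<dots> = e" using ab l by (simp add: mult.assoc flip: power_add)
        finally show ?thesis .
      qed
      have y: "(x - a) / (b - a) \<in> {0..1}" using x ab by (auto simp: field_simps)
      have "poly ((pderiv ^^ m) (p a b)) x - F m a
          = (\<Sum>l\<le>m. c a b l * poly ((pderiv ^^ m) (Q l)) ((x - a) / (b - a)))"
        using p[OF ab(1), of m x] T[of m a x] by simp
      also have "\<bar>\<dots>\<bar> \<le> (\<Sum>l\<le>m. e * B l)"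
        by (rule order_trans[OF sum_abs])
          (use B y c e in \<open>auto simp: abs_mult intro!: sum_mono mult_mono\<close>)
      also have "\<dots> = \<epsilon> * (S / (S + 1))" by (simp add: S_def e_def sum_distrib_left sum_divide_distrib)
      also have "\<dots> \<le> \<epsilon> * 1" using eps S by (intro mult_left_mono) auto
      finally show ?thesis by simp
    qed
    then show "\<exists>\<delta>>0. \<forall>a b. gap K a b \<longrightarrow> b - a < \<delta> \<longrightarrow>
        (\<forall>x\<in>{a..b}. \<bar>poly ((pderiv ^^ m) (p a b)) x - F m a\<bar> \<le> \<epsilon>)"
      using d(1) by blast
  qed (use that in blast)
qed

section \<open>Coercivity of weighted integrals\<close>

text \<open>A nonnegative continuous function with integral zero vanishes identically, but a nonzero
  polynomial has finitely many roots.\<close>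

lemma integral_poly_pos:
  fixes r :: "real poly"
  assumes "\<And>y. y \<in> {0..1} \<Longrightarrow> 0 \<le> poly r y" "r \<noteq> 0"
  shows "integral {0..1} (poly r) > 0"
proof -
  have int: "poly r integrable_on {0..1}" by (intro integrable_continuous_real continuous_on_poly) auto
  have "integral {0..1} (poly r) \<noteq> 0"
  proof
    assume "integral {0..1} (poly r) = 0"
    then have i0: "(poly r has_integral 0) (cbox 0 1)" using int by (simp add: has_integral_integral)
    have "poly r y = 0" if "y \<in> {0..1}" for y
      by (rule has_integral_0_cbox_imp_0[OF _ _ i0])
        (use that assms(1) in \<open>auto intro: continuous_on_poly[OF continuous_on_id]\<close>)
    then have "{0..1} \<subseteq> {y. poly r y = 0}" by blast
    then have "finite {0..1 :: real}" using poly_roots_finite[OF assms(2)] finite_subset by blast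
    then show False by (simp add: infinite_Icc)
  qed
  moreover have "integral {0..1} (poly r) \<ge> 0" using assms(1) by (intro integral_nonneg int) auto
  ultimately show ?thesis by linarith
qed

definition coeff_poly :: "nat \<Rightarrow> (nat \<Rightarrow> real) \<Rightarrow> real poly" where
  "coeff_poly m v = (\<Sum>j<m. monom (v j) j)"

lemma poly_coeff_poly: "poly (coeff_poly m v) y = (\<Sum>j<m. v j * y ^ j)"
  by (simp add: coeff_poly_def poly_sum poly_monom)

text \<open>By compactness of the unit sphere of the maximum norm in the product topology.\<close>

lemma weighted_integral_coercive:
  fixes w :: "real poly"
  assumes w: "\<And>y. y \<in> {0..1} \<Longrightarrow> 0 \<le> poly w y" "w \<noteq> 0"
  shows "\<exists>c>0. \<forall>v i. i < m \<longrightarrow> c * (v i)\<^sup>2 \<le> integral {0..1} (poly (w * coeff_poly m v ^ 2))"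
proof (cases "m = 0")
  case False
  define E where "E v = integral {0..1} (poly (w * coeff_poly m v ^ 2))" for v
  define W where "W i j = integral {0..1} (poly (w * monom 1 (i + j)))" for i j
  have int: "poly r integrable_on {0..1}" for r :: "real poly"
    by (intro integrable_continuous_real continuous_on_poly) auto
  \<comment> \<open>As a quadratic form in the coordinates below \<open>m\<close>, \<open>E\<close>
    is continuous in the product topology and homogeneous of degree 2.\<close>
  have E_eq: "E v = (\<Sum>i<m. \<Sum>j<m. v i * v j * W i j)" for v
  proof -
    have "poly (w * coeff_poly m v ^ 2) = (\<lambda>y. \<Sum>i<m. \<Sum>j<m. v i * v j * poly (w * monom 1 (i + j)) y)"
      by (auto simp: fun_eq_iff poly_coeff_poly power2_eq_square sum_product sum_distrib_left
          poly_monom power_add mult_ac)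
    then have "E v = integral {0..1} (\<lambda>y. \<Sum>i<m. \<Sum>j<m. v i * v j * poly (w * monom 1 (i + j)) y)"
      by (simp only: E_def)
    also have "\<dots> = (\<Sum>i<m. integral {0..1} (\<lambda>y. \<Sum>j<m. v i * v j * poly (w * monom 1 (i + j)) y))"
      by (rule integral_sum) (auto intro!: integrable_sum integrable_on_mult_right int simp del: poly_mult)
    also have "\<dots> = (\<Sum>i<m. \<Sum>j<m. integral {0..1} (\<lambda>y. v i * v j * poly (w * monom 1 (i + j)) y))"
      by (rule sum.cong[OF refl], rule integral_sum) (auto intro!: integrable_on_mult_right int simp del: poly_mult)
    finally show ?thesis by (simp only: integral_mult_right W_def)
  qed
  \<comment> \<open>A cube, compact by Tychonoff, cut by the closed condition that some coordinate
    below \<open>m\<close> has modulus 1.\<close>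
  define S where "S = (\<Pi>\<^sub>E i\<in>UNIV. {- 1..1 :: real}) \<inter> (\<Union>i<m. {v. \<bar>v i\<bar> = 1})"
  have coord: "continuous_on A (\<lambda>v :: nat \<Rightarrow> real. v i)" for A i
    by (rule continuous_on_subset[OF continuous_on_product_coordinates]) simp
  have "compactin (product_topology (\<lambda>i. euclidean) UNIV) (\<Pi>\<^sub>E i\<in>(UNIV :: nat set). {- 1..1 :: real})"
    unfolding compactin_PiE by simp
  then have "compact (\<Pi>\<^sub>E i\<in>(UNIV :: nat set). {- 1..1 :: real})"
    by (simp add: euclidean_product_topology)
  moreover have "closed (\<Union>i<m. {v :: nat \<Rightarrow> real. \<bar>v i\<bar> = 1})"
  proof (rule closed_UN)
    show "\<forall>i\<in>{..<m}. closed {v :: nat \<Rightarrow> real. \<bar>v i\<bar> = 1}"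
      by (intro ballI closed_Collect_eq continuous_on_rabs coord continuous_on_const)
  qed simp
  ultimately have S: "compact S" unfolding S_def by (rule compact_Int_closed)
  have "(\<lambda>_. 1) \<in> S" using False by (auto simp: S_def PiE_UNIV_domain)
  then have S': "S \<noteq> {}" by blast
  have "continuous_on S E" unfolding E_eq[abs_def]
    by (intro continuous_on_sum continuous_on_mult coord continuous_on_const)
  from continuous_attains_inf[OF S S' this]
  obtain v0 where v0: "v0 \<in> S" "\<And>v. v \<in> S \<Longrightarrow> E v0 \<le> E v" by auto
  have "E v0 > 0" unfolding E_def
  proof (rule integral_poly_pos)
    from v0(1) obtain i where i: "i < m" "\<bar>v0 i\<bar> = 1" by (auto simp: S_def)
    have "coeff (coeff_poly m v0) i = v0 i" using i by (simp add: coeff_poly_def coeff_sum)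
    then have "coeff_poly m v0 \<noteq> 0" using i by auto
    then show "w * coeff_poly m v0 ^ 2 \<noteq> 0" using w(2) by simp
  qed (use w in auto)
  moreover have "E v0 * (v i)\<^sup>2 \<le> E v" if i: "i < m" for v i
  proof -
    define M where "M = Max ((\<lambda>j. \<bar>v j\<bar>) ` {..<m})"
    have M: "\<bar>v j\<bar> \<le> M" if "j < m" for j using that by (simp add: M_def)
    have "M \<in> (\<lambda>j. \<bar>v j\<bar>) ` {..<m}" using i unfolding M_def by (intro Max_in) auto
    then obtain j where j: "j < m" "\<bar>v j\<bar> = M" by auto
    show ?thesis
    proof (cases "M = 0")
      case True
      then have "v i = 0" using M[OF i] by simp
      moreover have "E v \<ge> 0" unfolding E_def using w by (intro integral_nonneg int) auto
      ultimately show ?thesis by simp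
    next
      case False
      then have Mp: "M > 0" using j by auto
      define u where "u k = (if k < m then v k / M else 0)" for k
      have "\<bar>u k\<bar> \<le> 1" for k using M[of k] Mp by (simp add: u_def)
      then have "- 1 \<le> u k" "u k \<le> 1" for k by (simp_all add: abs_le_iff minus_le_iff)
      moreover have "\<bar>u j\<bar> = 1" using j Mp by (simp add: u_def)
      ultimately have "u \<in> S" using j by (auto simp: S_def PiE_UNIV_domain)
      then have "E v0 \<le> E u" by (rule v0(2))
      moreover have "E v = M\<^sup>2 * E u"
        unfolding E_eq sum_distrib_left using Mp by (intro sum.cong refl) (simp add: u_def power2_eq_square)
      ultimately have "E v0 * M\<^sup>2 \<le> E v" by (simp add: mult.commute[of "M\<^sup>2"] mult_right_mono)
      moreover have "(v i)\<^sup>2 \<le> M\<^sup>2" using M[OF i] by (metis abs_ge_zero power2_abs power_mono)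
      ultimately show ?thesis using \<open>E v0 > 0\<close> by (smt (verit) mult_left_mono)
    qed
  qed
  ultimately show ?thesis unfolding E_def by blast
qed (use zero_less_one in blast)

lemma integral_rescale:
  fixes f :: "real \<Rightarrow> real"
  assumes ab: "a < b" and f: "continuous_on {0..1} f"
  shows "integral {a..b} (\<lambda>x. f ((x - a) / (b - a))) = (b - a) * integral {0..1} f"
proof -
  have "(f has_integral integral {0..1} f) (cbox 0 1)"
    using integrable_continuous_real[OF f] by (simp add: has_integral_integral)
  from has_integral_affinity'[OF this, of "1 / (b - a)" "- a / (b - a)"] ab
  have "((\<lambda>x. f ((1 / (b - a)) *\<^sub>R x + - a / (b - a))) has_integral
      integral {0..1} f /\<^sub>R (1 / (b - a)) ^ DIM(real))
      (cbox ((0 - - a / (b - a)) /\<^sub>R (1 / (b - a))) ((1 - - a / (b - a)) /\<^sub>R (1 / (b - a))))"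
    by simp
  moreover have "(1 / (b - a)) *\<^sub>R x + - a / (b - a) = (x - a) / (b - a)" for x
    by (simp add: diff_divide_distrib)
  moreover have "(0 - - a / (b - a)) /\<^sub>R (1 / (b - a)) = a" "(1 - - a / (b - a)) /\<^sub>R (1 / (b - a)) = b"
    using ab by (auto simp: field_simps)
  moreover have "integral {0..1} f /\<^sub>R (1 / (b - a)) ^ DIM(real) = (b - a) * integral {0..1} f" by simp
  ultimately show ?thesis by (simp only: cbox_interval integral_unique)
qed

text \<open>The bound involves only \<open>e\<close> and \<gamma>: \<alpha> and \<beta> will be
  areas of bumps against arbitrary functions and may be large. Signs are chosen so that the linear
  part never opposes \<open>e\<close>; the intermediate value theorem then finds a solution before
  the quadratic term alone would reach it.\<close>

lemma quadratic_correction: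
  fixes \<alpha> \<beta> \<gamma> e :: real
  assumes g: "\<gamma> > 0"
  shows "\<exists>\<mu> \<nu>. \<mu> * \<alpha> + \<nu> * \<beta> + \<mu> * \<nu> * \<gamma> = e \<and> \<bar>\<mu>\<bar> \<le> sqrt (\<bar>e\<bar> / \<gamma>) \<and> \<bar>\<nu>\<bar> \<le> sqrt (\<bar>e\<bar> / \<gamma>)"
proof -
  \<comment> \<open>with equal parameters \<open>\<mu> = \<nu>\<close>, whose common sign makes the linear part nonnegative\<close>
  have nonneg: "\<exists>\<mu>. \<mu> * \<alpha> + \<mu> * \<beta> + \<mu> * \<mu> * \<gamma> = e \<and> \<bar>\<mu>\<bar> \<le> sqrt (\<bar>e\<bar> / \<gamma>)"
    if e: "e \<ge> 0" for \<alpha> \<beta> e :: real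
  proof -
    define \<sigma> :: real where "\<sigma> = (if \<alpha> + \<beta> \<ge> 0 then 1 else - 1)"
    have s: "\<sigma> * \<sigma> = 1" "\<sigma> * (\<alpha> + \<beta>) \<ge> 0" "\<bar>\<sigma>\<bar> = 1" by (auto simp: \<sigma>_def)
    define T where "T = sqrt (e / \<gamma>)"
    have T: "T \<ge> 0" "T * T * \<gamma> = e" using e g by (auto simp: T_def)
    define q where "q t = t * (\<sigma> * (\<alpha> + \<beta>)) + t * t * \<gamma>" for t
    have "q 0 \<le> e" "e \<le> q T" using e T s by (auto simp: q_def)
    moreover have "continuous_on {0..T} q" unfolding q_def by (intro continuous_intros)
    ultimately obtain t where t: "0 \<le> t" "t \<le> T" "q t = e" using IVT'[of q 0 e T] T by blast
    have "\<sigma> * t * \<alpha> + \<sigma> * t * \<beta> + \<sigma> * t * (\<sigma> * t) * \<gamma> = t * (\<sigma> * (\<alpha> + \<beta>)) + (\<sigma> * \<sigma>) * (t * t * \<gamma>)"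
      by (simp add: algebra_simps)
    also have "\<dots> = e" using t s by (simp add: q_def)
    finally show ?thesis using t e s by (intro exI[of _ "\<sigma> * t"]) (simp add: abs_mult T_def)
  qed
  show ?thesis
  proof (cases "e \<ge> 0")
    case True
    then show ?thesis using nonneg[of e \<alpha> \<beta>] by blast
  next
    case False
    \<comment> \<open>For negative \<open>e\<close> the pair \<open>\<mu>\<close>,
      \<open>- \<mu>\<close> reverses the sign of the quadratic term.\<close>
    then obtain \<mu> where "\<mu> * - \<alpha> + \<mu> * \<beta> + \<mu> * \<mu> * \<gamma> = - e" "\<bar>\<mu>\<bar> \<le> sqrt (\<bar>e\<bar> / \<gamma>)"
      using nonneg[of "- e" "- \<alpha>" \<beta>] by auto
    then show ?thesis by (intro exI[of _ \<mu>] exI[of _ "- \<mu>"]) (simp add: algebra_simps)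
  qed
qed

section \<open>Area corrections by bumps\<close>

definition flat :: "nat \<Rightarrow> real poly \<Rightarrow> bool" where
  "flat m Q \<longleftrightarrow> (\<forall>k\<le>m. poly ((pderiv ^^ k) Q) 0 = 0 \<and> poly ((pderiv ^^ k) Q) 1 = 0)"

lemma flat_0 [simp]: "flat m 0"
  by (simp add: flat_def)

lemma flat_smult: "flat m Q \<Longrightarrow> flat m (smult c Q)"
  by (simp add: flat_def higher_pderiv_smult)

text \<open>The exponent \<open>m + 1\<close> gives vanishing through order \<open>m\<close> at both
  ends. Being nonnegative on the unit interval, it also serves as the weight in the coercivity
  estimate.\<close>

definition bump_weight :: "nat \<Rightarrow> real poly" where
  "bump_weight m = [:0, 1:] ^ Suc m * [:1, - 1:] ^ Suc m"

lemma flat_bump_weight_mult: "flat m (bump_weight m * Q)"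
proof -
  have "[:1, - 1 :: real:] = - [:- 1, 1:]" by simp
  then have "[:- 1, 1:] ^ Suc m dvd [:1, - 1 :: real:] ^ Suc m"
    by (metis dvd_minus_iff dvd_power_same dvd_refl)
  then have "[:- 1, 1:] ^ Suc m dvd bump_weight m * Q" "[:- 0, 1:] ^ Suc m dvd bump_weight m * Q"
    unfolding bump_weight_def by (auto intro: dvd_mult dvd_mult2 simp del: power_Suc)
  then show ?thesis using poly_higher_pderiv_root unfolding flat_def by blast
qed

lemma bump_weight_unit:
  assumes "y \<in> {0..1}"
  shows "0 \<le> poly (bump_weight m) y" "poly (bump_weight m) y \<le> 1"
  using assms by (auto simp: bump_weight_def simp del: power_Suc intro!: mult_le_one power_le_one)

lemma bump_weight_nonzero: "bump_weight m \<noteq> 0" "pderiv (bump_weight m) \<noteq> 0"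
proof -
  show "bump_weight m \<noteq> 0" by (simp add: bump_weight_def del: power_Suc)
  show "pderiv (bump_weight m) \<noteq> 0"
  proof
    assume "pderiv (bump_weight m) = 0"
    then obtain c where c: "bump_weight m = [:c:]" by (metis degree_eq_zeroE pderiv_eq_0_iff)
    moreover have "poly (bump_weight m) 0 = 0" by (simp add: bump_weight_def)
    ultimately have "bump_weight m = 0" by simp
    then show False using \<open>bump_weight m \<noteq> 0\<close> by simp
  qed
qed

lemma rescaled_smult: "rescaled m a b (smult c Q) = smult c (rescaled m a b Q)"
  by (simp add: rescaled_def pcompose_smult mult_ac)

lemma poly_rescaled: "a < b \<Longrightarrow> poly (rescaled m a b Q) x = (b - a) ^ m * poly Q ((x - a) / (b - a))"
  using poly_higher_pderiv_rescaled[of a b 0 m Q x] by simp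

lemma poly_pderiv_rescaled:
  "a < b \<Longrightarrow> m \<ge> 1 \<Longrightarrow>
    poly (pderiv (rescaled m a b Q)) x = (b - a) ^ (m - 1) * poly (pderiv Q) ((x - a) / (b - a))"
  using poly_higher_pderiv_rescaled[of a b 1 m Q x] by simp

lemma poly_rescaled_flat:
  assumes "a < b" "flat m Q" "k \<le> m"
  shows "poly ((pderiv ^^ k) (rescaled m a b Q)) a = 0" "poly ((pderiv ^^ k) (rescaled m a b Q)) b = 0"
  using assms by (simp_all add: poly_higher_pderiv_rescaled flat_def)

section \<open>Bilinearity of the area and its correction on one gap\<close>

text \<open>Half the height gained over \<open>[a, b]\<close> by a horizontal lift of the pair; only
  the entries of order 0 and 1 enter.\<close>

definition area :: "real \<Rightarrow> real \<Rightarrow> (nat \<Rightarrow> real \<Rightarrow> real) \<Rightarrow> (nat \<Rightarrow> real \<Rightarrow> real) \<Rightarrow> real" where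
  "area a b f g = integral {a..b} (\<lambda>s. f 1 s * g 0 s - g 1 s * f 0 s)"

definition poly_seq :: "real poly \<Rightarrow> nat \<Rightarrow> real \<Rightarrow> real" where
  "poly_seq P k = poly ((pderiv ^^ k) P)"

lemma poly_seq_low: "poly_seq P 0 = poly P" "poly_seq P 1 = poly (pderiv P)"
  by (simp_all add: poly_seq_def)

lemma smooth_seq_poly_seq: "smooth_seq m (poly_seq P)"
  by (auto simp: smooth_seq_def poly_seq_def poly_DERIV intro: continuous_on_poly[OF continuous_on_id])

lemma area_integrand_continuous:
  assumes "smooth_seq m f" "smooth_seq m g" "m \<ge> 1"
  shows "continuous_on A (\<lambda>s. f 1 s * g 0 s - g 1 s * f 0 s)"
  using assms by (intro continuous_intros smooth_seq_continuous[of m]) auto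

lemma area_swap: "area a b g f = - area a b f g"
  unfolding area_def integral_neg[symmetric] by (simp add: algebra_simps)

lemma area_add_right:
  assumes "smooth_seq m f" "smooth_seq m g" "smooth_seq m h" "m \<ge> 1"
  shows "area a b f (\<lambda>k x. g k x + h k x) = area a b f g + area a b f h"
proof -
  have "area a b f (\<lambda>k x. g k x + h k x)
      = integral {a..b} (\<lambda>s. (f 1 s * g 0 s - g 1 s * f 0 s) + (f 1 s * h 0 s - h 1 s * f 0 s))"
    unfolding area_def by (intro integral_cong) (simp add: algebra_simps)
  also have "\<dots> = area a b f g + area a b f h"
    unfolding area_def using assms
    by (intro integral_add integrable_continuous_real area_integrand_continuous[of m])
  finally show ?thesis .
qed

lemma area_add_left:
  assumes "smooth_seq m f" "smooth_seq m g" "smooth_seq m h" "m \<ge> 1"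
  shows "area a b (\<lambda>k x. g k x + h k x) f = area a b g f + area a b h f"
  unfolding area_swap[of a b _ f] area_add_right[OF assms] by simp

lemma area_smult_right: "area a b f (poly_seq (smult c P)) = c * area a b f (poly_seq P)"
  unfolding area_def integral_mult_right[symmetric]
  by (intro integral_cong) (simp add: poly_seq_def pderiv_smult algebra_simps)

lemma area_smult_left: "area a b (poly_seq (smult c P)) f = c * area a b (poly_seq P) f"
  unfolding area_swap[of a b _ f] area_smult_right by simp

definition unit_bound :: "nat \<Rightarrow> real \<Rightarrow> real poly \<Rightarrow> bool" where
  "unit_bound m B Q \<longleftrightarrow> (\<forall>y\<in>{0..1}. \<bar>poly ((pderiv ^^ m) Q) y\<bar> \<le> B)"

lemma unit_bound_exists: "\<exists>B\<ge>0. unit_bound m B Q"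
  using poly_bounded_unit[of "(pderiv ^^ m) Q"] by (simp add: unit_bound_def)

lemma unit_bound_mono: "unit_bound m B Q \<Longrightarrow> B \<le> C \<Longrightarrow> unit_bound m C Q"
  by (force simp: unit_bound_def)

lemma unit_bound_smult: "unit_bound m B Q \<Longrightarrow> unit_bound m (\<bar>c\<bar> * B) (smult c Q)"
  by (auto simp: unit_bound_def higher_pderiv_smult abs_mult intro: mult_left_mono)

text \<open>The quadratic term \<open>\<mu>\<nu>\<close> of a two-sided perturbation corrects any error; the cost is the
  square root of the relative error.\<close>

lemma area_correction_quadratic:
  assumes m: "m \<ge> 1"
  shows "\<exists>C\<ge>0. \<forall>f g a b e. smooth_seq m f \<longrightarrow> smooth_seq m g \<longrightarrow> a < b \<longrightarrow>
    (\<exists>A B. flat m A \<and> flat m B \<and>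
       area a b (\<lambda>k x. f k x + poly_seq (rescaled m a b A) k x) (\<lambda>k x. g k x + poly_seq (rescaled m a b B) k x)
         = area a b f g + e \<and>
       unit_bound m (C * sqrt (\<bar>e\<bar> / (b - a) ^ (2 * m))) A \<and> unit_bound m (C * sqrt (\<bar>e\<bar> / (b - a) ^ (2 * m))) B)"
proof -
  define w where "w = bump_weight m"
  \<comment> \<open>This partner makes \<gamma> positive: \<open>w' v - v' w\<close> equals
    \<open>2 w w'^2\<close> minus the derivative of \<open>w v\<close>, which integrates to
    zero.\<close>
  define v where "v = w * pderiv w"
  define \<gamma> where "\<gamma> = integral {0..1} (poly (pderiv w * v - pderiv v * w))"
  have int: "poly r integrable_on {0..1}" for r :: "real poly"
    by (intro integrable_continuous_real continuous_on_poly) auto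
  have gpos: "\<gamma> > 0"
  proof -
    have "((\<lambda>y. poly (pderiv (w * v)) y) has_integral (poly (w * v) 1 - poly (w * v) 0)) {0..1}"
      by (rule fundamental_theorem_of_calculus)
        (auto simp flip: has_real_derivative_iff_has_vector_derivative intro: poly_DERIV has_field_derivative_at_within
          simp del: poly_mult)
    moreover have "poly w 0 = 0" "poly w 1 = 0" by (auto simp: w_def bump_weight_def)
    ultimately have 0: "integral {0..1} (poly (pderiv (w * v))) = 0" by (simp add: integral_unique)
    have "pderiv w * v - pderiv v * w = 2 * (w * pderiv w ^ 2) - pderiv (w * v)"
      by (simp add: v_def pderiv_mult power2_eq_square algebra_simps)
    then have "\<gamma> = integral {0..1} (poly (2 * (w * pderiv w ^ 2) - pderiv (w * v)))"
      by (simp only: \<gamma>_def)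
    also have "\<dots> = integral {0..1} (\<lambda>y. poly (2 * (w * pderiv w ^ 2)) y - poly (pderiv (w * v)) y)"
      by (rule integral_cong) simp
    also have "\<dots> = integral {0..1} (poly (2 * (w * pderiv w ^ 2))) - integral {0..1} (poly (pderiv (w * v)))"
      by (intro integral_diff int)
    also have "\<dots> = integral {0..1} (poly (2 * (w * pderiv w ^ 2)))" by (simp only: 0 diff_0_right)
    also have "\<dots> > 0"
      by (rule integral_poly_pos) (use bump_weight_unit[of _ m] bump_weight_nonzero[of m] in \<open>auto simp: w_def\<close>)
    finally show ?thesis .
  qed
  obtain Bw where Bw: "Bw \<ge> 0" "unit_bound m Bw w" using unit_bound_exists by blast
  obtain Bv where Bv: "Bv \<ge> 0" "unit_bound m Bv v" using unit_bound_exists by blast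
  have flat: "flat m w" "flat m v"
    using flat_bump_weight_mult[of m 1] flat_bump_weight_mult[of m "pderiv w"] by (simp_all add: w_def v_def)
  define C where "C = max Bw Bv / sqrt \<gamma>"
  have C: "C \<ge> 0" using Bw gpos by (simp add: C_def)
  have "\<exists>A B. flat m A \<and> flat m B \<and>
       area a b (\<lambda>k x. f k x + poly_seq (rescaled m a b A) k x) (\<lambda>k x. g k x + poly_seq (rescaled m a b B) k x)
         = area a b f g + e \<and>
       unit_bound m (C * sqrt (\<bar>e\<bar> / (b - a) ^ (2 * m))) A \<and> unit_bound m (C * sqrt (\<bar>e\<bar> / (b - a) ^ (2 * m))) B"
    if f: "smooth_seq m f" and g: "smooth_seq m g" and ab: "a < b" for f g a b e
  proof -
    define \<phi> where "\<phi> = poly_seq (rescaled m a b w)"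
    define \<psi> where "\<psi> = poly_seq (rescaled m a b v)"
    \<comment> \<open>The powers of \<open>b - a\<close> add up as \<open>m\<close> from one bump,
      \<open>m - 1\<close> from the derivative of the other and 1 from the change of
      variable.\<close>
    have "area a b \<phi> \<psi> = (b - a) ^ (2 * m) * \<gamma>"
    proof -
      have "area a b \<phi> \<psi> = integral {a..b} (\<lambda>x. (b - a) ^ (2 * m - 1) *
          poly (pderiv w * v - pderiv v * w) ((x - a) / (b - a)))"
        unfolding area_def
      proof (rule integral_cong)
        fix x
        have "(b - a) ^ (m - 1) * (b - a) ^ m = (b - a) ^ (2 * m - 1)"
          using m by (simp add: mult_2 flip: power_add)
        then show "\<phi> 1 x * \<psi> 0 x - \<psi> 1 x * \<phi> 0 x = (b - a) ^ (2 * m - 1) *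
            poly (pderiv w * v - pderiv v * w) ((x - a) / (b - a))"
          unfolding \<phi>_def \<psi>_def poly_seq_low using ab m
          by (simp add: poly_rescaled poly_pderiv_rescaled right_diff_distrib mult.assoc mult.left_commute
              del: One_nat_def flip: \<open>_ = (b - a) ^ (2 * m - 1)\<close>)
      qed
      also have "\<dots> = (b - a) ^ (2 * m - 1) * ((b - a) * \<gamma>)"
        unfolding integral_mult_right \<gamma>_def
        by (subst integral_rescale[OF ab]) (auto intro!: continuous_intros)
      also have "(b - a) ^ (2 * m - 1) * (b - a) = (b - a) ^ (2 * m)"
        using m power_Suc2[of "b - a" "2 * m - 1"] by simp
      then have "(b - a) ^ (2 * m - 1) * ((b - a) * \<gamma>) = (b - a) ^ (2 * m) * \<gamma>" by (simp flip: mult.assoc)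
      finally show ?thesis .
    qed
    then have pos: "area a b \<phi> \<psi> > 0" using gpos ab by simp
    obtain \<mu> \<nu> where mn: "\<mu> * area a b \<phi> g + \<nu> * area a b f \<psi> + \<mu> * \<nu> * area a b \<phi> \<psi> = e"
      "\<bar>\<mu>\<bar> \<le> sqrt (\<bar>e\<bar> / area a b \<phi> \<psi>)" "\<bar>\<nu>\<bar> \<le> sqrt (\<bar>e\<bar> / area a b \<phi> \<psi>)"
      using quadratic_correction[OF pos] by blast
    define A where "A = smult \<mu> w"
    define B where "B = smult \<nu> v"
    let ?A = "poly_seq (rescaled m a b A)" and ?B = "poly_seq (rescaled m a b B)"
    have sm: "smooth_seq m ?A" "smooth_seq m ?B" by (rule smooth_seq_poly_seq)+
    have "area a b (\<lambda>k x. f k x + ?A k x) (\<lambda>k x. g k x + ?B k x)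
        = area a b f g + area a b ?A g + (area a b f ?B + area a b ?A ?B)"
      using f g sm m by (simp add: area_add_right[of m] area_add_left[of m] smooth_seq_add)
    also have "\<dots> = area a b f g + e"
      unfolding A_def B_def rescaled_smult area_smult_left area_smult_right using mn(1)
      by (simp add: \<phi>_def \<psi>_def algebra_simps)
    finally have ar: "area a b (\<lambda>k x. f k x + ?A k x) (\<lambda>k x. g k x + ?B k x) = area a b f g + e" .
    have s: "sqrt (\<bar>e\<bar> / area a b \<phi> \<psi>) = sqrt (\<bar>e\<bar> / (b - a) ^ (2 * m)) / sqrt \<gamma>"
      by (simp add: \<open>area a b \<phi> \<psi> = (b - a) ^ (2 * m) * \<gamma>\<close> flip: real_sqrt_divide)
    have bd: "unit_bound m (C * sqrt (\<bar>e\<bar> / (b - a) ^ (2 * m))) (smult c Q)"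
      if Q: "unit_bound m B0 Q" "0 \<le> B0" "B0 \<le> max Bw Bv" and c: "\<bar>c\<bar> \<le> sqrt (\<bar>e\<bar> / area a b \<phi> \<psi>)" for c B0 Q
    proof (rule unit_bound_mono[OF unit_bound_smult[OF Q(1)]])
      have "\<bar>c\<bar> * B0 \<le> sqrt (\<bar>e\<bar> / area a b \<phi> \<psi>) * max Bw Bv"
        using c Q pos by (intro mult_mono) auto
      also have "\<dots> = C * sqrt (\<bar>e\<bar> / (b - a) ^ (2 * m))" unfolding s C_def by simp
      finally show "\<bar>c\<bar> * B0 \<le> C * sqrt (\<bar>e\<bar> / (b - a) ^ (2 * m))" .
    qed
    show ?thesis
    proof (intro exI conjI)
      show "flat m A" "flat m B" unfolding A_def B_def using flat by (auto intro: flat_smult)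
      show "area a b (\<lambda>k x. f k x + ?A k x) (\<lambda>k x. g k x + ?B k x) = area a b f g + e" by (rule ar)
      show "unit_bound m (C * sqrt (\<bar>e\<bar> / (b - a) ^ (2 * m))) A"
        unfolding A_def by (rule bd[OF Bw(2,1) _ mn(2)]) simp
      show "unit_bound m (C * sqrt (\<bar>e\<bar> / (b - a) ^ (2 * m))) B"
        unfolding B_def by (rule bd[OF Bv(2,1) _ mn(3)]) simp
    qed
  qed
  then show ?thesis using C by blast
qed

text \<open>Integration by parts without boundary terms: both halves of the area contribute
  equally.\<close>

lemma area_poly_seq_vanishing_ends:
  assumes f: "smooth_seq m f" and m: "m \<ge> 1" and ab: "a \<le> b"
    and P: "poly P a = 0" "poly P b = 0"
  shows "area a b f (poly_seq P) = 2 * integral {a..b} (\<lambda>s. f 1 s * poly P s)"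
proof -
  have f1: "continuous_on {a..b} (f 1)" "continuous_on {a..b} (f 0)"
    using m by (auto intro!: smooth_seq_continuous[OF f])
  have "((\<lambda>s. f 1 s * poly P s + poly (pderiv P) s * f 0 s) has_integral
      (f 0 b * poly P b - f 0 a * poly P a)) {a..b}"
  proof (rule fundamental_theorem_of_calculus[OF ab])
    fix x
    have "(f 0 has_real_derivative f 1 x) (at x)" using smooth_seq_deriv[OF f, of 0 x] m by simp
    from DERIV_mult[OF this poly_DERIV[of P x]]
    show "((\<lambda>s. f 0 s * poly P s) has_vector_derivative f 1 x * poly P x + poly (pderiv P) x * f 0 x)
        (at x within {a..b})"
      unfolding has_real_derivative_iff_has_vector_derivative[symmetric]
      by (rule has_field_derivative_at_within)
  qed
  then have 0: "integral {a..b} (\<lambda>s. f 1 s * poly P s + poly (pderiv P) s * f 0 s) = 0"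
    by (simp add: P integral_unique)
  have "area a b f (poly_seq P) = integral {a..b} (\<lambda>s. 2 * (f 1 s * poly P s)
      - (f 1 s * poly P s + poly (pderiv P) s * f 0 s))"
    unfolding area_def poly_seq_low by (intro integral_cong) simp
  also have "\<dots> = integral {a..b} (\<lambda>s. 2 * (f 1 s * poly P s))
      - integral {a..b} (\<lambda>s. f 1 s * poly P s + poly (pderiv P) s * f 0 s)"
    by (intro integral_diff integrable_continuous_real continuous_intros f1)
  finally show ?thesis by (simp only: 0 integral_mult_right diff_0_right)
qed

lemma abs_coeff_poly_le:
  assumes "\<And>j. j < m \<Longrightarrow> \<bar>v j\<bar> \<le> M" "y \<in> {0..1}"
  shows "\<bar>poly (coeff_poly m v) y\<bar> \<le> m * M"
proof -
  have "\<bar>poly (coeff_poly m v) y\<bar> \<le> (\<Sum>j<m. \<bar>v j * y ^ j\<bar>)"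
    unfolding poly_coeff_poly by (rule sum_abs)
  also have "\<dots> \<le> (\<Sum>j<m. M)"
  proof (rule sum_mono)
    fix j assume "j \<in> {..<m}"
    then have j: "\<bar>v j\<bar> \<le> M" using assms(1) by simp
    then have "0 \<le> M" by linarith
    then have "\<bar>v j\<bar> * y ^ j \<le> M * 1" using assms(2) j by (intro mult_mono power_le_one) auto
    then show "\<bar>v j * y ^ j\<bar> \<le> M" using assms(2) by (simp add: abs_mult)
  qed
  finally show ?thesis by simp
qed

text \<open>When the rescaled polynomial \<open>p\<close> of \<open>f'\<close> is large, the one-sided perturbation of \<open>g\<close> by a
  multiple of \<open>w p\<close>, with \<open>w\<close> the bump weight, changes the area linearly, at a rate bounded below by
  coercivity.\<close>

lemma area_correction_linear:
  assumes m: "m \<ge> 1"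
  shows "\<exists>C\<ge>0. \<exists>\<kappa>>0. \<forall>f g a b e v M. smooth_seq m f \<longrightarrow> smooth_seq m g \<longrightarrow> a < b \<longrightarrow> M > 0 \<longrightarrow>
    (\<forall>j<m. \<bar>v j\<bar> \<le> M) \<longrightarrow> (\<exists>j<m. \<bar>v j\<bar> = M) \<longrightarrow>
    (\<forall>x\<in>{a..b}. \<bar>f 1 x - poly (coeff_poly m v) ((x - a) / (b - a))\<bar> \<le> \<kappa> * M) \<longrightarrow>
    (\<exists>B. flat m B \<and> area a b f (\<lambda>k x. g k x + poly_seq (rescaled m a b B) k x) = area a b f g + e \<and>
       unit_bound m (C * (\<bar>e\<bar> / ((b - a) ^ (m + 1) * M))) B)"
proof -
  define w where "w = bump_weight m"
  have w: "0 \<le> poly w y" "poly w y \<le> 1" if "y \<in> {0..1}" for y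
    using bump_weight_unit[OF that] by (simp_all add: w_def)
  have w0: "w \<noteq> 0" using bump_weight_nonzero by (simp add: w_def)
  from weighted_integral_coercive[OF w(1) w0, of m] obtain c where c: "c > 0"
    "\<And>v i. i < m \<Longrightarrow> c * (v i)\<^sup>2 \<le> integral {0..1} (poly (w * coeff_poly m v ^ 2))" by auto
  have "\<forall>j. \<exists>B\<ge>0. unit_bound m B (w * monom 1 j)" using unit_bound_exists by auto
  from choice[OF this] obtain \<beta> where \<beta>: "\<And>j. \<beta> j \<ge> 0" "\<And>j. unit_bound m (\<beta> j) (w * monom 1 j)"
    by auto
  define S where "S = (\<Sum>j<m. \<beta> j)"
  have S: "S \<ge> 0" unfolding S_def by (intro sum_nonneg \<beta>)
  \<comment> \<open>Since \<open>|w P| \<le> m M\<close> on the unit interval, replacing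
    \<open>f'\<close> by \<open>P\<close> costs at most \<open>\<kappa> m M^2 = c M^2 / 2\<close>,
    half of what coercivity provides.\<close>
  define \<kappa> where "\<kappa> = c / (2 * real m)"
  have \<kappa>: "\<kappa> > 0" "\<kappa> * m = c / 2" using c m by (auto simp: \<kappa>_def)
  have int: "poly r integrable_on {0..1}" for r :: "real poly"
    by (intro integrable_continuous_real continuous_on_poly) auto
  have "\<exists>B. flat m B \<and> area a b f (\<lambda>k x. g k x + poly_seq (rescaled m a b B) k x) = area a b f g + e \<and>
       unit_bound m (S / c * (\<bar>e\<bar> / ((b - a) ^ (m + 1) * M))) B"
    if f: "smooth_seq m f" and g: "smooth_seq m g" and ab: "a < b" and M: "M > 0"
      and v: "\<forall>j<m. \<bar>v j\<bar> \<le> M" "\<exists>j<m. \<bar>v j\<bar> = M"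
      and app: "\<forall>x\<in>{a..b}. \<bar>f 1 x - poly (coeff_poly m v) ((x - a) / (b - a))\<bar> \<le> \<kappa> * M"
    for f g a b e v M
  proof -
    define L where "L = b - a"
    have L: "L > 0" using ab by (simp add: L_def)
    define P where "P = coeff_poly m v"
    define Q where "Q = w * P"
    define R where "R = rescaled m a b Q"
    define I where "I = integral {a..b} (\<lambda>s. f 1 s * poly R s)"
    have flatQ: "flat m Q" unfolding Q_def w_def by (rule flat_bump_weight_mult)
    have PM: "\<bar>poly P y\<bar> \<le> m * M" if "y \<in> {0..1}" for y
      unfolding P_def by (rule abs_coeff_poly_le) (use v that in auto)
    have QM: "\<bar>poly Q y\<bar> \<le> m * M" if y: "y \<in> {0..1}" for y
    proof -
      have "\<bar>poly Q y\<bar> \<le> 1 * (m * M)"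
        unfolding Q_def poly_mult abs_mult using w[OF y] PM[OF y] by (intro mult_mono) auto
      then show ?thesis by simp
    qed
    have I: "I \<ge> L ^ (m + 1) * (c * M\<^sup>2 / 2)"
    proof -
      \<comment> \<open>Up to the factor \<open>L^m\<close>, \<open>r\<close> lies below
        \<open>f'\<close> times the bump pointwise, and its integral is still at least
        \<open>c M^2 / 2\<close>.\<close>
      define r where "r y = poly (w * P ^ 2) y - c / 2 * M\<^sup>2" for y
      have cr: "continuous_on {0..1} r" unfolding r_def by (intro continuous_intros)
      obtain j where j: "j < m" "\<bar>v j\<bar> = M" using v by auto
      have "c * M\<^sup>2 \<le> integral {0..1} (poly (w * P ^ 2))"
        using c(2)[OF j(1), of v] j(2) unfolding P_def by (metis power2_abs)
      moreover have "integral {0..1} r = integral {0..1} (poly (w * P ^ 2)) - integral {0..1} (\<lambda>y :: real. c / 2 * M\<^sup>2)"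
        unfolding r_def by (intro integral_diff int integrable_const_ivl)
      ultimately have "integral {0..1} r \<ge> c * M\<^sup>2 / 2" by simp
      then have "L ^ (m + 1) * (c * M\<^sup>2 / 2) \<le> L ^ m * (L * integral {0..1} r)"
        using L by (simp add: mult_left_mono)
      also have "L * integral {0..1} r = integral {a..b} (\<lambda>x. r ((x - a) / (b - a)))"
        using integral_rescale[OF ab cr] by (simp add: L_def)
      also have "L ^ m * \<dots> = integral {a..b} (\<lambda>x. L ^ m * r ((x - a) / (b - a)))" by simp
      also have "\<dots> \<le> I"
        unfolding I_def
      proof (rule integral_le)
        have "continuous_on {a..b} (\<lambda>x. r ((x - a) / (b - a)))"
          unfolding r_def using ab by (intro continuous_intros) auto
        then show "(\<lambda>x. L ^ m * r ((x - a) / (b - a))) integrable_on {a..b}"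
          by (intro integrable_continuous_real continuous_intros)
        show "(\<lambda>s. f 1 s * poly R s) integrable_on {a..b}"
          using m by (intro integrable_continuous_real continuous_intros smooth_seq_continuous[OF f])
        fix x assume x: "x \<in> {a..b}"
        define y where "y = (x - a) / (b - a)"
        have y: "y \<in> {0..1}" using x ab by (simp add: y_def)
        have "\<bar>(f 1 x - poly P y) * poly Q y\<bar> \<le> (\<kappa> * M) * (m * M)"
          unfolding abs_mult using app[rule_format, OF x] QM[OF y] \<kappa> M
          by (intro mult_mono) (auto simp: y_def P_def)
        also have "\<dots> = (\<kappa> * m) * M\<^sup>2" by (simp add: power2_eq_square)
        also have "\<dots> = c / 2 * M\<^sup>2" by (simp only: \<kappa>)
        finally have "r y \<le> poly (w * P ^ 2) y + (f 1 x - poly P y) * poly Q y"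
          unfolding r_def by linarith
        also have "\<dots> = f 1 x * poly Q y" by (simp add: Q_def power2_eq_square algebra_simps)
        finally have "L ^ m * r y \<le> L ^ m * (f 1 x * poly Q y)" using L by simp
        then show "L ^ m * r ((x - a) / (b - a)) \<le> f 1 x * poly R x"
          using ab by (simp add: R_def poly_rescaled y_def L_def mult_ac)
      qed
      finally show ?thesis .
    qed
    have low: "L ^ (m + 1) * (c * M\<^sup>2 / 2) > 0" using L c M by simp
    then have Ipos: "I > 0" using I by linarith
    \<comment> \<open>The area changes at the rate \<open>2 I\<close> along \<open>R\<close>, so
      this factor hits \<open>e\<close> exactly. \<open>I\<close> is at least of order
      \<open>L^(m+1) M^2\<close> and the derivative of \<open>Q\<close> of order \<open>m\<close>
      has size \<open>M\<close>; one power of \<open>M\<close> remains in the cost.\<close>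
    define B where "B = smult (e / (2 * I)) Q"
    have R0: "poly R a = 0" "poly R b = 0"
      using poly_rescaled_flat[OF ab flatQ, of 0] by (simp_all add: R_def)
    have "area a b f (poly_seq (rescaled m a b B)) = e / (2 * I) * area a b f (poly_seq R)"
      unfolding B_def rescaled_smult R_def by (rule area_smult_right)
    also have "\<dots> = e"
      using area_poly_seq_vanishing_ends[OF f m _ R0] ab Ipos by (simp add: I_def)
    finally have ar: "area a b f (\<lambda>k x. g k x + poly_seq (rescaled m a b B) k x) = area a b f g + e"
      by (simp add: area_add_right[OF f g smooth_seq_poly_seq m])
    have "unit_bound m (M * S) Q"
      unfolding unit_bound_def
    proof
      fix y :: real assume y: "y \<in> {0..1}"
      have "Q = (\<Sum>j<m. smult (v j) (w * monom 1 j))"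
        by (simp add: Q_def P_def coeff_poly_def sum_distrib_left smult_monom flip: mult_smult_right)
      then have "poly ((pderiv ^^ m) Q) y = (\<Sum>j<m. v j * poly ((pderiv ^^ m) (w * monom 1 j)) y)"
        by (simp add: higher_pderiv_sum poly_sum higher_pderiv_smult)
      also have "\<bar>\<dots>\<bar> \<le> (\<Sum>j<m. \<bar>v j * poly ((pderiv ^^ m) (w * monom 1 j)) y\<bar>)" by (rule sum_abs)
      also have "\<dots> \<le> (\<Sum>j<m. M * \<beta> j)"
        unfolding abs_mult using v(1) \<beta>(2) y M
        by (intro sum_mono mult_mono) (auto simp: unit_bound_def)
      also have "\<dots> = M * S" by (simp add: S_def sum_distrib_left)
      finally show "\<bar>poly ((pderiv ^^ m) Q) y\<bar> \<le> M * S" .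
    qed
    then have "unit_bound m (\<bar>e / (2 * I)\<bar> * (M * S)) B" unfolding B_def by (rule unit_bound_smult)
    moreover have "\<bar>e / (2 * I)\<bar> * (M * S) \<le> S / c * (\<bar>e\<bar> / (L ^ (m + 1) * M))"
    proof -
      have "\<bar>e / (2 * I)\<bar> \<le> \<bar>e\<bar> / (2 * (L ^ (m + 1) * (c * M\<^sup>2 / 2)))"
        unfolding abs_divide using I low by (intro frac_le) auto
      then have "\<bar>e / (2 * I)\<bar> * (M * S) \<le> \<bar>e\<bar> / (2 * (L ^ (m + 1) * (c * M\<^sup>2 / 2))) * (M * S)"
        using M S by (intro mult_right_mono) auto
      also have "\<dots> = S / c * (\<bar>e\<bar> / (L ^ (m + 1) * M))"
        using M L c by (simp add: power2_eq_square field_simps)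
      finally show ?thesis .
    qed
    ultimately have "unit_bound m (S / c * (\<bar>e\<bar> / ((b - a) ^ (m + 1) * M))) B"
      unfolding L_def by (rule unit_bound_mono)
    moreover have "flat m B" unfolding B_def by (rule flat_smult[OF flatQ])
    ultimately show ?thesis using ar by blast
  qed
  then show ?thesis using S c(1) \<kappa>(1) by (intro exI[of _ "S / c"] exI[of _ \<kappa>] conjI) auto
qed

text \<open>Coefficients of the Taylor polynomial of \<open>f'\<close> at \<open>a\<close>, in the variable \<open>(x - a) / (b - a)\<close>.\<close>

definition rescaled_coeffs :: "real \<Rightarrow> real \<Rightarrow> (nat \<Rightarrow> real \<Rightarrow> real) \<Rightarrow> nat \<Rightarrow> real" where
  "rescaled_coeffs a b f j = f (Suc j) a * (b - a) ^ j / fact j"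

lemma poly_rescaled_coeffs:
  assumes "a < b"
  shows "poly (coeff_poly m (rescaled_coeffs a b f)) ((x - a) / (b - a))
    = (\<Sum>j<m. f (Suc j) a / fact j * (x - a) ^ j)"
  unfolding poly_coeff_poly rescaled_coeffs_def using assms
  by (intro sum.cong refl) (simp add: power_divide)

lemma deriv_taylor:
  assumes "a < b" "m \<ge> 1"
  shows "deriv (taylor m f a) x = poly (coeff_poly m (rescaled_coeffs a b f)) ((x - a) / (b - a))"
proof -
  obtain n where n: "m = Suc n" using assms by (cases m) auto
  show ?thesis
    unfolding poly_rescaled_coeffs[OF assms(1)] taylor_conv_poly deriv_poly n pderiv_taylor_poly poly_taylor_poly
    by (simp add: lessThan_Suc_atMost)
qed

text \<open>On the gap each Taylor derivative is at most \<open>m M\<close>. The bound separates the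
  scales of the two corrections: \<open>L^(2m)\<close> for the quadratic one and
  \<open>L^(m+1) M\<close> for the linear one.\<close>

lemma velocity_le:
  assumes ab: "a < b" and m: "m \<ge> 1"
    and M: "\<And>j. j < m \<Longrightarrow> \<bar>rescaled_coeffs a b f j\<bar> \<le> M" "\<And>j. j < m \<Longrightarrow> \<bar>rescaled_coeffs a b g j\<bar> \<le> M"
  shows "velocity m f g a b \<le> (b - a) ^ (2 * m) + 2 * m * ((b - a) ^ (m + 1) * M)"
proof -
  let ?h = "\<lambda>s. \<bar>deriv (taylor m f a) s\<bar> + \<bar>deriv (taylor m g a) s\<bar>"
  have cont: "continuous_on {a..b} ?h"
    unfolding deriv_taylor[OF ab m] using ab by (intro continuous_intros) auto
  have "integral {a..b} ?h \<le> integral {a..b} (\<lambda>s. 2 * m * M)"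
  proof (rule integral_le)
    fix s assume "s \<in> {a..b}"
    then have s: "(s - a) / (b - a) \<in> {0..1}" using ab by simp
    show "?h s \<le> 2 * m * M"
      unfolding deriv_taylor[OF ab m]
      using abs_coeff_poly_le[of m "rescaled_coeffs a b f" M, OF M(1) s]
        abs_coeff_poly_le[of m "rescaled_coeffs a b g" M, OF M(2) s] by simp
  qed (use cont in \<open>auto intro: integrable_continuous_real\<close>)
  also have "\<dots> = (b - a) * (2 * m * M)" using ab by simp
  finally have "(b - a) ^ m * integral {a..b} ?h \<le> (b - a) ^ m * ((b - a) * (2 * m * M))"
    using ab by (intro mult_left_mono) auto
  then show ?thesis
    unfolding velocity_def using ab LBINT_eq_integral[OF _ cont] by (simp add: mult_ac)
qed

text \<open>\<open>M\<close> is the largest modulus among the rescaled coefficients of both Taylor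
  derivatives. If it is at least \<open>L^(m-1)\<close>, the function attaining it decides which of
  \<open>f\<close> and \<open>g\<close> is perturbed; otherwise both are.\<close>

lemma gap_correction:
  assumes f: "smooth_seq m f" and g: "smooth_seq m g" and m: "m \<ge> 1" and K: "K \<subseteq> {c..d}"
    and E: "\<forall>\<epsilon>>0. \<exists>\<delta>>0. \<forall>a\<in>K. \<forall>b\<in>K. 0 < b - a \<and> b - a < \<delta> \<longrightarrow>
        \<bar>E a b\<bar> \<le> \<epsilon> * velocity m f g a b"
    and \<eta>: "\<eta> > 0"
  shows "\<exists>\<delta>>0. \<forall>a\<in>K. \<forall>b\<in>K. 0 < b - a \<and> b - a < \<delta> \<longrightarrow> (\<exists>A B. flat m A \<and> flat m B \<and>
       area a b (\<lambda>k x. f k x + poly_seq (rescaled m a b A) k x) (\<lambda>k x. g k x + poly_seq (rescaled m a b B) k x)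
         = area a b f g + E a b \<and> unit_bound m \<eta> A \<and> unit_bound m \<eta> B)"
proof -
  from area_correction_quadratic[OF m] obtain C1 where C1: "C1 \<ge> 0"
    "\<And>f g a b e. smooth_seq m f \<Longrightarrow> smooth_seq m g \<Longrightarrow> a < b \<Longrightarrow>
      \<exists>A B. flat m A \<and> flat m B \<and>
       area a b (\<lambda>k x. f k x + poly_seq (rescaled m a b A) k x) (\<lambda>k x. g k x + poly_seq (rescaled m a b B) k x)
         = area a b f g + e \<and>
       unit_bound m (C1 * sqrt (\<bar>e\<bar> / (b - a) ^ (2 * m))) A \<and> unit_bound m (C1 * sqrt (\<bar>e\<bar> / (b - a) ^ (2 * m))) B"
    by (elim exE conjE) blast
  from area_correction_linear[OF m] obtain C2 \<kappa> where C2: "C2 \<ge> 0" and \<kappa>: "\<kappa> > 0"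
    and lin: "\<And>f g a b e v M. smooth_seq m f \<Longrightarrow> smooth_seq m g \<Longrightarrow> a < b \<Longrightarrow> M > 0 \<Longrightarrow>
    \<forall>j<m. \<bar>v j\<bar> \<le> M \<Longrightarrow> \<exists>j<m. \<bar>v j\<bar> = M \<Longrightarrow>
    \<forall>x\<in>{a..b}. \<bar>f 1 x - poly (coeff_poly m v) ((x - a) / (b - a))\<bar> \<le> \<kappa> * M \<Longrightarrow>
    \<exists>B. flat m B \<and> area a b f (\<lambda>k x. g k x + poly_seq (rescaled m a b B) k x) = area a b f g + e \<and>
       unit_bound m (C2 * (\<bar>e\<bar> / ((b - a) ^ (m + 1) * M))) B"
    by (elim exE conjE) blast
  \<comment> \<open>\<open>|E|\<close> is at most \<open>N \<epsilon>\<close> times the dominant one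
    of \<open>L^(2m)\<close> and \<open>L^(m+1) M\<close>. The constants bring both the quadratic
    cost \<open>C1 sqrt (N \<epsilon>)\<close> and the linear cost \<open>C2 N \<epsilon>\<close>
    below \<eta>.\<close>
  define s where "s = \<eta> / (C1 + 1)"
  define N where "N = 1 + 2 * real m"
  define \<epsilon> where "\<epsilon> = min (s\<^sup>2) (\<eta> / (C2 + 1)) / N"
  have s: "s > 0" "C1 * s \<le> \<eta>" using C1(1) \<eta> by (auto simp: s_def field_simps)
  have N: "N > 0" by (simp add: N_def)
  have eps: "\<epsilon> > 0" using s \<eta> C2 N by (simp add: \<epsilon>_def)
  have Ne: "N * \<epsilon> \<le> s\<^sup>2" "N * \<epsilon> \<le> \<eta> / (C2 + 1)" using N by (simp_all add: \<epsilon>_def)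
  have C2e: "C2 * (\<eta> / (C2 + 1)) \<le> \<eta>" using C2 \<eta> by (simp add: field_simps)
  from E[rule_format, OF eps] obtain d0 where d0: "d0 > 0"
    "\<And>a b. a \<in> K \<Longrightarrow> b \<in> K \<Longrightarrow> 0 < b - a \<Longrightarrow> b - a < d0 \<Longrightarrow> \<bar>E a b\<bar> \<le> \<epsilon> * velocity m f g a b"
    by (elim exE conjE) blast
  \<comment> \<open>The hypothesis of the linear correction asks for an error
    \<open>\<kappa> M\<close>; this bound yields it as soon as
    \<open>L^(m-1) \<le> M\<close>.\<close>
  have tay: "\<exists>\<delta>>0. \<forall>a\<in>{c..d}. \<forall>b\<in>{c..d}. 0 < b - a \<and> b - a < \<delta> \<longrightarrow> (\<forall>x\<in>{a..b}.
      \<bar>u 1 x - poly (coeff_poly m (rescaled_coeffs a b u)) ((x - a) / (b - a))\<bar> \<le> \<kappa> * (b - a) ^ (m - 1))"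
    if u: "smooth_seq m u" for u
  proof -
    obtain t where t: "t > 0" "\<And>a x k. a \<in> {c..d} \<Longrightarrow> x \<in> {c..d} \<Longrightarrow> \<bar>x - a\<bar> < t \<Longrightarrow> k \<le> m \<Longrightarrow>
           \<bar>u k x - (\<Sum>l\<le>m - k. u (k + l) a / fact l * (x - a) ^ l)\<bar> \<le> \<kappa> * \<bar>x - a\<bar> ^ (m - k)"
      by (rule smooth_seq_taylor[OF u \<kappa>, of c d]) (rule that)
    have "\<bar>u 1 x - poly (coeff_poly m (rescaled_coeffs a b u)) ((x - a) / (b - a))\<bar> \<le> \<kappa> * (b - a) ^ (m - 1)"
      if ab: "a \<in> {c..d}" "b \<in> {c..d}" "0 < b - a" "b - a < t" and x: "x \<in> {a..b}" for a b x
    proof -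
      have "{..m - 1} = {..<m}" using m by auto
      moreover have "\<bar>u 1 x - (\<Sum>l\<le>m - 1. u (1 + l) a / fact l * (x - a) ^ l)\<bar> \<le> \<kappa> * \<bar>x - a\<bar> ^ (m - 1)"
        using ab x m by (intro t(2)) auto
      ultimately have "\<bar>u 1 x - poly (coeff_poly m (rescaled_coeffs a b u)) ((x - a) / (b - a))\<bar>
          \<le> \<kappa> * \<bar>x - a\<bar> ^ (m - 1)"
        using ab by (subst poly_rescaled_coeffs) simp_all
      also have "\<dots> \<le> \<kappa> * (b - a) ^ (m - 1)"
        using x \<kappa> by (intro mult_left_mono power_mono) auto
      finally show ?thesis .
    qed
    then show ?thesis using t(1) by (intro exI[of _ t]) simp
  qed
  from tay[OF f] obtain d1 where d1: "d1 > 0" "\<And>a b x. a \<in> {c..d} \<Longrightarrow> b \<in> {c..d} \<Longrightarrow> 0 < b - a \<Longrightarrow> b - a < d1 \<Longrightarrow>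
      x \<in> {a..b} \<Longrightarrow> \<bar>f 1 x - poly (coeff_poly m (rescaled_coeffs a b f)) ((x - a) / (b - a))\<bar> \<le> \<kappa> * (b - a) ^ (m - 1)"
    by (elim exE conjE) blast
  from tay[OF g] obtain d2 where d2: "d2 > 0" "\<And>a b x. a \<in> {c..d} \<Longrightarrow> b \<in> {c..d} \<Longrightarrow> 0 < b - a \<Longrightarrow> b - a < d2 \<Longrightarrow>
      x \<in> {a..b} \<Longrightarrow> \<bar>g 1 x - poly (coeff_poly m (rescaled_coeffs a b g)) ((x - a) / (b - a))\<bar> \<le> \<kappa> * (b - a) ^ (m - 1)"
    by (elim exE conjE) blast
  have "\<exists>A B. flat m A \<and> flat m B \<and>
       area a b (\<lambda>k x. f k x + poly_seq (rescaled m a b A) k x) (\<lambda>k x. g k x + poly_seq (rescaled m a b B) k x)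
         = area a b f g + E a b \<and> unit_bound m \<eta> A \<and> unit_bound m \<eta> B"
    if aK: "a \<in> K" and bK: "b \<in> K" and L: "0 < b - a" "b - a < min d0 (min d1 d2)" for a b
  proof -
    define L where "L = b - a"
    have L0: "L > 0" and ab: "a < b" using L by (auto simp: L_def)
    have cd: "a \<in> {c..d}" "b \<in> {c..d}" using aK bK K by auto
    define V where "V = (\<lambda>j. \<bar>rescaled_coeffs a b f j\<bar>) ` {..<m} \<union> (\<lambda>j. \<bar>rescaled_coeffs a b g j\<bar>) ` {..<m}"
    define M where "M = Max V"
    have V: "finite V" "V \<noteq> {}" using m by (auto simp: V_def lessThan_empty_iff)
    have Mle: "\<bar>rescaled_coeffs a b f j\<bar> \<le> M" "\<bar>rescaled_coeffs a b g j\<bar> \<le> M" if "j < m" for j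
      using that V unfolding M_def by (auto intro!: Max_ge simp: V_def)
    have Mex: "(\<exists>j<m. \<bar>rescaled_coeffs a b f j\<bar> = M) \<or> (\<exists>j<m. \<bar>rescaled_coeffs a b g j\<bar> = M)"
      using Max_in[OF V] unfolding M_def[symmetric] by (auto simp: V_def)
    have e: "\<bar>E a b\<bar> \<le> \<epsilon> * (L ^ (2 * m) + 2 * m * (L ^ (m + 1) * M))"
    proof -
      have "\<bar>E a b\<bar> \<le> \<epsilon> * velocity m f g a b" using d0(2)[OF aK bK] L by simp
      also have "\<dots> \<le> \<epsilon> * (L ^ (2 * m) + 2 * m * (L ^ (m + 1) * M))"
        unfolding L_def using velocity_le[OF ab m Mle] eps by (intro mult_left_mono) auto
      finally show ?thesis .
    qed
    have "m + 1 + (m - 1) = 2 * m" using m by simp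
    then have LL: "L ^ (m + 1) * L ^ (m - 1) = L ^ (2 * m)" by (simp only: power_add[symmetric])
    have sf: "poly_seq (rescaled m a b 0) k x = 0" for k x by (simp add: poly_seq_def rescaled_def)
    show ?thesis
    proof (cases "L ^ (m - 1) \<le> M")
      case True
      have "0 < L ^ (m - 1)" using L0 by simp
      then have Mp: "M > 0" using True by linarith
      have "L ^ (m + 1) * L ^ (m - 1) \<le> L ^ (m + 1) * M" using True L0 by (intro mult_left_mono) auto
      then have "\<epsilon> * (L ^ (2 * m) + 2 * m * (L ^ (m + 1) * M)) \<le> \<epsilon> * (N * (L ^ (m + 1) * M))"
        using eps unfolding LL N_def by (intro mult_left_mono) (simp_all add: algebra_simps)
      then have "\<bar>E a b\<bar> \<le> N * \<epsilon> * (L ^ (m + 1) * M)" using e by (simp add: mult_ac)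
      then have "\<bar>E a b\<bar> / (L ^ (m + 1) * M) \<le> N * \<epsilon>" using L0 Mp by (simp add: pos_divide_le_eq)
      then have "C2 * (\<bar>E a b\<bar> / (L ^ (m + 1) * M)) \<le> C2 * (\<eta> / (C2 + 1))"
        using Ne(2) C2 by (intro mult_left_mono) auto
      then have bd: "C2 * (\<bar>E a b\<bar> / ((b - a) ^ (m + 1) * M)) \<le> \<eta>" using C2e by (simp add: L_def)
      have kM: "\<kappa> * (b - a) ^ (m - 1) \<le> \<kappa> * M" using True \<kappa> by (simp add: L_def)
      show ?thesis
        using Mex
      proof
        assume ex: "\<exists>j<m. \<bar>rescaled_coeffs a b f j\<bar> = M"
        have "\<forall>x\<in>{a..b}. \<bar>f 1 x - poly (coeff_poly m (rescaled_coeffs a b f)) ((x - a) / (b - a))\<bar> \<le> \<kappa> * M"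
          using d1(2)[OF cd L(1)] L(2) kM by (meson min_less_iff_conj order_trans)
        from lin[OF f g ab Mp _ ex this, of "E a b"] Mle(1) obtain B where B: "flat m B"
          "area a b f (\<lambda>k x. g k x + poly_seq (rescaled m a b B) k x) = area a b f g + E a b"
          "unit_bound m (C2 * (\<bar>E a b\<bar> / ((b - a) ^ (m + 1) * M))) B" by auto
        show ?thesis
        proof (intro exI conjI)
          show "flat m 0" "flat m B" using B by simp_all
          show "unit_bound m \<eta> B" by (rule unit_bound_mono[OF B(3) bd])
          show "unit_bound m \<eta> 0" using \<eta> by (simp add: unit_bound_def)
          show "area a b (\<lambda>k x. f k x + poly_seq (rescaled m a b 0) k x)
            (\<lambda>k x. g k x + poly_seq (rescaled m a b B) k x) = area a b f g + E a b"
            using B(2) by (simp add: sf)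
        qed
      next
        assume ex: "\<exists>j<m. \<bar>rescaled_coeffs a b g j\<bar> = M"
        have "\<forall>x\<in>{a..b}. \<bar>g 1 x - poly (coeff_poly m (rescaled_coeffs a b g)) ((x - a) / (b - a))\<bar> \<le> \<kappa> * M"
          using d2(2)[OF cd L(1)] L(2) kM by (meson min_less_iff_conj order_trans)
        \<comment> \<open>With the roles exchanged the error changes sign, as the area is
          antisymmetric.\<close>
        from lin[OF g f ab Mp _ ex this, of "- E a b"] Mle(2) obtain A where A: "flat m A"
          "area a b g (\<lambda>k x. f k x + poly_seq (rescaled m a b A) k x) = area a b g f - E a b"
          "unit_bound m (C2 * (\<bar>E a b\<bar> / ((b - a) ^ (m + 1) * M))) A" by auto
        show ?thesis
        proof (intro exI conjI)
          show "flat m A" "flat m 0" using A by simp_all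
          show "unit_bound m \<eta> A" by (rule unit_bound_mono[OF A(3) bd])
          show "unit_bound m \<eta> 0" using \<eta> by (simp add: unit_bound_def)
          show "area a b (\<lambda>k x. f k x + poly_seq (rescaled m a b A) k x)
            (\<lambda>k x. g k x + poly_seq (rescaled m a b 0) k x) = area a b f g + E a b"
            unfolding sf add_0_right area_swap[of a b _ g] A(2) by simp
        qed
      qed
    next
      case False
      have "L ^ (m + 1) * M \<le> L ^ (m + 1) * L ^ (m - 1)" using False L0 by (intro mult_left_mono) auto
      then have "2 * m * (L ^ (m + 1) * M) \<le> 2 * m * L ^ (2 * m)"
        unfolding LL by (intro mult_left_mono) auto
      then have "\<epsilon> * (L ^ (2 * m) + 2 * m * (L ^ (m + 1) * M)) \<le> \<epsilon> * (N * L ^ (2 * m))"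
        using eps unfolding N_def by (intro mult_left_mono) (simp_all add: algebra_simps)
      then have "\<bar>E a b\<bar> \<le> N * \<epsilon> * L ^ (2 * m)" using e by (simp add: mult_ac)
      then have "\<bar>E a b\<bar> / L ^ (2 * m) \<le> N * \<epsilon>" using L0 by (simp add: pos_divide_le_eq)
      then have "sqrt (\<bar>E a b\<bar> / L ^ (2 * m)) \<le> sqrt (s\<^sup>2)" using Ne(1) by (intro real_sqrt_le_mono) linarith
      then have "C1 * sqrt (\<bar>E a b\<bar> / (b - a) ^ (2 * m)) \<le> C1 * s"
        using s C1(1) by (intro mult_left_mono) (auto simp: L_def)
      then have bd: "C1 * sqrt (\<bar>E a b\<bar> / (b - a) ^ (2 * m)) \<le> \<eta>" using s(2) by linarith
      from C1(2)[OF f g ab, of "E a b"] show ?thesis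
        by (elim exE conjE) (intro exI conjI; (assumption | rule unit_bound_mono[OF _ bd]))
    qed
  qed
  moreover have "min d0 (min d1 d2) > 0" using d0 d1 d2 by simp
  ultimately show ?thesis by (intro exI[of _ "min d0 (min d1 d2)"]) simp
qed

text \<open>One choice of \<open>z\<close> must serve all \<open>\<epsilon>\<close>: take a nearly optimal one, with the length as tolerance.\<close>

lemma choose_uniformly:
  fixes R :: "'g \<Rightarrow> 'z \<Rightarrow> real \<Rightarrow> bool" and len :: "'g \<Rightarrow> real"
  assumes mono: "\<And>g z \<eta> \<eta>'. R g z \<eta> \<Longrightarrow> \<eta> \<le> \<eta>' \<Longrightarrow> R g z \<eta>'"
    and nonneg: "\<And>g z \<eta>. R g z \<eta> \<Longrightarrow> \<eta> \<ge> 0"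
    and ex: "\<And>g. g \<in> S \<Longrightarrow> \<exists>z \<eta>. R g z \<eta>"
    and len: "\<And>g. g \<in> S \<Longrightarrow> len g > 0"
    and small: "\<And>\<epsilon>. \<epsilon> > 0 \<Longrightarrow> \<exists>\<delta>>0. \<forall>g\<in>S. len g < \<delta> \<longrightarrow> (\<exists>z. R g z \<epsilon>)"
  obtains z where "\<And>g. g \<in> S \<Longrightarrow> \<exists>\<eta>. R g (z g) \<eta>"
    "\<And>\<epsilon>. \<epsilon> > 0 \<Longrightarrow> \<exists>\<delta>>0. \<forall>g\<in>S. len g < \<delta> \<longrightarrow> R g (z g) \<epsilon>"
proof -
  define I where "I g = {\<eta>. \<exists>z. R g z \<eta>}" for g
  have bdd: "bdd_below (I g)" for g using nonneg by (auto simp: I_def intro: bdd_belowI[of _ 0])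
  have "\<exists>z. R g z (Inf (I g) + len g)" if g: "g \<in> S" for g
  proof -
    have "I g \<noteq> {}" using ex[OF g] by (auto simp: I_def)
    then obtain \<eta> where "\<eta> \<in> I g" and \<eta>: "\<eta> < Inf (I g) + len g"
      using cInf_lessD[of "I g" "Inf (I g) + len g"] len[OF g] by auto
    then obtain z where "R g z \<eta>" by (auto simp: I_def)
    then have "R g z (Inf (I g) + len g)" by (rule mono) (use \<eta> in simp)
    then show ?thesis ..
  qed
  then have "\<forall>g. \<exists>z. g \<in> S \<longrightarrow> R g z (Inf (I g) + len g)" by blast
  from choice[OF this] obtain z where z: "\<And>g. g \<in> S \<Longrightarrow> R g (z g) (Inf (I g) + len g)" by blast
  show thesis
  proof (rule that)
    show "\<exists>\<eta>. R g (z g) \<eta>" if "g \<in> S" for g using z[OF that] by blast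
    fix \<epsilon> :: real assume eps: "\<epsilon> > 0"
    from small[of "\<epsilon> / 2"] eps obtain d where d: "d > 0" "\<And>g. g \<in> S \<Longrightarrow> len g < d \<Longrightarrow> \<exists>z. R g z (\<epsilon> / 2)"
      by auto
    have "R g (z g) \<epsilon>" if g: "g \<in> S" "len g < min d (\<epsilon> / 2)" for g
    proof (rule mono[OF z[OF g(1)]])
      have "\<epsilon> / 2 \<in> I g" using d(2)[of g] g by (auto simp: I_def)
      then have "Inf (I g) \<le> \<epsilon> / 2" by (rule cInf_lower[OF _ bdd])
      then show "Inf (I g) + len g \<le> \<epsilon>" using g by linarith
    qed
    then show "\<exists>\<delta>>0. \<forall>g\<in>S. len g < \<delta> \<longrightarrow> R g (z g) \<epsilon>"
      using d(1) eps by (intro exI[of _ "min d (\<epsilon> / 2)"]) simp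
  qed
qed

section \<open>The extension theorem\<close>

lemma horizontal_poly_cong:
  assumes "\<And>j. j \<le> k \<Longrightarrow> x j = x' j" "\<And>j. j \<le> k \<Longrightarrow> y j = y' j"
  shows "horizontal_poly k x y = horizontal_poly k x' y'"
  unfolding horizontal_poly_def using assms
  by (intro arg_cong2[of _ _ _ _ "(*)"] refl sum.cong) auto

lemma horizontal_poly_1: "horizontal_poly 1 x y = 2 * (x 1 * y 0 - y 1 * x 0)"
  by (simp add: horizontal_poly_def)

text \<open>Replaces iterated \<open>deriv\<close> and almost everywhere tangency by identities
  between entries of explicit sequences.\<close>

lemma extends_iff_smooth_seq:
  assumes m: "m \<ge> 1"
  shows "(\<exists>f g h. extends_to_horizontal_curve m K F G H f g h) \<longleftrightarrow>
    (\<exists>f g h. smooth_seq m f \<and> smooth_seq m g \<and> smooth_seq m h \<and>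
       (\<forall>x. h 1 x = 2 * (f 1 x * g 0 x - g 1 x * f 0 x)) \<and>
       (\<forall>x\<in>K. \<forall>k\<le>m. f k x = F k x \<and> g k x = G k x \<and> h k x = H k x))"
    (is "?L \<longleftrightarrow> ?R")
proof -
  have hor: "horizontal_curve (\<lambda>t. (f 0 t, g 0 t, h 0 t)) \<longleftrightarrow> (\<forall>x. h 1 x = 2 * (f 1 x * g 0 x - g 1 x * f 0 x))"
    if "smooth_seq m f" "smooth_seq m g" "smooth_seq m h" for f g h
  proof (rule horizontal_curve_C1_iff)
    show "(f 0 has_real_derivative f 1 t) (at t)" "(g 0 has_real_derivative g 1 t) (at t)"
      "(h 0 has_real_derivative h 1 t) (at t)" for t
      using that[THEN smooth_seq_deriv, of 0 t] m by simp_all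
    show "continuous_on UNIV (f 1)" "continuous_on UNIV (g 1)" "continuous_on UNIV (h 1)"
      using that[THEN smooth_seq_continuous, of 1] m by simp_all
  qed
  show ?thesis
  proof
    assume ?L
    then obtain f g h where e: "extends_to_horizontal_curve m K F G H f g h" by blast
    let ?f = "\<lambda>k. (deriv ^^ k) f" and ?g = "\<lambda>k. (deriv ^^ k) g" and ?h = "\<lambda>k. (deriv ^^ k) h"
    have s: "smooth_seq m ?f" "smooth_seq m ?g" "smooth_seq m ?h"
      using e by (auto simp: extends_to_horizontal_curve_def Cm_horizontal_curve_def Cm_fun_smooth_seq)
    have "horizontal_curve (\<lambda>t. (?f 0 t, ?g 0 t, ?h 0 t))"
      using e by (simp add: extends_to_horizontal_curve_def Cm_horizontal_curve_def)
    then have "\<forall>x. ?h 1 x = 2 * (?f 1 x * ?g 0 x - ?g 1 x * ?f 0 x)" using hor[OF s] by blast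
    moreover have "\<forall>x\<in>K. \<forall>k\<le>m. ?f k x = F k x \<and> ?g k x = G k x \<and> ?h k x = H k x"
      using e by (simp add: extends_to_horizontal_curve_def)
    ultimately show ?R using s by (intro exI[of _ ?f] exI[of _ ?g] exI[of _ ?h] conjI)
  next
    assume ?R
    then obtain f g h where s: "smooth_seq m f" "smooth_seq m g" "smooth_seq m h"
      and h: "\<forall>x. h 1 x = 2 * (f 1 x * g 0 x - g 1 x * f 0 x)"
      and eq: "\<forall>x\<in>K. \<forall>k\<le>m. f k x = F k x \<and> g k x = G k x \<and> h k x = H k x"
      by (elim exE conjE) (rule that)
    have "extends_to_horizontal_curve m K F G H (f 0) (g 0) (h 0)"
      unfolding extends_to_horizontal_curve_def Cm_horizontal_curve_def
      using s h eq by (auto simp: smooth_seq_Cm_fun hor smooth_seq_deriv_eq)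
    then show ?L by blast
  qed
qed

lemma whitney_field_smooth_seq:
  assumes u: "smooth_seq m u" and K: "bounded K" and jet: "jet m K F"
    and eq: "\<And>x k. x \<in> K \<Longrightarrow> k \<le> m \<Longrightarrow> u k x = F k x"
  shows "whitney_field m K F"
  unfolding whitney_field_def
proof (intro conjI allI impI jet)
  fix k and \<epsilon> :: real assume k: "k \<le> m" and e: "\<epsilon> > 0"
  obtain B where B: "\<And>x. x \<in> K \<Longrightarrow> \<bar>x\<bar> \<le> B" using K by (auto simp: bounded_iff)
  obtain d where d: "d > 0" "\<And>a x k. a \<in> {- B..B} \<Longrightarrow> x \<in> {- B..B} \<Longrightarrow> \<bar>x - a\<bar> < d \<Longrightarrow> k \<le> m \<Longrightarrow>
           \<bar>u k x - (\<Sum>l\<le>m - k. u (k + l) a / fact l * (x - a) ^ l)\<bar> \<le> \<epsilon> * \<bar>x - a\<bar> ^ (m - k)"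
    by (rule smooth_seq_taylor[OF u e, of "- B" B]) (rule that)
  have "\<bar>F k b - (\<Sum>l\<le>m - k. F (k + l) a / fact l * (b - a) ^ l)\<bar> \<le> \<epsilon> * \<bar>a - b\<bar> ^ (m - k)"
    if ab: "a \<in> K" "b \<in> K" "\<bar>a - b\<bar> < d" for a b
  proof -
    have "(\<Sum>l\<le>m - k. F (k + l) a / fact l * (b - a) ^ l) = (\<Sum>l\<le>m - k. u (k + l) a / fact l * (b - a) ^ l)"
      using ab k by (intro sum.cong) (auto simp: eq)
    moreover have "a \<in> {- B..B}" "b \<in> {- B..B}" using B[OF ab(1)] B[OF ab(2)] by auto
    ultimately show ?thesis using d(2)[of a b k] ab k eq[OF ab(2) k] by (simp add: abs_minus_commute)
  qed
  then show "\<exists>\<delta>>0. \<forall>a\<in>K. \<forall>b\<in>K. \<bar>a - b\<bar> < \<delta> \<longrightarrow>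
        \<bar>F k b - (\<Sum>l\<le>m - k. F (k + l) a / fact l * (b - a) ^ l)\<bar> \<le> \<epsilon> * \<bar>a - b\<bar> ^ (m - k)"
    using d(1) by (intro exI[of _ d]) simp
qed

lemma area_discrepancy_cong:
  assumes "\<And>k. k \<le> m \<Longrightarrow> F k a = F' k a" "\<And>k. k \<le> m \<Longrightarrow> G k a = G' k a"
    "F 0 b = F' 0 b" "G 0 b = G' 0 b" "H 0 a = H' 0 a" "H 0 b = H' 0 b"
  shows "area_discrepancy m F G H a b = area_discrepancy m F' G' H' a b"
  using assms taylor_cong[of m F a F'] taylor_cong[of m G a G'] by (simp add: area_discrepancy_def)

lemma velocity_cong:
  assumes "\<And>k. k \<le> m \<Longrightarrow> F k a = F' k a" "\<And>k. k \<le> m \<Longrightarrow> G k a = G' k a"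
  shows "velocity m F G a b = velocity m F' G' a b"
  using assms taylor_cong[of m F a F'] taylor_cong[of m G a G'] by (simp add: velocity_def)

lemma antiderivative_area:
  assumes h: "\<And>x. (h has_real_derivative 2 * (f 1 x * g 0 x - g 1 x * f 0 x)) (at x)" and ab: "a \<le> b"
  shows "h b - h a = 2 * area a b f g"
proof -
  have "((\<lambda>x. 2 * (f 1 x * g 0 x - g 1 x * f 0 x)) has_integral (h b - h a)) {a..b}"
    using h by (intro fundamental_theorem_of_calculus ab)
      (simp add: has_field_derivative_at_within flip: has_real_derivative_iff_has_vector_derivative)
  then have "integral {a..b} (\<lambda>x. 2 * (f 1 x * g 0 x - g 1 x * f 0 x)) = h b - h a" by (rule integral_unique)
  then show ?thesis unfolding area_def by (simp only: integral_mult_right)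
qed

lemma horizontal_extension_conditions:
  assumes m: "m \<ge> 1" and K: "compact K" and jets: "jet m K F" "jet m K G" "jet m K H"
    and s: "smooth_seq m f" "smooth_seq m g" "smooth_seq m h"
    and h: "\<forall>x. h 1 x = 2 * (f 1 x * g 0 x - g 1 x * f 0 x)"
    and eq: "\<forall>x\<in>K. \<forall>k\<le>m. f k x = F k x \<and> g k x = G k x \<and> h k x = H k x"
  shows "(whitney_field m K F \<and> whitney_field m K G \<and> whitney_field m K H) \<and>
     (\<forall>k\<in>{1..m}. \<forall>t\<in>K. H k t = horizontal_poly k (\<lambda>j. F j t) (\<lambda>j. G j t)) \<and>
     (\<forall>\<epsilon>>0. \<exists>\<delta>>0. \<forall>a\<in>K. \<forall>b\<in>K. 0 < b - a \<and> b - a < \<delta> \<longrightarrow>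
        \<bar>area_discrepancy m F G H a b\<bar> \<le> \<epsilon> * velocity m F G a b)"
proof (intro conjI)
  have Kb: "bounded K" using K by (rule compact_imp_bounded)
  show "whitney_field m K F" "whitney_field m K G" "whitney_field m K H"
    using eq by (auto intro: whitney_field_smooth_seq[OF s(1) Kb jets(1)]
        whitney_field_smooth_seq[OF s(2) Kb jets(2)] whitney_field_smooth_seq[OF s(3) Kb jets(3)])
  have dh: "(h 0 has_real_derivative 2 * (f 1 x * g 0 x - g 1 x * f 0 x)) (at x)" for x
    using smooth_seq_deriv[OF s(3), of 0 x] m h by simp
  show "\<forall>k\<in>{1..m}. \<forall>t\<in>K. H k t = horizontal_poly k (\<lambda>j. F j t) (\<lambda>j. G j t)"
  proof (intro ballI)
    fix k t assume k: "k \<in> {1..m}" and t: "t \<in> K"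
    \<comment> \<open>Derivative sequences are determined by their entry of order 0, so those of
      \<open>h\<close> must be the ones that the Leibniz rule produces.\<close>
    have "h k = (\<lambda>x. if k = 0 then h 0 x else horizontal_poly k (\<lambda>j. f j x) (\<lambda>j. g j x))"
      using smooth_seq_unique[OF s(3) smooth_seq_horizontal_poly[OF s(1,2) dh m], of k] k by auto
    then have "h k t = horizontal_poly k (\<lambda>j. f j t) (\<lambda>j. g j t)" using k by simp
    also have "\<dots> = horizontal_poly k (\<lambda>j. F j t) (\<lambda>j. G j t)"
      using eq t k by (intro horizontal_poly_cong) auto
    finally show "H k t = horizontal_poly k (\<lambda>j. F j t) (\<lambda>j. G j t)" using eq t k by simp
  qed
  obtain B where B: "\<And>x. x \<in> K \<Longrightarrow> \<bar>x\<bar> \<le> B" using Kb by (auto simp: bounded_iff)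
  show "\<forall>\<epsilon>>0. \<exists>\<delta>>0. \<forall>a\<in>K. \<forall>b\<in>K. 0 < b - a \<and> b - a < \<delta> \<longrightarrow>
        \<bar>area_discrepancy m F G H a b\<bar> \<le> \<epsilon> * velocity m F G a b"
  proof (intro allI impI)
    fix \<epsilon> :: real assume e: "\<epsilon> > 0"
    from area_estimate[OF s(1,2) m e, of "- B" B] obtain d where d: "d > 0"
      "\<And>a b h. a \<in> {- B..B} \<Longrightarrow> b \<in> {- B..B} \<Longrightarrow> 0 < b - a \<Longrightarrow> b - a < d \<Longrightarrow>
        h 0 b - h 0 a = 2 * area a b f g \<Longrightarrow> \<bar>area_discrepancy m f g h a b\<bar> \<le> \<epsilon> * velocity m f g a b"
      unfolding area_def[symmetric] by (elim exE conjE) blast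
    have "\<bar>area_discrepancy m F G H a b\<bar> \<le> \<epsilon> * velocity m F G a b"
      if ab: "a \<in> K" "b \<in> K" "0 < b - a" "b - a < d" for a b
    proof -
      have "area_discrepancy m F G H a b = area_discrepancy m f g h a b"
        using eq ab by (intro area_discrepancy_cong) auto
      moreover have "velocity m F G a b = velocity m f g a b"
        using eq ab by (intro velocity_cong) auto
      moreover have "a \<in> {- B..B}" "b \<in> {- B..B}" using B[OF ab(1)] B[OF ab(2)] by auto
      ultimately show ?thesis using d(2)[of a b h] ab antiderivative_area[of "h 0" f g a b, OF dh] by simp
    qed
    then show "\<exists>\<delta>>0. \<forall>a\<in>K. \<forall>b\<in>K. 0 < b - a \<and> b - a < \<delta> \<longrightarrow>
        \<bar>area_discrepancy m F G H a b\<bar> \<le> \<epsilon> * velocity m F G a b"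
      using d(1) by blast
  qed
qed

text \<open>A function on \<open>K\<close> whose derivative along \<open>K\<close> vanishes need not be constant, since \<open>K\<close> may be
  totally disconnected. Equal values at the two ends of each gap allow extending it by constants.\<close>

lemma constant_on_compact:
  fixes S :: "real \<Rightarrow> real"
  assumes K: "compact K" and der: "\<And>x. x \<in> K \<Longrightarrow> (S has_real_derivative 0) (at x within K)"
    and gaps: "\<And>a b. gap K a b \<Longrightarrow> S a = S b" and xy: "x \<in> K" "y \<in> K"
  shows "S x = S y"
proof -
  have ne: "K \<noteq> {}" using xy by blast
  \<comment> \<open>The jet \<open>(S, 0)\<close> of order 1: with constants on the gaps it glues to
    a C^1 function whose derivative vanishes on the whole interval from \<open>Inf K\<close> to
    \<open>Sup K\<close>.\<close>
  define J where "J k = (if k = 0 then S else (\<lambda>_. 0))" for k :: nat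
  obtain u where u: "smooth_seq 1 u" "\<And>k x. k \<le> 1 \<Longrightarrow> x \<in> K \<Longrightarrow> u k x = J k x"
    "\<And>k a b x. k \<le> 1 \<Longrightarrow> gap K a b \<Longrightarrow> x \<in> {a..b} \<Longrightarrow> u k x = poly ((pderiv ^^ k) [:S a:]) x"
  proof (rule glue_gaps[OF K ne, of 1 J "\<lambda>a b. [:S a:]"])
    show "continuous_on K (J k)" for k
      using DERIV_continuous_on[OF der] by (simp add: J_def)
    show "(J k has_real_derivative J (Suc k) x) (at x within K)" if "k < 1" "x \<in> K" for k x
      using der that by (simp add: J_def)
    have eval: "poly ((pderiv ^^ k) [:c:]) z = (if k = 0 then c else 0)" if "k \<le> 1" for k and c z :: real
      using that by (cases k) auto
    show "poly ((pderiv ^^ k) [:S a:]) a = J k a" if "k \<le> 1" for k a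
      unfolding eval[OF that] by (simp add: J_def)
    show "poly ((pderiv ^^ k) [:S a:]) b = J k b" if "k \<le> 1" "gap K a b" for k a b
      unfolding eval[OF that(1)] using gaps[OF that(2)] by (simp add: J_def)
    show "\<exists>\<delta>>0. \<forall>a b. gap K a b \<longrightarrow> b - a < \<delta> \<longrightarrow> (\<forall>x\<in>{a..b}. \<bar>poly ((pderiv ^^ 1) [:S a:]) x - J 1 a\<bar> \<le> \<epsilon>)"
      if "\<epsilon> > 0" for \<epsilon>
      using that by (intro exI[of _ 1]) (simp add: J_def)
  qed (rule that)
  have "bdd_above K" "bdd_below K"
    using compact_imp_bounded[OF K] by (auto intro: bounded_imp_bdd_above bounded_imp_bdd_below)
  then have in_hull: "z \<in> {Inf K..Sup K}" if "z \<in> K" for z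
    using that by (simp add: cInf_lower cSup_upper)
  have "u 1 z = 0" if z: "z \<in> {Inf K..Sup K}" for z
  proof (cases "z \<in> K")
    case False
    from K ne False show ?thesis
    proof (cases rule: gap_cases)
      case (3 a b)
      then show ?thesis using u(3)[of 1 a b z] by simp
    qed (use z in auto)
  qed (use u(2)[of 1 z] in \<open>simp add: J_def\<close>)
  moreover have "(u 0 has_real_derivative u 1 z) (at z within {Inf K..Sup K})" for z
    using smooth_seq_deriv[OF u(1), of 0 z] by (simp add: has_field_derivative_at_within)
  ultimately have "\<And>z. z \<in> {Inf K..Sup K} \<Longrightarrow> (u 0 has_real_derivative 0) (at z within {Inf K..Sup K})"
    by metis
  then obtain c where "\<And>z. z \<in> {Inf K..Sup K} \<Longrightarrow> u 0 z = c"
    using has_field_derivative_zero_constant[of "{Inf K..Sup K}" "u 0"] by auto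
  then have "u 0 x = u 0 y" using in_hull xy by metis
  then show ?thesis using u(2)[of 0 x] u(2)[of 0 y] xy by (simp add: J_def)
qed

lemma antiderivative_exists:
  fixes q :: "real \<Rightarrow> real"
  assumes "continuous_on UNIV q"
  obtains h where "\<And>x. (h has_real_derivative q x) (at x)" "h x0 = c"
proof -
  have "\<exists>h. \<forall>x. - \<infinity> < ereal x \<longrightarrow> ereal x < \<infinity> \<longrightarrow> (h has_vector_derivative q x) (at x)"
    using assms by (intro einterval_antiderivative) (auto simp: continuous_on_eq_continuous_at)
  then obtain h where "\<And>x. (h has_real_derivative q x) (at x)"
    by (auto simp: has_real_derivative_iff_has_vector_derivative)
  then have "((\<lambda>x. h x + (c - h x0)) has_real_derivative q x) (at x)" for x
    by (auto intro!: derivative_eq_intros)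
  then show thesis by (rule that) simp
qed

lemma area_discrepancy_shift:
  "area_discrepancy m F G H a b
    = area_discrepancy m F G H' a b + ((H 0 b - H 0 a) - (H' 0 b - H' 0 a))"
  by (simp add: area_discrepancy_def)

text \<open>The bumps form a C^m function of their own with zero jet on \<open>K\<close>, so adding
  it to an extension preserves both smoothness and the jet.\<close>

lemma glue_bumps:
  assumes K: "compact K" "K \<noteq> {}"
    and flat: "\<And>a b. gap K a b \<Longrightarrow> flat m (A a b)"
    and small: "\<And>\<epsilon>. \<epsilon> > 0 \<Longrightarrow> \<exists>\<delta>>0. \<forall>a b. gap K a b \<longrightarrow> b - a < \<delta> \<longrightarrow> unit_bound m \<epsilon> (A a b)"
  obtains u where "smooth_seq m u" "\<And>k x. k \<le> m \<Longrightarrow> x \<in> K \<Longrightarrow> u k x = 0"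
    "\<And>k a b x. k \<le> m \<Longrightarrow> gap K a b \<Longrightarrow> x \<in> {a..b} \<Longrightarrow> u k x = poly_seq (rescaled m a b (A a b)) k x"
proof (rule glue_gaps[OF K, of m "\<lambda>_ _. 0" "\<lambda>a b. rescaled m a b (A a b)"])
  fix k a b assume "k \<le> m" "gap K a b"
  then show "poly ((pderiv ^^ k) (rescaled m a b (A a b))) a = 0"
    "poly ((pderiv ^^ k) (rescaled m a b (A a b))) b = 0"
    using poly_rescaled_flat[OF _ flat] by (auto simp: gap_def)
next
  fix \<epsilon> :: real assume "\<epsilon> > 0"
  from small[OF this] obtain d where d: "d > 0" "\<And>a b. gap K a b \<Longrightarrow> b - a < d \<Longrightarrow> unit_bound m \<epsilon> (A a b)"
    by auto
  have "\<bar>poly ((pderiv ^^ m) (rescaled m a b (A a b))) x - 0\<bar> \<le> \<epsilon>"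
    if g: "gap K a b" "b - a < d" "x \<in> {a..b}" for a b x
  proof -
    have ab: "a < b" using g by (simp add: gap_def)
    then have "(x - a) / (b - a) \<in> {0..1}" using g by simp
    then show ?thesis
      using d(2)[OF g(1,2)] by (simp add: unit_bound_def poly_higher_pderiv_rescaled[OF ab])
  qed
  then show "\<exists>\<delta>>0. \<forall>a b. gap K a b \<longrightarrow> b - a < \<delta> \<longrightarrow>
      (\<forall>x\<in>{a..b}. \<bar>poly ((pderiv ^^ m) (rescaled m a b (A a b))) x - 0\<bar> \<le> \<epsilon>)"
    using d(1) by blast
next
  fix u assume "smooth_seq m u" "\<And>k x. k \<le> m \<Longrightarrow> x \<in> K \<Longrightarrow> u k x = 0"
    "\<And>k a b x. k \<le> m \<Longrightarrow> gap K a b \<Longrightarrow> x \<in> {a..b} \<Longrightarrow>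
       u k x = poly ((pderiv ^^ k) (rescaled m a b (A a b))) x"
  then show thesis by (intro that[of u]) (simp_all add: poly_seq_def)
qed auto

lemma horizontal_extension_exists:
  assumes m: "m \<ge> 1" and K: "compact K" "K \<noteq> {}"
    and w: "whitney_field m K F" "whitney_field m K G" "whitney_field m K H"
    and hp: "\<forall>k\<in>{1..m}. \<forall>t\<in>K. H k t = horizontal_poly k (\<lambda>j. F j t) (\<lambda>j. G j t)"
    and disc: "\<forall>\<epsilon>>0. \<exists>\<delta>>0. \<forall>a\<in>K. \<forall>b\<in>K. 0 < b - a \<and> b - a < \<delta> \<longrightarrow>
        \<bar>area_discrepancy m F G H a b\<bar> \<le> \<epsilon> * velocity m F G a b"
  shows "\<exists>f g h. smooth_seq m f \<and> smooth_seq m g \<and> smooth_seq m h \<and>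
       (\<forall>x. h 1 x = 2 * (f 1 x * g 0 x - g 1 x * f 0 x)) \<and>
       (\<forall>x\<in>K. \<forall>k\<le>m. f k x = F k x \<and> g k x = G k x \<and> h k x = H k x)"
proof -
  obtain f0 where f0: "smooth_seq m f0" "\<And>k x. k \<le> m \<Longrightarrow> x \<in> K \<Longrightarrow> f0 k x = F k x"
    by (rule whitney_extension[OF w(1) K]) (rule that)
  obtain g0 where g0: "smooth_seq m g0" "\<And>k x. k \<le> m \<Longrightarrow> x \<in> K \<Longrightarrow> g0 k x = G k x"
    by (rule whitney_extension[OF w(2) K]) (rule that)
  obtain B where B: "\<And>x. x \<in> K \<Longrightarrow> \<bar>x\<bar> \<le> B" using compact_imp_bounded[OF K(1)] by (auto simp: bounded_iff)
  have KB: "K \<subseteq> {- B..B}" using B by (force simp: abs_le_iff)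
  define E where "E a b = (H 0 b - H 0 a) / 2 - area a b f0 g0" for a b
  have E: "\<forall>\<epsilon>>0. \<exists>\<delta>>0. \<forall>a\<in>K. \<forall>b\<in>K. 0 < b - a \<and> b - a < \<delta> \<longrightarrow>
      \<bar>E a b\<bar> \<le> \<epsilon> * velocity m f0 g0 a b"
  proof (intro allI impI)
    fix \<epsilon> :: real assume e: "\<epsilon> > 0"
    from disc[rule_format, OF e] obtain d1 where d1: "d1 > 0"
      "\<And>a b. a \<in> K \<Longrightarrow> b \<in> K \<Longrightarrow> 0 < b - a \<Longrightarrow> b - a < d1 \<Longrightarrow>
        \<bar>area_discrepancy m F G H a b\<bar> \<le> \<epsilon> * velocity m F G a b"
      by (elim exE conjE) blast
    from area_estimate[OF f0(1) g0(1) m e, of "- B" B] obtain d2 where d2: "d2 > 0"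
      "\<And>a b h. a \<in> {- B..B} \<Longrightarrow> b \<in> {- B..B} \<Longrightarrow> 0 < b - a \<Longrightarrow> b - a < d2 \<Longrightarrow>
        h 0 b - h 0 a = 2 * area a b f0 g0 \<Longrightarrow> \<bar>area_discrepancy m f0 g0 h a b\<bar> \<le> \<epsilon> * velocity m f0 g0 a b"
      unfolding area_def[symmetric] by (elim exE conjE) blast
    have "\<bar>E a b\<bar> \<le> \<epsilon> * velocity m f0 g0 a b"
      if ab: "a \<in> K" "b \<in> K" "0 < b - a" "b - a < min d1 d2" for a b
    proof -
      \<comment> \<open>An artificial third component with exactly the increment that
        \<open>area_estimate\<close> requires. The discrepancies for \<open>H\<close> and for
        \<open>h\<close> then differ by \<open>2 * E a b\<close>, and both are small.\<close>
      define h where "h k x = (if x = b then 2 * area a b f0 g0 else 0)" for k :: nat and x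
      have h: "h 0 b - h 0 a = 2 * area a b f0 g0" using ab by (simp add: h_def)
      have "area_discrepancy m F G H a b = area_discrepancy m f0 g0 H a b"
        by (intro area_discrepancy_cong) (use f0 g0 ab in auto)
      also have "\<dots> = area_discrepancy m f0 g0 h a b + 2 * E a b"
        using area_discrepancy_shift[of m f0 g0 H a b h] h by (simp add: E_def)
      finally have eq: "2 * E a b = area_discrepancy m F G H a b - area_discrepancy m f0 g0 h a b" by simp
      have "velocity m F G a b = velocity m f0 g0 a b"
        by (intro velocity_cong) (use f0 g0 ab in auto)
      then have "\<bar>area_discrepancy m F G H a b\<bar> \<le> \<epsilon> * velocity m f0 g0 a b"
        using d1(2)[of a b] ab by simp
      moreover have "\<bar>area_discrepancy m f0 g0 h a b\<bar> \<le> \<epsilon> * velocity m f0 g0 a b"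
        using d2(2)[OF subsetD[OF KB ab(1)] subsetD[OF KB ab(2)] ab(3), of h] h ab(4) by simp
      ultimately show ?thesis using eq by linarith
    qed
    then show "\<exists>\<delta>>0. \<forall>a\<in>K. \<forall>b\<in>K. 0 < b - a \<and> b - a < \<delta> \<longrightarrow>
        \<bar>E a b\<bar> \<le> \<epsilon> * velocity m f0 g0 a b"
      using d1(1) d2(1) by (intro exI[of _ "min d1 d2"]) simp
  qed
  \<comment> \<open>Admissible pairs of bumps on a gap, with \<eta> as their cost: the area is
    always corrected exactly, and only the size bound depends on \<eta>.\<close>
  define R where "R g z \<eta> \<longleftrightarrow> (case g of (a, b) \<Rightarrow> case z of (P, Q) \<Rightarrow> flat m P \<and> flat m Q \<and>
       area a b (\<lambda>k x. f0 k x + poly_seq (rescaled m a b P) k x) (\<lambda>k x. g0 k x + poly_seq (rescaled m a b Q) k x)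
         = area a b f0 g0 + E a b \<and> unit_bound m \<eta> P \<and> unit_bound m \<eta> Q)" for g z \<eta>
  obtain z where z: "\<And>g. g \<in> {(a, b). gap K a b} \<Longrightarrow> \<exists>\<eta>. R g (z g) \<eta>"
    "\<And>\<epsilon>. \<epsilon> > 0 \<Longrightarrow> \<exists>\<delta>>0. \<forall>g\<in>{(a, b). gap K a b}. snd g - fst g < \<delta> \<longrightarrow> R g (z g) \<epsilon>"
  proof (rule choose_uniformly[of R "{(a, b). gap K a b}" "\<lambda>g. snd g - fst g"])
    show "R g z \<eta>'" if "R g z \<eta>" "\<eta> \<le> \<eta>'" for g z \<eta> \<eta>'
      using that unit_bound_mono by (auto simp: R_def split: prod.splits)
    show "\<eta> \<ge> 0" if R: "R g z \<eta>" for g z \<eta>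
    proof -
      obtain P where "unit_bound m \<eta> P" using R by (auto simp: R_def split: prod.splits)
      then have "\<bar>poly ((pderiv ^^ m) P) 0\<bar> \<le> \<eta>" by (simp add: unit_bound_def)
      then show ?thesis by linarith
    qed
    show "snd g - fst g > 0" if "g \<in> {(a, b). gap K a b}" for g using that by (auto simp: gap_def)
    \<comment> \<open>Long gaps must be corrected exactly too; the quadratic correction is available
      on every gap, at some cost.\<close>
    show "\<exists>z \<eta>. R g z \<eta>" if gS: "g \<in> {(a, b). gap K a b}" for g
    proof -
      obtain a b where g: "g = (a, b)" "a < b" using gS by (auto simp: gap_def)
      from area_correction_quadratic[OF m] obtain C where
        "\<exists>P Q. flat m P \<and> flat m Q \<and>
         area a b (\<lambda>k x. f0 k x + poly_seq (rescaled m a b P) k x) (\<lambda>k x. g0 k x + poly_seq (rescaled m a b Q) k x)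
           = area a b f0 g0 + E a b \<and>
         unit_bound m (C * sqrt (\<bar>E a b\<bar> / (b - a) ^ (2 * m))) P \<and> unit_bound m (C * sqrt (\<bar>E a b\<bar> / (b - a) ^ (2 * m))) Q"
        using f0(1) g0(1) g(2) by (elim exE conjE) blast
      then obtain P Q where "R g (P, Q) (C * sqrt (\<bar>E a b\<bar> / (b - a) ^ (2 * m)))"
        unfolding R_def g by auto
      then show ?thesis by blast
    qed
    show "\<exists>\<delta>>0. \<forall>g\<in>{(a, b). gap K a b}. snd g - fst g < \<delta> \<longrightarrow> (\<exists>z. R g z \<eta>)" if \<eta>: "\<eta> > 0" for \<eta>
    proof -
      from gap_correction[OF f0(1) g0(1) m KB E \<eta>] obtain d where d: "d > 0"
        "\<And>a b. a \<in> K \<Longrightarrow> b \<in> K \<Longrightarrow> 0 < b - a \<Longrightarrow> b - a < d \<Longrightarrow> (\<exists>P Q. flat m P \<and> flat m Q \<and>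
         area a b (\<lambda>k x. f0 k x + poly_seq (rescaled m a b P) k x) (\<lambda>k x. g0 k x + poly_seq (rescaled m a b Q) k x)
           = area a b f0 g0 + E a b \<and> unit_bound m \<eta> P \<and> unit_bound m \<eta> Q)"
        by (elim exE conjE) blast
      have "\<exists>z. R (a, b) z \<eta>" if "gap K a b" "b - a < d" for a b
      proof -
        have "\<exists>P Q. R (a, b) (P, Q) \<eta>"
          unfolding R_def prod.case using d(2)[of a b] that by (simp add: gap_def)
        then show ?thesis by blast
      qed
      then show ?thesis using d(1) by (intro exI[of _ d]) auto
    qed
  qed (rule that)
  define P where "P a b = fst (z (a, b))" for a b
  define Q where "Q a b = snd (z (a, b))" for a b
  have R: "R (a, b) (z (a, b)) \<eta> \<longleftrightarrow> flat m (P a b) \<and> flat m (Q a b) \<and>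
       area a b (\<lambda>k x. f0 k x + poly_seq (rescaled m a b (P a b)) k x)
           (\<lambda>k x. g0 k x + poly_seq (rescaled m a b (Q a b)) k x)
         = area a b f0 g0 + E a b \<and> unit_bound m \<eta> (P a b) \<and> unit_bound m \<eta> (Q a b)" for a b \<eta>
    by (simp add: R_def P_def Q_def split: prod.split)
  have PQ: "flat m (P a b)" "flat m (Q a b)"
    "area a b (\<lambda>k x. f0 k x + poly_seq (rescaled m a b (P a b)) k x)
           (\<lambda>k x. g0 k x + poly_seq (rescaled m a b (Q a b)) k x) = area a b f0 g0 + E a b"
    if "gap K a b" for a b
    using z(1)[of "(a, b)"] that R[of a b] by auto
  have small: "\<exists>\<delta>>0. \<forall>a b. gap K a b \<longrightarrow> b - a < \<delta> \<longrightarrow> unit_bound m \<epsilon> (P a b) \<and> unit_bound m \<epsilon> (Q a b)"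
    if "\<epsilon> > 0" for \<epsilon>
  proof -
    from z(2)[OF that] obtain d where d: "d > 0"
      "\<And>a b. gap K a b \<Longrightarrow> b - a < d \<Longrightarrow> R (a, b) (z (a, b)) \<epsilon>" by auto
    then show ?thesis using R by (intro exI[of _ d]) simp
  qed
  obtain \<phi> where \<phi>: "smooth_seq m \<phi>" "\<And>k x. k \<le> m \<Longrightarrow> x \<in> K \<Longrightarrow> \<phi> k x = 0"
    "\<And>k a b x. k \<le> m \<Longrightarrow> gap K a b \<Longrightarrow> x \<in> {a..b} \<Longrightarrow> \<phi> k x = poly_seq (rescaled m a b (P a b)) k x"
  proof (rule glue_bumps[OF K, of m P])
    show "\<exists>\<delta>>0. \<forall>a b. gap K a b \<longrightarrow> b - a < \<delta> \<longrightarrow> unit_bound m \<epsilon> (P a b)" if "\<epsilon> > 0" for \<epsilon>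
      using small[OF that] by blast
  qed (use PQ in auto)
  obtain \<psi> where \<psi>: "smooth_seq m \<psi>" "\<And>k x. k \<le> m \<Longrightarrow> x \<in> K \<Longrightarrow> \<psi> k x = 0"
    "\<And>k a b x. k \<le> m \<Longrightarrow> gap K a b \<Longrightarrow> x \<in> {a..b} \<Longrightarrow> \<psi> k x = poly_seq (rescaled m a b (Q a b)) k x"
  proof (rule glue_bumps[OF K, of m Q])
    show "\<exists>\<delta>>0. \<forall>a b. gap K a b \<longrightarrow> b - a < \<delta> \<longrightarrow> unit_bound m \<epsilon> (Q a b)" if "\<epsilon> > 0" for \<epsilon>
      using small[OF that] by blast
  qed (use PQ in auto)
  define f where "f k x = f0 k x + \<phi> k x" for k x
  define g where "g k x = g0 k x + \<psi> k x" for k x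
  have f: "smooth_seq m f" "\<And>k x. k \<le> m \<Longrightarrow> x \<in> K \<Longrightarrow> f k x = F k x"
    using smooth_seq_add[OF f0(1) \<phi>(1)] f0(2) \<phi>(2) by (simp_all add: f_def[abs_def])
  have g: "smooth_seq m g" "\<And>k x. k \<le> m \<Longrightarrow> x \<in> K \<Longrightarrow> g k x = G k x"
    using smooth_seq_add[OF g0(1) \<psi>(1)] g0(2) \<psi>(2) by (simp_all add: g_def[abs_def])
  have gap_area: "2 * area a b f g = H 0 b - H 0 a" if gap: "gap K a b" for a b
  proof -
    have "area a b f g = area a b (\<lambda>k x. f0 k x + poly_seq (rescaled m a b (P a b)) k x)
           (\<lambda>k x. g0 k x + poly_seq (rescaled m a b (Q a b)) k x)"
      unfolding area_def f_def g_def using m \<phi>(3)[OF _ gap] \<psi>(3)[OF _ gap] by (intro integral_cong) simp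
    then show ?thesis using PQ(3)[OF gap] by (simp add: E_def)
  qed
  from K(2) obtain x0 where x0: "x0 \<in> K" by blast
  obtain h where h: "\<And>x. (h has_real_derivative 2 * (f 1 x * g 0 x - g 1 x * f 0 x)) (at x)" "h x0 = H 0 x0"
  proof (rule antiderivative_exists)
    show "continuous_on UNIV (\<lambda>x. 2 * (f 1 x * g 0 x - g 1 x * f 0 x))"
      by (intro continuous_on_mult continuous_on_const area_integrand_continuous[OF f(1) g(1) m])
  qed (rule that)
  have hH: "h x = H 0 x" if x: "x \<in> K" for x
  proof -
    \<comment> \<open>Condition (2) with \<open>k = 1\<close> equates the derivatives of
      \<open>H\<close> and \<open>h\<close> along \<open>K\<close>, and the corrected areas equate
      their increments over gaps.\<close>
    have "H 0 x - h x = H 0 x0 - h x0"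
    proof (rule constant_on_compact[OF K(1) _ _ x x0, where S = "\<lambda>x. H 0 x - h x"])
      fix y assume y: "y \<in> K"
      have "H 1 y = 2 * (f 1 y * g 0 y - g 1 y * f 0 y)"
        using hp m y f(2)[of _ y] g(2)[of _ y] by (simp add: horizontal_poly_1 del: One_nat_def)
      moreover have "(H 0 has_real_derivative H 1 y) (at y within K)"
        using whitney_field_deriv[OF w(3) _ y, of 0] m by simp
      ultimately show "((\<lambda>x. H 0 x - h x) has_real_derivative 0) (at y within K)"
        using DERIV_diff[of "H 0" _ y K h, OF _ has_field_derivative_at_within[OF h(1)]] by fastforce
    next
      fix a b assume gap: "gap K a b"
      then have "h b - h a = 2 * area a b f g" using antiderivative_area[OF h(1), of a b] by (simp add: gap_def)
      then show "H 0 a - h a = H 0 b - h b" using gap_area[OF gap] by simp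
    qed
    then show ?thesis using h(2) by simp
  qed
  \<comment> \<open>Above order 0 the lift has the derivatives that condition (2) prescribes for
    \<open>H\<close> on \<open>K\<close>.\<close>
  define hs where "hs k x = (if k = 0 then h x else horizontal_poly k (\<lambda>j. f j x) (\<lambda>j. g j x))" for k x
  have "smooth_seq m hs"
    unfolding hs_def[abs_def] by (rule smooth_seq_horizontal_poly[OF f(1) g(1) h(1) m])
  moreover have "hs 1 x = 2 * (f 1 x * g 0 x - g 1 x * f 0 x)" for x
    by (simp add: hs_def horizontal_poly_1 del: One_nat_def)
  moreover have "hs k x = H k x" if "x \<in> K" "k \<le> m" for k x
  proof (cases "k = 0")
    case False
    then have "hs k x = horizontal_poly k (\<lambda>j. f j x) (\<lambda>j. g j x)" by (simp add: hs_def)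
    also have "\<dots> = horizontal_poly k (\<lambda>j. F j x) (\<lambda>j. G j x)"
      using that by (intro horizontal_poly_cong) (auto simp: f g)
    finally show ?thesis using hp that False by simp
  qed (use hH that in \<open>simp add: hs_def\<close>)
  ultimately show ?thesis using f g by (intro exI[of _ f] exI[of _ g] exI[of _ hs]) simp
qed

theorem theorem1p1:
  fixes m :: nat and K :: "real set" and F G H :: "nat \<Rightarrow> real \<Rightarrow> real"
  assumes "m \<ge> 1" and "compact K"
    and "jet m K F" and "jet m K G" and "jet m K H"
  shows "(\<exists>f g h. extends_to_horizontal_curve m K F G H f g h) \<longleftrightarrow>
     (whitney_field m K F \<and> whitney_field m K G \<and> whitney_field m K H) \<and>
     (\<forall>k\<in>{1..m}. \<forall>t\<in>K. H k t = horizontal_poly k (\<lambda>j. F j t) (\<lambda>j. G j t)) \<and>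
     (\<forall>\<epsilon>>0. \<exists>\<delta>>0. \<forall>a\<in>K. \<forall>b\<in>K. 0 < b - a \<and> b - a < \<delta> \<longrightarrow>
        \<bar>area_discrepancy m F G H a b\<bar> \<le> \<epsilon> * velocity m F G a b)"
    (is "?L \<longleftrightarrow> ?R")
proof
  assume ?L
  then obtain f g h where "smooth_seq m f" "smooth_seq m g" "smooth_seq m h"
    "\<forall>x. h 1 x = 2 * (f 1 x * g 0 x - g 1 x * f 0 x)"
    "\<forall>x\<in>K. \<forall>k\<le>m. f k x = F k x \<and> g k x = G k x \<and> h k x = H k x"
    unfolding extends_iff_smooth_seq[OF assms(1)] by (elim exE conjE) (rule that)
  then show ?R by (rule horizontal_extension_conditions[OF assms])
next
  assume R: ?R
  show ?L
  proof (cases "K = {}")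
    \<comment> \<open>The empty set is treated apart, since the gluing takes \<open>Inf K\<close>
      and \<open>Sup K\<close> as points of \<open>K\<close>.\<close>
    case True
    have "smooth_seq m (\<lambda>k x. 0)" by (simp add: smooth_seq_def)
    then show ?thesis
      unfolding extends_iff_smooth_seq[OF assms(1)] using True
      by (intro exI[of _ "\<lambda>k x. 0"]) simp
  next
    case False
    from R show ?thesis
      unfolding extends_iff_smooth_seq[OF assms(1)]
      by (elim conjE) (rule horizontal_extension_exists[OF assms(1,2) False])
  qed
qed

end
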